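(* Let $1<p<\infty$ and let $g\in L^\infty(\mathbb T)$ satisfy $gg_\alpha=1$. Suppose $T(g):H^p\to H^p$ is Fredholm and $n:=\operatorname{ind}T(g)>0$, and let $g=g_-t^{-n}g_+$, $g_-(\infty)=1$, be the Wiener–Hopf factorization of $g$ in $H^p$. Then the following systems of functions $\mathcal B_\alpha^\pm(g)$ form bases of the spaces $\operatorname{im}\mathbf P_\alpha^\pm(g)$, respectively: (i) If $n=2m$, $m\in\mathbb N$, then $$\mathcal B_\alpha^\pm(g)=\{g_+^{-1}(\chi^{m-k-1}\pm\boldsymbol\sigma_\alpha(g)\chi^{m+k}):k=0,1,\dots,m-1\},$$ and $\dim\operatorname{im}\mathbf P_\alpha^\pm(g)=m$. (ii) If $n=2m+1$, $m\in\mathbb Z_{\ge0}$, then $$\mathcal B_\alpha^\pm(g)=\{g_+^{-1}(\chi^{m+k}\pm\boldsymbol\sigma_\alpha(g)\chi^{m-k}):k=0,1,\dots,m\}\setminus\{0\},$$ and $\dim\operatorname{im}\mathbf P_\alpha^\pm(g)=m+\dfrac{1\pm\boldsymbol\sigma_\alpha(g)}2$.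
   Context: $\mathbb T$ is the unit circle, $L^p=L^p(\mathbb T)$, $1/p+1/q=1$. $H^p=\{f\in L^p:\widehat f_n=0,\ n<0\}$, $\overline{H^p}=\{f\in L^p:\widehat f_n=0,\ n>0\}$; elements of $H^p$ are identified with their analytic extensions to the open unit disc, and for $f\in\overline{H^p}$, $f(\infty):=\widehat f_0$. $P:\sum_{n\in\mathbb Z}\widehat f_nt^n\mapsto\sum_{n\ge0}\widehat f_nt^n$ on $L^p$, $Q=I-P$, and $T(g)\varphi=P(g\varphi)$ on $H^p$. A Fredholm operator has closed range and finite-dimensional kernel and cokernel ($\operatorname{coker}A=\ker A^*$); $\operatorname{ind}A=\dim\ker A-\dim\operatorname{coker}A$. Fix $\beta\in\mathbb C$, $|\beta|>1$, $\lambda:=i\sqrt{|\beta|^2-1}$, $\alpha(t)=\dfrac{t-\beta}{\overline\beta t-1}$ (a map of $\mathbb T$ onto itself, $\alpha\circ\alpha=\mathrm{id}$), $g_\alpha:=g\circ\alpha$, $\chi(t):=(\overline\beta t-1)/\lambda$, and $J_\alpha\varphi(t):=\chi(t)^{-1}\varphi(\alpha(t))$. For $g\in L^\infty$ with $gg_\alpha=1$: $\mathbf P_\alpha(g):=J_\alpha QgP|_{\ker T(g)}$ maps $\ker T(g)$ to itself with square $I$, and $\mathbf P_\alpha^\pm(g):=\frac12(I\pm\mathbf P_\alpha(g))$ are complementary projections on $\ker T(g)$. Wiener–Hopf factorization of $g$ in $H^p$ (it exists and is unique when $T(g)$ is Fredholm on $H^p$ with index $n$): $g=g_-t^{-n}g_+$,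 $g_-(\infty)=1$, $g_+\in H^q$, $g_+^{-1}\in H^p$, $g_-\in\overline{H^p}$, $g_-^{-1}\in\overline{H^q}$, and $g_+^{-1}Pg_-^{-1}I$, defined on $\operatorname{span}\{t^k:k\ge0\}$, extends to a bounded operator on $H^p$. The $\alpha$-signature of $g$ is $\boldsymbol\sigma_\alpha(g):=(\lambda/\overline\beta)^n\,g_+^{-1}(1/\overline\beta)\in\{-1,1\}$. *)

theory Defs
  imports "HOL-Analysis.Analysis" "HOL-Library.Function_Algebras"
begin

section \<open>Functions on the unit circle modulo null sets\<close>

text \<open>Normalised arc length on the unit circle, regarded as a Borel measure on the whole
  complex plane. Values of functions off the circle are therefore irrelevant.\<close>

definition circle :: "complex measure" where
  "circle = distr (uniform_measure lborel {0..2*pi}) borel cis"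

lemma cis_measurable [measurable]: "cis \<in> borel_measurable borel"
  by (intro borel_measurable_continuous_onI continuous_intros)

lemma sets_circle [simp, measurable_cong]: "sets circle = sets borel"
  by (simp add: circle_def)

lemma space_circle [simp]: "space circle = UNIV"
  by (simp add: circle_def)

lemma emeasure_circle_UNIV: "emeasure circle UNIV = 1"
proof -
  have "emeasure circle UNIV = emeasure (uniform_measure lborel {0..2*pi}) UNIV"
    unfolding circle_def by (subst emeasure_distr) auto
  also have "\<dots> = 1"
    by (subst emeasure_uniform_measure) (auto intro!: ennreal_divide_self)
  finally show ?thesis .
qed

lemma null_sets_circle_iff:
  assumes N: "N \<in> sets borel"
  shows "N \<in> null_sets circle \<longleftrightarrow> negligible {x \<in> {0..2*pi}. cis x \<in> N}"
proof -
  have eq: "{0..2*pi} \<inter> cis -` N = {x \<in> {0..2*pi}. cis x \<in> N}"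
    by auto
  have m: "cis -` N \<in> sets borel"
    using measurable_sets[OF cis_measurable N] by simp
  then have ms: "{x \<in> {0..2*pi}. cis x \<in> N} \<in> sets lborel"
    unfolding eq[symmetric] by auto
  have "emeasure circle N = emeasure (uniform_measure lborel {0..2*pi}) (cis -` N)"
    unfolding circle_def using N by (subst emeasure_distr) auto
  also have "\<dots> = emeasure lborel {x \<in> {0..2*pi}. cis x \<in> N} / emeasure lborel {0..2*pi}"
    using m by (subst emeasure_uniform_measure) (auto simp: eq)
  finally have "emeasure circle N = 0 \<longleftrightarrow> emeasure lborel {x \<in> {0..2*pi}. cis x \<in> N} = 0"
    by (simp add: ennreal_divide_eq_0_iff)
  then have "N \<in> null_sets circle \<longleftrightarrow> {x \<in> {0..2*pi}. cis x \<in> N} \<in> null_sets lborel"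
    using N ms by (auto simp: null_sets_def)
  also have "\<dots> \<longleftrightarrow> negligible {x \<in> {0..2*pi}. cis x \<in> N}"
    using ms by (simp add: negligible_iff_null_sets null_sets_completion_iff)
  finally show ?thesis .
qed

definition ae_eq :: "(complex \<Rightarrow> complex) \<Rightarrow> (complex \<Rightarrow> complex) \<Rightarrow> bool" where
  "ae_eq f g \<longleftrightarrow> f \<in> borel_measurable circle \<and> g \<in> borel_measurable circle \<and>
     (AE t in circle. f t = g t)"

quotient_type L0 = "complex \<Rightarrow> complex" / partial: ae_eq
proof (rule part_equivpI)
  show "\<exists>f. ae_eq f f"
    by (rule exI[of _ "\<lambda>_. 0"]) (simp add: ae_eq_def)
  show "symp ae_eq"
    by (rule sympI) (auto simp: ae_eq_def elim: eventually_mono)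
  show "transp ae_eq"
    by (rule transpI) (auto simp: ae_eq_def elim: eventually_elim2)
qed

instantiation L0 :: comm_ring_1
begin
lift_definition zero_L0 :: L0 is "\<lambda>_. 0" by (simp add: ae_eq_def)
lift_definition one_L0 :: L0 is "\<lambda>_. 1" by (simp add: ae_eq_def)
lift_definition plus_L0 :: "L0 \<Rightarrow> L0 \<Rightarrow> L0" is "\<lambda>f g t. f t + g t"
  by (auto simp: ae_eq_def)
lift_definition minus_L0 :: "L0 \<Rightarrow> L0 \<Rightarrow> L0" is "\<lambda>f g t. f t - g t"
  by (auto simp: ae_eq_def)
lift_definition uminus_L0 :: "L0 \<Rightarrow> L0" is "\<lambda>f t. - f t"
  by (auto simp: ae_eq_def)
lift_definition times_L0 :: "L0 \<Rightarrow> L0 \<Rightarrow> L0" is "\<lambda>f g t. f t * g t"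
  by (auto simp: ae_eq_def)
instance
proof
  fix a b c :: L0
  show "a * b * c = a * (b * c)" by transfer (auto simp: ae_eq_def mult_ac)
  show "a * b = b * a" by transfer (auto simp: ae_eq_def mult_ac)
  show "1 * a = a" by transfer (auto simp: ae_eq_def)
  show "(a + b) * c = a * c + b * c" by transfer (auto simp: ae_eq_def algebra_simps)
  show "a + b + c = a + (b + c)" by transfer (auto simp: ae_eq_def)
  show "a + b = b + a" by transfer (auto simp: ae_eq_def)
  show "0 + a = a" by transfer (auto simp: ae_eq_def)
  show "- a + a = 0" by transfer (auto simp: ae_eq_def)
  show "a - b = a + - b" by transfer (auto simp: ae_eq_def)
  show "(0::L0) \<noteq> 1"
  proof (transfer, rule notI)
    assume "ae_eq (\<lambda>_. 0) (\<lambda>_. 1)"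
    then have "AE t in circle. False"
      by (simp add: ae_eq_def)
    then have "emeasure circle UNIV = 0"
      by (simp add: AE_iff_null_sets null_sets_def eventually_ae_filter) (metis space_circle top.extremum_unique UNIV_I subsetI top_greatest)
    then show False
      by (simp add: emeasure_circle_UNIV)
  qed
qed
end

text \<open>Pointwise reciprocal. A class \<open>f\<close> is nonzero almost everywhere iff
  \<open>f * inverse f = 1\<close>.\<close>

instantiation L0 :: inverse
begin
lift_definition inverse_L0 :: "L0 \<Rightarrow> L0" is "\<lambda>f t. inverse (f t)"
  by (auto simp: ae_eq_def)
lift_definition divide_L0 :: "L0 \<Rightarrow> L0 \<Rightarrow> L0" is "\<lambda>f g t. f t / g t"
  by (auto simp: ae_eq_def)
instance ..
end

lift_definition cscale :: "complex \<Rightarrow> L0 \<Rightarrow> L0" is "\<lambda>c f t. c * f t"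
  by (auto simp: ae_eq_def)

interpretation L0: vector_space cscale
proof
  fix a b :: complex and x y :: L0
  show "cscale a (x + y) = cscale a x + cscale a y"
    by transfer (auto simp: ae_eq_def algebra_simps)
  show "cscale (a + b) x = cscale a x + cscale b x"
    by transfer (auto simp: ae_eq_def algebra_simps)
  show "cscale a (cscale b x) = cscale (a * b) x"
    by transfer (auto simp: ae_eq_def algebra_simps)
  show "cscale 1 x = x"
    by transfer (auto simp: ae_eq_def)
qed

text \<open>The monomials \<open>t\<^sup>k\<close>, \<open>k\<close> an integer.\<close>

lift_definition tpow :: "int \<Rightarrow> L0" is "\<lambda>k t. t powi k"
  by (auto simp: ae_eq_def power_int_def)

section \<open>Lebesgue and Hardy spaces\<close>

lift_definition fourier :: "L0 \<Rightarrow> int \<Rightarrow> complex"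
  is "\<lambda>f n. \<integral>t. f t * t powi (- n) \<partial>circle"
proof -
  fix f g assume "ae_eq f g"
  then show "(\<lambda>n. \<integral>t. f t * t powi (- n) \<partial>circle) = (\<lambda>n. \<integral>t. g t * t powi (- n) \<partial>circle)"
    by (intro ext integral_cong_AE) (auto simp: ae_eq_def power_int_def)
qed

lift_definition lp_norm :: "real \<Rightarrow> L0 \<Rightarrow> real"
  is "\<lambda>p f. (\<integral>t. norm (f t) powr p \<partial>circle) powr (1 / p)"
proof -
  fix p :: real and f g assume "ae_eq f g"
  then have "(\<integral>t. norm (f t) powr p \<partial>circle) = (\<integral>t. norm (g t) powr p \<partial>circle)"
    by (intro integral_cong_AE) (auto simp: ae_eq_def)
  then show "(\<integral>t. norm (f t) powr p \<partial>circle) powr (1 / p) =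
      (\<integral>t. norm (g t) powr p \<partial>circle) powr (1 / p)"
    by simp
qed

lift_definition in_Lp :: "real \<Rightarrow> L0 \<Rightarrow> bool"
  is "\<lambda>p f. integrable circle (\<lambda>t. norm (f t) powr p)"
  by (intro integrable_cong_AE) (auto simp: ae_eq_def)

definition Lp :: "real \<Rightarrow> L0 set" where
  "Lp p = {f. in_Lp p f}"

lift_definition ess_bounded :: "L0 \<Rightarrow> bool"
  is "\<lambda>f. \<exists>C. AE t in circle. norm (f t) \<le> C"
proof -
  fix f g assume "ae_eq f g"
  then have ae: "AE t in circle. f t = g t"
    by (simp add: ae_eq_def)
  show "(\<exists>C. AE t in circle. norm (f t) \<le> C) = (\<exists>C. AE t in circle. norm (g t) \<le> C)"
    using ae by (intro ex_cong1 eventually_cong) (auto elim: eventually_mono)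
qed

definition Linf :: "L0 set" where
  "Linf = {f. ess_bounded f}"

definition Hp :: "real \<Rightarrow> L0 set" where
  "Hp p = {f \<in> Lp p. \<forall>n<0. fourier f n = 0}"

definition Hp_bar :: "real \<Rightarrow> L0 set" where
  "Hp_bar p = {f \<in> Lp p. \<forall>n>0. fourier f n = 0}"

definition disc_ext :: "L0 \<Rightarrow> complex \<Rightarrow> complex" where
  "disc_ext f z = (\<Sum>n. fourier f (int n) * z ^ n)"

definition at_infty :: "L0 \<Rightarrow> complex" where
  "at_infty f = fourier f 0"

text \<open>The Riesz projection. For \<open>f\<close> in \<open>Lp p\<close> with \<open>1 < p < \<infinity>\<close> the function \<open>h\<close> exists and lies
  in \<open>Lp p\<close> again (M. Riesz); it is unique because a function in \<open>Lp 1\<close> is determined by its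
  Fourier coefficients. So one definition serves all exponents.\<close>

definition riesz_P :: "L0 \<Rightarrow> L0" where
  "riesz_P f = (THE h. h \<in> Lp 1 \<and> (\<forall>n. fourier h n = (if n \<ge> 0 then fourier f n else 0)))"

definition riesz_Q :: "L0 \<Rightarrow> L0" where
  "riesz_Q f = f - riesz_P f"

definition toeplitz :: "L0 \<Rightarrow> L0 \<Rightarrow> L0" where
  "toeplitz g \<phi> = riesz_P (g * \<phi>)"

section \<open>Fredholm operators on \<open>Hp p\<close>\<close>

definition bounded_operator :: "real \<Rightarrow> (L0 \<Rightarrow> L0) \<Rightarrow> bool" where
  "bounded_operator p A \<longleftrightarrow>
     (\<forall>x\<in>Hp p. A x \<in> Hp p) \<and>
     (\<forall>x\<in>Hp p. \<forall>y\<in>Hp p. A (x + y) = A x + A y) \<and>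
     (\<forall>c. \<forall>x\<in>Hp p. A (cscale c x) = cscale c (A x)) \<and>
     (\<exists>C. \<forall>x\<in>Hp p. lp_norm p (A x) \<le> C * lp_norm p x)"

definition fun_scale :: "complex \<Rightarrow> (L0 \<Rightarrow> complex) \<Rightarrow> (L0 \<Rightarrow> complex)" where
  "fun_scale c l = (\<lambda>x. c * l x)"

interpretation fnl: vector_space fun_scale
  by unfold_locales (auto simp: fun_scale_def fun_eq_iff algebra_simps)

text \<open>The dual space; functionals are normalised to be \<open>0\<close> outside \<open>Hp p\<close>, so that equal
  functionals are equal as HOL functions.\<close>

definition dual_Hp :: "real \<Rightarrow> (L0 \<Rightarrow> complex) set" where
  "dual_Hp p = {l.
     (\<forall>x\<in>Hp p. \<forall>y\<in>Hp p. l (x + y) = l x + l y) \<and>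
     (\<forall>c. \<forall>x\<in>Hp p. l (cscale c x) = c * l x) \<and>
     (\<exists>C. \<forall>x\<in>Hp p. norm (l x) \<le> C * lp_norm p x) \<and>
     (\<forall>x. x \<notin> Hp p \<longrightarrow> l x = 0)}"

definition adjoint_Hp :: "real \<Rightarrow> (L0 \<Rightarrow> L0) \<Rightarrow> (L0 \<Rightarrow> complex) \<Rightarrow> (L0 \<Rightarrow> complex)" where
  "adjoint_Hp p A l = (\<lambda>x. if x \<in> Hp p then l (A x) else 0)"

definition ker_Hp :: "real \<Rightarrow> (L0 \<Rightarrow> L0) \<Rightarrow> L0 set" where
  "ker_Hp p A = {x \<in> Hp p. A x = 0}"

definition coker_Hp :: "real \<Rightarrow> (L0 \<Rightarrow> L0) \<Rightarrow> (L0 \<Rightarrow> complex) set" where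
  "coker_Hp p A = {l \<in> dual_Hp p. adjoint_Hp p A l = 0}"

definition fredholm :: "real \<Rightarrow> (L0 \<Rightarrow> L0) \<Rightarrow> bool" where
  "fredholm p A \<longleftrightarrow>
     bounded_operator p A \<and>
     closedin (Metric_space.mtopology (Hp p) (\<lambda>x y. lp_norm p (x - y))) (A ` Hp p) \<and>
     (\<exists>B. finite B \<and> ker_Hp p A \<subseteq> L0.span B) \<and>
     (\<exists>B. finite B \<and> coker_Hp p A \<subseteq> fnl.span B)"

definition fredholm_index :: "real \<Rightarrow> (L0 \<Rightarrow> L0) \<Rightarrow> int" where
  "fredholm_index p A = int (L0.dim (ker_Hp p A)) - int (fnl.dim (coker_Hp p A))"

section \<open>Wiener--Hopf factorization\<close>

text \<open>\<open>g = g\<^sub>- t\<^sup>-\<^sup>n g\<^sub>+\<close>, normalised by \<open>g\<^sub>-(\<infinity>) = 1\<close>. The conditions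
  \<open>gm * inverse gm = 1\<close> and \<open>gp * inverse gp = 1\<close> make \<open>inverse\<close> a genuine reciprocal.\<close>

definition wiener_hopf :: "real \<Rightarrow> L0 \<Rightarrow> int \<Rightarrow> L0 \<Rightarrow> L0 \<Rightarrow> bool" where
  "wiener_hopf p g n gm gp \<longleftrightarrow>
     (let q = p / (p - 1) in
       g = gm * tpow (- n) * gp \<and> at_infty gm = 1 \<and>
       gm * inverse gm = 1 \<and> gp * inverse gp = 1 \<and>
       gp \<in> Hp q \<and> inverse gp \<in> Hp p \<and>
       gm \<in> Hp_bar p \<and> inverse gm \<in> Hp_bar q \<and>
       (\<exists>B. bounded_operator p B \<and>
         (\<forall>\<phi> \<in> L0.span (range (\<lambda>k::nat. tpow (int k))).
            B \<phi> = inverse gp * riesz_P (inverse gm * \<phi>))))"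

section \<open>The Carleman shift \<open>\<alpha>\<close>\<close>

definition lam :: "complex \<Rightarrow> complex" where
  "lam \<beta> = \<i> * complex_of_real (sqrt ((cmod \<beta>)\<^sup>2 - 1))"

definition alpha :: "complex \<Rightarrow> complex \<Rightarrow> complex" where
  "alpha \<beta> t = (t - \<beta>) / (cnj \<beta> * t - 1)"

definition comp_alpha :: "complex \<Rightarrow> L0 \<Rightarrow> L0" where
  "comp_alpha \<beta> f = abs_L0 (\<lambda>t. rep_L0 f (alpha \<beta> t))"

lemma alpha_measurable [measurable]: "alpha \<beta> \<in> borel_measurable borel"
  unfolding alpha_def by measurable

lemma alpha_circle:
  assumes "1 < cmod \<beta>" "cmod t = 1"
  shows "cnj \<beta> * t \<noteq> 1" "cmod (alpha \<beta> t) = 1" "alpha \<beta> (alpha \<beta> t) = t"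
proof -
  show nz: "cnj \<beta> * t \<noteq> 1"
  proof
    assume "cnj \<beta> * t = 1"
    then have "cmod (cnj \<beta> * t) = 1" by simp
    with assms show False by (simp add: norm_mult)
  qed
  have tt: "t * cnj t = 1"
    using assms by (simp add: complex_norm_square[symmetric])
  have "t * (cnj \<beta> - cnj t) = cnj \<beta> * t - 1"
    using tt by (simp add: algebra_simps)
  then have "cmod (cnj \<beta> * t - 1) = cmod t * cmod (cnj (\<beta> - t))"
    by (metis complex_cnj_diff norm_mult)
  also have "\<dots> = cmod (t - \<beta>)"
    unfolding complex_mod_cnj using assms by (simp add: norm_minus_commute)
  finally have "cmod (t - \<beta>) = cmod (cnj \<beta> * t - 1)" by simp
  moreover have "cmod (cnj \<beta> * t - 1) \<noteq> 0" using nz by simp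
  ultimately show "cmod (alpha \<beta> t) = 1"
    by (simp only: alpha_def norm_divide) simp
  have b: "1 - cnj \<beta> * \<beta> \<noteq> 0"
  proof
    assume "1 - cnj \<beta> * \<beta> = 0"
    then have "cmod (cnj \<beta> * \<beta>) = 1" by simp
    then have "cmod \<beta> * cmod \<beta> = 1" by (simp add: norm_mult)
    with assms show False
      by (metis less_irrefl less_1_mult)
  qed
  define d where "d = cnj \<beta> * t - 1"
  have d: "d \<noteq> 0" using nz by (simp add: d_def)
  have n1: "alpha \<beta> t - \<beta> = t * (1 - cnj \<beta> * \<beta>) / d"
    using d by (simp add: alpha_def d_def divide_simps) (simp add: algebra_simps)
  have n2: "cnj \<beta> * alpha \<beta> t - 1 = (1 - cnj \<beta> * \<beta>) / d"
    using d by (simp add: alpha_def d_def divide_simps) (simp add: algebra_simps)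
  show "alpha \<beta> (alpha \<beta> t) = t"
    unfolding alpha_def[of \<beta> "alpha \<beta> t"] n1 n2 using b d by simp
qed

lemma null_sets_alpha:
  assumes \<beta>: "1 < cmod \<beta>" and N: "N \<in> null_sets circle"
  shows "alpha \<beta> -` N \<in> null_sets circle"
proof -
  have Nb: "N \<in> sets borel" using N by (auto simp: null_sets_def)
  define S where "S = {x \<in> {0..2*pi}. cis x \<in> N}"
  define h where "h x = Im (Ln (- alpha \<beta> (cis x))) + pi" for x
  define S' where "S' = {x \<in> S. alpha \<beta> (cis x) \<noteq> 1}"
  have "negligible S"
    using N Nb by (simp add: S_def null_sets_circle_iff)
  then have nS': "negligible S'"
    by (rule negligible_subset) (auto simp: S'_def)
  have "negligible (h ` S')"
  proof (rule negligible_differentiable_image_negligible[OF order_refl nS'])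
    show "h differentiable_on S'"
      unfolding differentiable_on_def
    proof
      fix x assume x: "x \<in> S'"
      have nz: "cnj \<beta> * cis x \<noteq> 1"
        using alpha_circle(1)[OF \<beta>, of "cis x"] by simp
      have c1: "cmod (alpha \<beta> (cis x)) = 1"
        using alpha_circle(2)[OF \<beta>, of "cis x"] by simp
      have np: "- alpha \<beta> (cis x) \<notin> \<real>\<^sub>\<le>\<^sub>0"
      proof
        assume "- alpha \<beta> (cis x) \<in> \<real>\<^sub>\<le>\<^sub>0"
        then have "alpha \<beta> (cis x) = 1"
          using c1 by (auto simp: complex_nonpos_Reals_iff complex_eq_iff cmod_def)
        with x show False by (simp add: S'_def)
      qed
      have d1: "cis differentiable (at x)"
        using has_derivative_cis[OF has_derivative_ident, of x UNIV] differentiableI by auto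
      have d2: "(\<lambda>z. Ln (- alpha \<beta> z)) field_differentiable (at (cis x))"
      proof -
        have a: "(\<lambda>z. - alpha \<beta> z) field_differentiable (at (cis x))"
          unfolding alpha_def using nz by (intro derivative_intros) auto
        have b: "Ln field_differentiable (at (- alpha \<beta> (cis x)))"
          using np by (rule field_differentiable_at_Ln)
        from field_differentiable_compose[OF a b] show ?thesis
          by (simp add: o_def)
      qed
      have "((\<lambda>z. Ln (- alpha \<beta> z)) \<circ> cis) differentiable (at x)"
        using d1 field_differentiable_imp_differentiable[OF d2]
        by (rule differentiable_chain_at)
      then obtain D where D: "((\<lambda>x. Ln (- alpha \<beta> (cis x))) has_derivative D) (at x)"
        by (auto simp: differentiable_def o_def)
      have "(h has_derivative (\<lambda>v. Im (D v))) (at x)"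
        unfolding h_def
        by (rule has_derivative_eq_rhs, rule has_derivative_add[OF
              bounded_linear.has_derivative[OF bounded_linear_Im D] has_derivative_const]) simp
      then show "h differentiable (at x within S')"
        using differentiableI differentiable_at_withinI by blast
    qed
  qed
  then have neg: "negligible (h ` S' \<union> {0, 2*pi})"
    by (simp add: negligible_Un negligible_finite)
  have "{x \<in> {0..2*pi}. cis x \<in> alpha \<beta> -` N} \<subseteq> h ` S' \<union> {0, 2*pi}"
  proof
    fix x assume "x \<in> {x \<in> {0..2*pi}. cis x \<in> alpha \<beta> -` N}"
    then have x: "0 \<le> x" "x \<le> 2*pi" and xN: "alpha \<beta> (cis x) \<in> N" by auto
    show "x \<in> h ` S' \<union> {0, 2*pi}"
    proof (cases "x = 0 \<or> x = 2*pi")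
      case False
      with x have x': "0 < x" "x < 2*pi" by auto
      define y where "y = Arg2pi (alpha \<beta> (cis x))"
      have cy: "cis y = alpha \<beta> (cis x)"
        using alpha_circle(2)[OF \<beta>, of "cis x"]
        by (metis y_def Arg2pi_eq cis_conv_exp mult_1 norm_cis of_real_1)
      have ay: "alpha \<beta> (cis y) = cis x"
        unfolding cy using alpha_circle(3)[OF \<beta>, of "cis x"] by simp
      have A: "Arg2pi (cis x) = x"
        using x' by (intro Arg2pi_unique[of 1]) (auto simp: cis_conv_exp)
      have "h y = Im (Ln (- cis x)) + pi"
        by (simp add: h_def ay)
      also have "\<dots> = x"
        using Arg2pi_Ln[of "cis x"] A x' by simp
      finally have hy: "h y = x" .
      have "cis x \<noteq> 1"
      proof
        assume "cis x = 1"
        then have "Arg2pi (cis x) = 0"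
          using Arg2pi_unique[of 1 0 "cis x"] by simp
        with A x' show False by simp
      qed
      then have "y \<in> S'"
        using xN cy ay Arg2pi_ge_0[of "alpha \<beta> (cis x)"] Arg2pi_lt_2pi[of "alpha \<beta> (cis x)"]
        by (auto simp: S'_def S_def y_def)
      with hy show ?thesis by blast
    qed auto
  qed
  then have "negligible {x \<in> {0..2*pi}. cis x \<in> alpha \<beta> -` N}"
    using neg negligible_subset by blast
  moreover have "alpha \<beta> -` N \<in> sets borel"
    using measurable_sets[OF alpha_measurable Nb] by simp
  ultimately show ?thesis
    by (simp add: null_sets_circle_iff)
qed

text \<open>\<open>comp_alpha\<close> does not depend on the representative.\<close>

lemma comp_alpha_abs:
  assumes \<beta>: "1 < cmod \<beta>" and f: "f \<in> borel_measurable borel"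
  shows "comp_alpha \<beta> (abs_L0 f) = abs_L0 (\<lambda>t. f (alpha \<beta> t))"
proof -
  have ff: "ae_eq f f"
    using f by (simp add: ae_eq_def cong: measurable_cong_sets)
  have r: "ae_eq (rep_L0 (abs_L0 f)) f"
    by (rule rep_abs_rsp_left[OF Quotient3_L0, OF ff])
  then have rm: "rep_L0 (abs_L0 f) \<in> borel_measurable borel"
    and ae: "AE t in circle. rep_L0 (abs_L0 f) t = f t"
    by (auto simp: ae_eq_def cong: measurable_cong_sets)
  from ae obtain N where N: "N \<in> null_sets circle"
    "{t. rep_L0 (abs_L0 f) t \<noteq> f t} \<subseteq> N"
    by (auto simp: eventually_ae_filter)
  have "AE t in circle. rep_L0 (abs_L0 f) (alpha \<beta> t) = f (alpha \<beta> t)"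
    by (rule AE_I'[OF null_sets_alpha[OF \<beta> N(1)]]) (use N(2) in auto)
  then have "ae_eq (\<lambda>t. rep_L0 (abs_L0 f) (alpha \<beta> t)) (\<lambda>t. f (alpha \<beta> t))"
    using f rm measurable_compose[OF alpha_measurable f]
      measurable_compose[OF alpha_measurable rm]
    by (simp add: ae_eq_def cong: measurable_cong_sets)
  then show ?thesis
    unfolding comp_alpha_def by (rule Quotient3_rel_abs[OF Quotient3_L0])
qed

lift_definition chi :: "complex \<Rightarrow> L0" is "\<lambda>\<beta> t. (cnj \<beta> * t - 1) / lam \<beta>"
  by (auto simp: ae_eq_def)

definition J_alpha :: "complex \<Rightarrow> L0 \<Rightarrow> L0" where
  "J_alpha \<beta> \<phi> = inverse (chi \<beta>) * comp_alpha \<beta> \<phi>"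

text \<open>\<open>P_alpha\<close> is meant on the kernel of \<open>toeplitz g\<close>; \<open>P_alpha_proj \<beta> g s\<close> with \<open>s = 1\<close> or
  \<open>s = -1\<close> is the projection carrying the sign \<open>s\<close>.\<close>

definition P_alpha :: "complex \<Rightarrow> L0 \<Rightarrow> L0 \<Rightarrow> L0" where
  "P_alpha \<beta> g \<phi> = J_alpha \<beta> (riesz_Q (g * riesz_P \<phi>))"

definition P_alpha_proj :: "complex \<Rightarrow> L0 \<Rightarrow> complex \<Rightarrow> L0 \<Rightarrow> L0" where
  "P_alpha_proj \<beta> g s \<phi> = cscale (1/2) (\<phi> + cscale s (P_alpha \<beta> g \<phi>))"

definition im_P_alpha :: "real \<Rightarrow> complex \<Rightarrow> L0 \<Rightarrow> complex \<Rightarrow> L0 set" where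
  "im_P_alpha p \<beta> g s = P_alpha_proj \<beta> g s ` ker_Hp p (toeplitz g)"

text \<open>The signature of \<open>g\<close>, expressed through the index \<open>n\<close> and the factor \<open>g\<^sub>+\<close>.\<close>

definition alpha_signature :: "complex \<Rightarrow> int \<Rightarrow> L0 \<Rightarrow> complex" where
  "alpha_signature \<beta> n gp = (lam \<beta> / cnj \<beta>) powi n * disc_ext (inverse gp) (1 / cnj \<beta>)"

definition is_basis :: "L0 set \<Rightarrow> L0 set \<Rightarrow> bool" where
  "is_basis B V \<longleftrightarrow> L0.independent B \<and> L0.span B = V"

end

theory Submission
  imports Defs
begin

text \<open>Since \<open>P(g\<phi>) = 0\<close> forces \<open>g\<^sub>+ \<phi> = t\<^sup>n g\<^sub>-\<^sup>-\<^sup>1 (g \<phi>)\<close> to have all its frequencies in \<open>{0..n-1}\<close>,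
  the kernel of \<open>T(g)\<close> consists of the products of \<open>g\<^sub>+\<^sup>-\<^sup>1\<close> with polynomials of degree less than \<open>n\<close>,
  and \<open>e\<^sub>j = g\<^sub>+\<^sup>-\<^sup>1 \<chi>\<^sup>j\<close>, \<open>j < n\<close>, is a basis of it. Rewriting \<open>g g\<^sub>\<alpha> = 1\<close> with the factorization
  gives a function that is analytic both inside and outside the disc, so
  \<open>g\<^sub>+ (g\<^sub>-)\<^sub>\<alpha> = c (t - \<beta>)\<^sup>n\<close>; hence the operator \<open>P\<^sub>\<alpha>(g)\<close> sends \<open>e\<^sub>j\<close> to \<open>c \<lambda>\<^sup>n e\<^bsub>n-1-j\<^esub>\<close>. Evaluation at
  \<open>1 / cnj \<beta>\<close>, which \<open>\<alpha>\<close> exchanges with infinity, shows that \<open>c \<lambda>\<^sup>n\<close> is inverse to the signature,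
  and it equals the signature because \<open>P\<^sub>\<alpha>(g)\<close> is an involution. The images of the two projections are
  spanned by the systems \<open>e\<^sub>j \<plusminus> \<sigma> e\<^bsub>n-1-j\<^esub>\<close>; these have together at most \<open>n\<close> elements and span the
  kernel, so both are independent.\<close>

section \<open>Measures on the circle and their moments\<close>

text \<open>Function theory would settle two facts at once: a product of analytic factors with
  conjugate exponents has one-sided spectrum, and composition with \<alpha> exchanges the two sides.
  Here an element is only a class with Fourier coefficients, so both are proved on coefficients. For
  general p the convolution of two coefficient sequences need not converge absolutely; that all its
  terms vanish is passed to the product through a continuous correlation function instead. As for
  the shift, \<alpha> is a quotient of linear factors, one with its zero outside the disc and one
  with its zero inside. Dividing by such a factor is a one-step recursion, and boundedness of the
  coefficients excludes the growing solution. The change of variables by \<alpha> has a Poisson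
  kernel as density, found by comparing moments instead of differentiating. Evaluation at
  \<open>1 / cnj \<beta>\<close> is a mean against a Cauchy kernel, which agrees with the Poisson
  kernel on analytic functions.\<close>

interpretation circle: finite_measure circle
  by standard (simp add: emeasure_circle_UNIV)

lemma integral_circle:
  fixes f :: "complex \<Rightarrow> 'b::{banach, second_countable_topology}"
  assumes [measurable]: "f \<in> borel_measurable borel"
  shows "integral\<^sup>L circle f
    = (1 / (2 * pi)) *\<^sub>R (\<integral>x. indicator {0..2*pi} x *\<^sub>R f (cis x) \<partial>lborel)"
proof -
  have "integral\<^sup>L circle f = (\<integral>x. f (cis x) \<partial>uniform_measure lborel {0..2*pi})"
    unfolding circle_def by (rule integral_distr) auto
  also have "\<dots> = (\<integral>x. f (cis x) \<partial>density lborel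
      (\<lambda>x. ennreal (indicator {0..2*pi} x / (2 * pi))))"
    unfolding uniform_measure_def
    by (intro arg_cong2[where f="integral\<^sup>L"] density_cong)
       (auto simp: divide_ennreal[symmetric] ennreal_indicator)
  also have "\<dots> = (\<integral>x. (indicator {0..2*pi} x / (2 * pi)) *\<^sub>R f (cis x) \<partial>lborel)"
    by (rule integral_density) auto
  also have "\<dots> = (\<integral>x. (1 / (2 * pi)) *\<^sub>R (indicator {0..2*pi} x *\<^sub>R f (cis x)) \<partial>lborel)"
    by (simp add: field_simps)
  also have "\<dots> = (1 / (2 * pi)) *\<^sub>R (\<integral>x. indicator {0..2*pi} x *\<^sub>R f (cis x) \<partial>lborel)"
    by (rule integral_scaleR_right)
  finally show ?thesis .
qed

lemma AE_circle_norm: "AE t in circle. cmod t = 1"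
  unfolding circle_def by (subst AE_distr_iff) auto

lemma powi_measurable [measurable]: "(\<lambda>t::complex. t powi k) \<in> borel_measurable borel"
  by (auto simp: power_int_def)

lemma circle_moment: "(\<integral>t. t powi k \<partial>circle) = (if k = 0 then 1 else 0)"
proof (cases "k = 0")
  case True
  then show ?thesis
    by (simp add: measure_def emeasure_circle_UNIV)
next
  case False
  define F where "F x = cis (real_of_int k * x) / (\<i> * of_int k)" for x
  have "(\<integral>x. indicator {0..2*pi} x *\<^sub>R cis (real_of_int k * x) \<partial>lborel) = F (2*pi) - F 0"
  proof (rule integral_FTC_Icc)
    fix x :: real
    have "(cis has_vector_derivative (\<i> * cis (real_of_int k * x)))
        (at (real_of_int k * x) within (*) (real_of_int k) ` {0..2*pi})"
      by (auto intro!: derivative_eq_intros simp: has_vector_derivative_def scaleR_conv_of_real)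
    moreover have "((*) (real_of_int k) has_vector_derivative real_of_int k) (at x within {0..2*pi})"
      unfolding has_real_derivative_iff_has_vector_derivative[symmetric]
      by (auto intro!: derivative_eq_intros)
    ultimately have "((\<lambda>x. cis (real_of_int k * x)) has_vector_derivative
        real_of_int k *\<^sub>R (\<i> * cis (real_of_int k * x))) (at x within {0..2*pi})"
      using vector_diff_chain_within[of "(*) (real_of_int k)" "real_of_int k"] by (simp add: o_def)
    from has_vector_derivative_divide[OF this, of "\<i> * of_int k"]
    show "(F has_vector_derivative cis (real_of_int k * x)) (at x within {0..2*pi})"
      unfolding F_def using False by (simp add: scaleR_conv_of_real)
  qed (auto intro!: continuous_intros)
  also have "\<dots> = 0"
    using cis_multiple_2pi[of "real_of_int k"] by (simp add: F_def mult_ac)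
  finally show ?thesis
    using False by (subst integral_circle) (auto simp: cis_power_int mult_ac)
qed

text \<open>On the circle a polynomial in \<open>Re t\<close> and \<open>Im t\<close> is a Laurent polynomial in \<open>t\<close>, hence it
  multiplies the bounded functions all of whose moments agree for \<open>M\<close> and \<open>N\<close>. By
  Stone--Weierstrass this reaches every continuous function.\<close>

lemma circle_moments_determine_integral:
  fixes M N :: "complex measure" and \<phi> :: "complex \<Rightarrow> real"
  assumes M: "finite_measure M" "sets M = sets borel" "AE t in M. cmod t = 1"
    and N: "finite_measure N" "sets N = sets borel" "AE t in N. cmod t = 1"
    and mom: "\<And>k::int. (\<integral>t. t powi k \<partial>M) = (\<integral>t. t powi k \<partial>N)"
    and \<phi>: "continuous_on UNIV \<phi>"
  shows "(\<integral>t. \<phi> t \<partial>M) = (\<integral>t. \<phi> t \<partial>N)"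
proof -
  interpret M: finite_measure M by fact
  interpret N: finite_measure N by fact
  have [measurable_cong]: "sets M = sets borel" "sets N = sets borel" by fact+
  define bdd :: "(complex \<Rightarrow> complex) \<Rightarrow> bool" where
    "bdd \<psi> \<longleftrightarrow> \<psi> \<in> borel_measurable borel \<and> (\<exists>C. \<forall>t. cmod t = 1 \<longrightarrow> cmod (\<psi> t) \<le> C)" for \<psi>
  have bdd_int: "integrable M \<psi>" "integrable N \<psi>" if "bdd \<psi>" for \<psi>
  proof -
    from that obtain C where C: "\<And>t. cmod t = 1 \<Longrightarrow> cmod (\<psi> t) \<le> C"
      and [measurable]: "\<psi> \<in> borel_measurable borel"
      by (auto simp: bdd_def)
    show "integrable M \<psi>"
      by (rule M.integrable_const_bound[where B=C]) (use M(3) C in \<open>auto elim: eventually_mono\<close>)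
    show "integrable N \<psi>"
      by (rule N.integrable_const_bound[where B=C]) (use N(3) C in \<open>auto elim: eventually_mono\<close>)
  qed
  have bdd_mult: "bdd (\<lambda>t. \<psi> t * \<theta> t)" if "bdd \<psi>" "bdd \<theta>" for \<psi> \<theta>
  proof -
    from that obtain C D where "\<And>t. cmod t = 1 \<Longrightarrow> cmod (\<psi> t) \<le> C"
      "\<And>t. cmod t = 1 \<Longrightarrow> cmod (\<theta> t) \<le> D"
      and [measurable]: "\<psi> \<in> borel_measurable borel" "\<theta> \<in> borel_measurable borel"
      by (auto simp: bdd_def)
    then have "\<forall>t. cmod t = 1 \<longrightarrow> cmod (\<psi> t * \<theta> t) \<le> \<bar>C\<bar> * \<bar>D\<bar>"
      by (auto simp: norm_mult intro!: mult_mono intro: order_trans[OF _ abs_ge_self])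
    then show ?thesis by (auto simp: bdd_def)
  qed
  have bdd_add: "bdd (\<lambda>t. \<psi> t + \<theta> t)" if "bdd \<psi>" "bdd \<theta>" for \<psi> \<theta>
  proof -
    from that obtain C D where "\<And>t. cmod t = 1 \<Longrightarrow> cmod (\<psi> t) \<le> C"
      "\<And>t. cmod t = 1 \<Longrightarrow> cmod (\<theta> t) \<le> D"
      and [measurable]: "\<psi> \<in> borel_measurable borel" "\<theta> \<in> borel_measurable borel"
      by (auto simp: bdd_def)
    then have "\<forall>t. cmod t = 1 \<longrightarrow> cmod (\<psi> t + \<theta> t) \<le> C + D"
      by (auto intro!: norm_triangle_mono)
    then show ?thesis by (auto simp: bdd_def)
  qed
  have bdd_powi: "bdd (\<lambda>t. t powi k)" for k
    by (auto simp: bdd_def norm_power_int intro!: exI[of _ 1])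
  have bdd_const: "bdd (\<lambda>t. c)" for c
    by (auto simp: bdd_def)
  define G where "G \<psi> \<longleftrightarrow> bdd \<psi> \<and> (\<forall>k::int. (\<integral>t. \<psi> t * t powi k \<partial>M) = (\<integral>t. \<psi> t * t powi k \<partial>N))"
    for \<psi>
  have G_add: "G (\<lambda>t. \<psi> t + \<theta> t)" if "G \<psi>" "G \<theta>" for \<psi> \<theta>
    using that bdd_add[of \<psi> \<theta>] bdd_int[OF bdd_mult[OF _ bdd_powi]]
    by (auto simp: G_def ring_distribs)
  have G_scale: "G (\<lambda>t. c * \<psi> t)" if "G \<psi>" for \<psi> c
    using that bdd_mult[OF bdd_const[of c]] by (auto simp: G_def mult.assoc)
  \<comment> \<open>Identities such as \<open>t powi (-1) = cnj t\<close> hold on the circle only,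
    so \<open>G\<close> must be insensitive to values elsewhere.\<close>
  have G_cong: "G \<theta>" if G: "G \<psi>" and e: "\<And>t. cmod t = 1 \<Longrightarrow> \<psi> t = \<theta> t"
    and [measurable]: "\<theta> \<in> borel_measurable borel" for \<psi> \<theta>
  proof -
    have [measurable]: "\<psi> \<in> borel_measurable borel" using G by (auto simp: G_def bdd_def)
    have "bdd \<theta>" using G e by (auto simp: G_def bdd_def)
    moreover have "(\<integral>t. \<psi> t * t powi k \<partial>M) = (\<integral>t. \<theta> t * t powi k \<partial>M)" for k
      by (intro integral_cong_AE) (use M(3) e in \<open>auto elim: eventually_mono\<close>)
    moreover have "(\<integral>t. \<psi> t * t powi k \<partial>N) = (\<integral>t. \<theta> t * t powi k \<partial>N)" for k
      by (intro integral_cong_AE) (use N(3) e in \<open>auto elim: eventually_mono\<close>)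
    ultimately show ?thesis using G by (simp add: G_def)
  qed
  have powi_add: "t powi k * t powi j = t powi (k + j)" if "cmod t = 1" for t :: complex and k j
  proof -
    from that have "t \<noteq> 0" by auto
    then show ?thesis by (simp add: power_int_add)
  qed
  have G_powi: "G (\<lambda>t. \<psi> t * t powi k)" if "G \<psi>" for \<psi> k
  proof -
    have [measurable]: "\<psi> \<in> borel_measurable borel" using that by (auto simp: G_def bdd_def)
    have "(\<integral>t. \<psi> t * t powi k * t powi j \<partial>M) = (\<integral>t. \<psi> t * t powi (k + j) \<partial>M)" for j
      by (intro integral_cong_AE)
         (use M(3) in \<open>auto elim!: eventually_mono simp: mult.assoc powi_add\<close>)
    moreover have "(\<integral>t. \<psi> t * t powi k * t powi j \<partial>N) = (\<integral>t. \<psi> t * t powi (k + j) \<partial>N)" for j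
      by (intro integral_cong_AE)
         (use N(3) in \<open>auto elim!: eventually_mono simp: mult.assoc powi_add\<close>)
    ultimately show ?thesis
      using that bdd_mult[OF _ bdd_powi] by (simp add: G_def)
  qed
  have inv: "t powi (-1) = cnj t" if "cmod t = 1" for t
    using that complex_div_cnj[of 1 t] by (simp add: power_int_minus field_simps)
  have mult: "G (\<lambda>t. of_real (f t) * \<psi> t)" if "real_polynomial_function f" "G \<psi>" for f \<psi>
    using that
  proof (induction arbitrary: \<psi>)
    case (linear f)
    \<comment> \<open>A real-linear f satisfies \<open>f t = Re t * f 1 + Im t * f \<i>\<close>;
      expressing \<open>Re t\<close> and \<open>Im t\<close> by t and \<open>cnj t\<close> gives the
      coefficients a and b.\<close>
    define a where "a = (of_real (f 1) - \<i> * of_real (f \<i>)) / (2::complex)"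
    define b where "b = (of_real (f 1) + \<i> * of_real (f \<i>)) / (2::complex)"
    have fm[measurable]: "f \<in> borel_measurable borel"
      using linear by (intro borel_measurable_continuous_onI linear_continuous_on) auto
    have [measurable]: "\<psi> \<in> borel_measurable borel" using linear by (auto simp: G_def bdd_def)
    have f: "of_real (f t) = a * t + b * cnj t" for t
    proof -
      have "f t = f (Re t *\<^sub>R 1 + Im t *\<^sub>R \<i>)"
        by (rule arg_cong[where f=f]) (simp add: complex_eq_iff)
      also have "\<dots> = Re t * f 1 + Im t * f \<i>"
        using linear(1) by (simp add: bounded_linear.linear linear_add linear_scale)
      finally show ?thesis
        by (simp add: a_def b_def complex_eq_iff field_simps)
    qed
    have "G (\<lambda>t. a * (\<psi> t * t powi 1) + b * (\<psi> t * t powi (-1)))"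
      by (intro G_add G_scale G_powi linear)
    then show ?case
    proof (rule G_cong)
      fix t :: complex assume "cmod t = 1"
      from inv[OF this] show "a * (\<psi> t * t powi 1) + b * (\<psi> t * t powi (-1)) = of_real (f t) * \<psi> t"
        unfolding f by (simp add: algebra_simps)
    qed measurable
  next
    case (const c)
    then show ?case by (rule G_scale)
  next
    case (add f g)
    then show ?case using G_add[of "\<lambda>t. of_real (f t) * \<psi> t" "\<lambda>t. of_real (g t) * \<psi> t"]
      by (simp add: ring_distribs)
  next
    case (mult f g)
    then show ?case by (simp add: mult.assoc)
  qed
  have G1: "G (\<lambda>_. 1)"
    using mom bdd_const by (simp add: G_def)
  have poly_eq: "(\<integral>t. f t \<partial>M) = (\<integral>t. f t \<partial>N)" if "real_polynomial_function f" for f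
  proof -
    have "(\<integral>t. complex_of_real (f t) \<partial>M) = (\<integral>t. complex_of_real (f t) \<partial>N)"
      using mult[OF that G1] by (auto simp: G_def dest: spec[of _ 0])
    then show ?thesis by (simp add: integral_complex_of_real)
  qed
  have \<phi>m[measurable]: "\<phi> \<in> borel_measurable borel"
    using \<phi> by (rule borel_measurable_continuous_onI)
  have cs: "compact (sphere (0::complex) 1)" by simp
  have bound: "\<bar>(\<integral>t. \<phi> t \<partial>L) - (\<integral>t. f t \<partial>L)\<bar> \<le> e * measure L (space L)"
    if L: "finite_measure L" "sets L = sets borel" "AE t in L. cmod t = 1"
      and f: "\<And>t. t \<in> sphere 0 1 \<Longrightarrow> \<bar>\<phi> t - f t\<bar> < e" "real_polynomial_function f" for f e L
  proof -
    interpret L: finite_measure L by fact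
    have [measurable_cong]: "sets L = sets borel" by fact
    have cf: "continuous_on UNIV f"
      using f(2) by (simp add: continuous_real_polymonial_function continuous_at_imp_continuous_on)
    have cint: "integrable L h" if h: "continuous_on UNIV h" for h :: "complex \<Rightarrow> real"
    proof -
      have [measurable]: "h \<in> borel_measurable borel"
        using h by (rule borel_measurable_continuous_onI)
      have "bounded (h ` sphere 0 1)"
        using h cs by (intro compact_imp_bounded compact_continuous_image continuous_on_subset[OF h]) auto
      then obtain B where "\<forall>t\<in>sphere 0 1. \<bar>h t\<bar> \<le> B"
        by (auto simp: bounded_iff)
      then show ?thesis
        by (intro L.integrable_const_bound[where B=B]) (use L(3) in \<open>auto elim: eventually_mono\<close>)
    qed
    have "\<bar>(\<integral>t. \<phi> t \<partial>L) - (\<integral>t. f t \<partial>L)\<bar> = \<bar>\<integral>t. \<phi> t - f t \<partial>L\<bar>"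
      using cint[OF \<phi>] cint[OF cf] by simp
    also have "\<dots> \<le> (\<integral>t. \<bar>\<phi> t - f t\<bar> \<partial>L)"
      by (rule integral_abs_bound)
    also have "\<dots> \<le> (\<integral>t. e \<partial>L)"
      using cint[OF \<phi>] cint[OF cf] f(1) L(3)
      by (intro integral_mono_AE) (auto elim!: eventually_mono intro: less_imp_le)
    finally show ?thesis by (simp add: mult.commute)
  qed
  have "\<bar>(\<integral>t. \<phi> t \<partial>M) - (\<integral>t. \<phi> t \<partial>N)\<bar> \<le> 0"
  proof (rule field_le_epsilon)
    fix e :: real assume e: "e > 0"
    \<comment> \<open>The summand 1 keeps \<open>K\<close> positive even if both measures are
      zero.\<close>
    define K where "K = measure M (space M) + measure N (space N) + 1"
    have K: "K > 0" by (simp add: K_def add_nonneg_pos)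
    obtain f where f: "real_polynomial_function f" "\<And>t. t \<in> sphere 0 1 \<Longrightarrow> \<bar>\<phi> t - f t\<bar> < e / K"
      using Stone_Weierstrass_real_polynomial_function[OF cs continuous_on_subset[OF \<phi>], of "e / K"] e K
      by auto
    have "\<bar>(\<integral>t. \<phi> t \<partial>M) - (\<integral>t. \<phi> t \<partial>N)\<bar> \<le>
        e / K * measure M (space M) + e / K * measure N (space N)"
      using bound[OF M f(2,1)] bound[OF N f(2,1)] poly_eq[OF f(1)] by linarith
    also have "\<dots> = e / K * (K - 1)" by (simp add: K_def ring_distribs)
    also have "\<dots> \<le> 0 + e" using e K by (simp add: field_simps)
    finally show "\<bar>(\<integral>t. \<phi> t \<partial>M) - (\<integral>t. \<phi> t \<partial>N)\<bar> \<le> 0 + e" .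
  qed
  then show ?thesis by simp
qed

text \<open>Off a closed set the distance is positive, so the bump is eventually zero there.
  Nonemptiness matters: \<open>infdist t {}\<close> is 0, which would make the bumps constantly
  1.\<close>

lemma closed_indicator_approx:
  fixes K :: "'a::metric_space set"
  assumes "closed K" "K \<noteq> {}"
  shows "(\<lambda>n. max 0 (1 - real n * infdist t K)) \<longlonglongrightarrow> indicator K t"
proof (cases "t \<in> K")
  case True
  then show ?thesis by simp
next
  case False
  then have d: "infdist t K > 0"
    using assms in_closed_iff_infdist_zero[of K t] infdist_nonneg[of t K] by fastforce
  have "eventually (\<lambda>n. max 0 (1 - real n * infdist t K) = indicator K t) sequentially"
    using eventually_ge_at_top[of "nat \<lceil>1 / infdist t K\<rceil>"]
  proof eventually_elim
    case (elim n)
    then have "1 / infdist t K \<le> real n" by linarith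
    then show ?case using d False by (simp add: field_simps)
  qed
  then show ?thesis by (rule tendsto_eventually)
qed

lemma continuous_closed_indicator_approx:
  "continuous_on UNIV (\<lambda>t. max 0 (1 - real n * infdist t K))"
  by (intro continuous_intros)

text \<open>The bumps of a closed set are continuous and dominated by 1, so equality of their
  integrals passes to the measure of the set, and closed sets form an intersection-stable generator.
  It is applied to rotations, to the positive and negative parts of a function, and to the image of
  arc length under \<alpha>.\<close>

theorem circle_moments_determine_measure:
  fixes M N :: "complex measure"
  assumes M: "finite_measure M" "sets M = sets borel" "AE t in M. cmod t = 1"
    and N: "finite_measure N" "sets N = sets borel" "AE t in N. cmod t = 1"
    and mom: "\<And>k::int. (\<integral>t. t powi k \<partial>M) = (\<integral>t. t powi k \<partial>N)"
  shows "M = N"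
proof -
  interpret M: finite_measure M by fact
  interpret N: finite_measure N by fact
  have [measurable_cong]: "sets M = sets borel" "sets N = sets borel" by fact+
  have lim: "(\<lambda>n. \<integral>t. max 0 (1 - real n * infdist t K) \<partial>L) \<longlonglongrightarrow> measure L K"
    if K: "closed K" "K \<noteq> {}" and L: "finite_measure L" "sets L = sets borel" for K and L :: "complex measure"
  proof -
    interpret L: finite_measure L by fact
    have [measurable_cong]: "sets L = sets borel" by fact
    have [measurable]: "K \<in> sets borel" using K by auto
    have "(\<lambda>n. \<integral>t. max 0 (1 - real n * infdist t K) \<partial>L) \<longlonglongrightarrow> (\<integral>t. indicator K t \<partial>L)"
    proof (rule integral_dominated_convergence[where w="\<lambda>_. 1"])
      show "(\<lambda>t. max 0 (1 - real n * infdist t K)) \<in> borel_measurable L" for n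
        using continuous_closed_indicator_approx[THEN borel_measurable_continuous_onI] L(2)
        by (simp cong: measurable_cong_sets)
    qed (use closed_indicator_approx[OF K] in \<open>auto simp: infdist_nonneg\<close>)
    then show ?thesis using L(2) sets_eq_imp_space_eq[OF L(2)] by simp
  qed
  have eq: "measure M K = measure N K" if K: "closed K" for K
  proof (cases "K = {}")
    case False
    have e: "(\<integral>t. max 0 (1 - real n * infdist t K) \<partial>M) = (\<integral>t. max 0 (1 - real n * infdist t K) \<partial>N)" for n
      by (rule circle_moments_determine_integral[OF M N mom continuous_closed_indicator_approx])
    show ?thesis
      using LIMSEQ_unique[OF lim[OF K False M(1,2), unfolded e] lim[OF K False N(1,2)]] .
  qed simp
  show ?thesis
  proof (rule measure_eqI_generator_eq[where E="Collect closed" and A="\<lambda>_. UNIV" and \<Omega>=UNIV])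
    show "Int_stable (Collect (closed :: complex set \<Rightarrow> bool))"
      by (auto simp: Int_stable_def)
    show "sets M = sigma_sets UNIV (Collect closed)" "sets N = sigma_sets UNIV (Collect closed)"
      using M(2) N(2) by (simp_all add: borel_eq_closed)
  qed (use eq in \<open>auto simp: M.emeasure_eq_measure N.emeasure_eq_measure\<close>)
qed

section \<open>Rotation invariance, and functions with vanishing moments\<close>

lemma cnj_mult_unit: "cmod s = 1 \<Longrightarrow> cnj s * s = 1" "cmod s = 1 \<Longrightarrow> s * cnj s = 1"
  by (simp_all add: complex_norm_square[symmetric] mult.commute)

text \<open>Rotation multiplies the k-th moment by \<open>s powi k\<close>, which changes nothing
  because only the moment with k = 0 is nonzero.\<close>

lemma circle_rotation:
  assumes s: "cmod s = 1"
  shows "distr circle borel (\<lambda>t. t * s) = circle"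
proof (rule circle_moments_determine_measure)
  show "finite_measure (distr circle borel (\<lambda>t. t * s))"
    by (rule circle.finite_measure_distr) simp
  show "AE t in distr circle borel (\<lambda>t. t * s). cmod t = 1"
    using AE_circle_norm s by (subst AE_distr_iff) (auto elim: eventually_mono simp: norm_mult)
  show "(\<integral>t. t powi k \<partial>distr circle borel (\<lambda>t. t * s)) = (\<integral>t. t powi k \<partial>circle)" for k
    by (subst integral_distr) (auto simp: power_int_mult_distrib circle_moment)
qed (simp_all add: circle.finite_measure_axioms AE_circle_norm)

lemma integral_rotation:
  fixes f :: "complex \<Rightarrow> 'b::{banach, second_countable_topology}"
  assumes "cmod s = 1" "f \<in> borel_measurable borel"
  shows "(\<integral>t. f (t * s) \<partial>circle) = integral\<^sup>L circle f"
  using integral_distr[of "\<lambda>t. t * s" circle borel f] assms by (simp add: circle_rotation)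

lemma integrable_rotation:
  fixes f :: "complex \<Rightarrow> 'b::{banach, second_countable_topology}"
  assumes "cmod s = 1" "f \<in> borel_measurable borel"
  shows "integrable circle (\<lambda>t. f (t * s)) \<longleftrightarrow> integrable circle f"
  using integrable_distr_eq[of "\<lambda>t. t * s" circle borel f] assms by (simp add: circle_rotation)

text \<open>The positive and the negative part are densities of two finite measures with equal
  moments, so they agree almost everywhere; as one of them is always 0, both vanish.\<close>

lemma AE_zero_if_moments_zero_real:
  fixes f :: "complex \<Rightarrow> real"
  assumes f: "integrable circle f"
    and mom: "\<And>k::int. (\<integral>t. f t *\<^sub>R t powi k \<partial>circle) = 0"
  shows "AE t in circle. f t = 0"
proof -
  have [measurable]: "f \<in> borel_measurable borel"
    using f by (auto cong: measurable_cong_sets)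
  define P where "P t = max 0 (f t)" for t
  define N where "N t = max 0 (- f t)" for t
  have [measurable]: "P \<in> borel_measurable borel" "N \<in> borel_measurable borel"
    by (auto simp: P_def[abs_def] N_def[abs_def])
  have int: "integrable circle P" "integrable circle N"
    using f by (auto simp: P_def[abs_def] N_def[abs_def])
  have intk: "integrable circle (\<lambda>t. P t *\<^sub>R t powi k)" "integrable circle (\<lambda>t. N t *\<^sub>R t powi k)" for k
  proof -
    have ae: "AE t in circle. cmod (t powi k) = 1"
      using AE_circle_norm by eventually_elim (simp add: norm_power_int)
    show "integrable circle (\<lambda>t. P t *\<^sub>R t powi k)"
      by (rule Bochner_Integration.integrable_bound[OF int(1)]) (use ae in auto)
    show "integrable circle (\<lambda>t. N t *\<^sub>R t powi k)"
      by (rule Bochner_Integration.integrable_bound[OF int(2)]) (use ae in auto)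
  qed
  have "density circle P = density circle N"
  proof (rule circle_moments_determine_measure)
    have fin: "finite_measure (density circle R)"
      if R: "integrable circle R" "\<And>t. R t \<ge> 0" for R :: "complex \<Rightarrow> real"
    proof
      have [measurable]: "R \<in> borel_measurable circle" using R by auto
      show "emeasure (density circle (\<lambda>t. ennreal (R t))) (space (density circle (\<lambda>t. ennreal (R t)))) \<noteq> \<infinity>"
        using R nn_integral_eq_integral[OF R(1)] by (simp add: emeasure_density)
    qed
    show "finite_measure (density circle P)" "finite_measure (density circle N)"
      using fin[OF int(1)] fin[OF int(2)] by (auto simp: P_def N_def)
    show "AE t in density circle P. cmod t = 1" "AE t in density circle N. cmod t = 1"
      using AE_circle_norm by (auto simp: AE_density elim: eventually_mono)
    fix k :: int
    have "(\<integral>t. P t *\<^sub>R t powi k \<partial>circle) - (\<integral>t. N t *\<^sub>R t powi k \<partial>circle)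
        = (\<integral>t. P t *\<^sub>R t powi k - N t *\<^sub>R t powi k \<partial>circle)"
      using intk by simp
    also have "\<dots> = (\<integral>t. f t *\<^sub>R t powi k \<partial>circle)"
      by (rule Bochner_Integration.integral_cong)
         (auto simp: P_def N_def scaleR_diff_left[symmetric] max_def)
    finally have "(\<integral>t. P t *\<^sub>R t powi k \<partial>circle) = (\<integral>t. N t *\<^sub>R t powi k \<partial>circle)"
      using mom by simp
    then show "(\<integral>t. t powi k \<partial>density circle P) = (\<integral>t. t powi k \<partial>density circle N)"
      by (subst (1 2) integral_density) (auto simp: P_def N_def)
  qed simp_all
  then have "AE t in circle. ennreal (P t) = ennreal (N t)"
    by (subst (asm) circle.density_unique_iff) auto
  then show ?thesis
    by eventually_elim (auto simp: P_def N_def max_def split: if_splits)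
qed

lemma integrable_powi_mult:
  fixes f :: "complex \<Rightarrow> complex"
  assumes "integrable circle f"
  shows "integrable circle (\<lambda>t. f t * t powi k)"
  by (rule Bochner_Integration.integrable_bound[OF assms])
     (use AE_circle_norm assms in
       \<open>auto elim!: eventually_mono simp: norm_mult norm_power_int\<close>)

lemma cnj_measurable [measurable]: "cnj \<in> borel_measurable borel"
  by (intro borel_measurable_continuous_onI continuous_intros)

text \<open>On the circle the k-th moment of the conjugate of f is the conjugate of the moment of f
  at -k. So the moments of the real and the imaginary part vanish too.\<close>

lemma AE_zero_if_moments_zero:
  fixes f :: "complex \<Rightarrow> complex"
  assumes f: "integrable circle f"
    and mom: "\<And>k::int. (\<integral>t. f t * t powi k \<partial>circle) = 0"
  shows "AE t in circle. f t = 0"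
proof -
  have [measurable]: "f \<in> borel_measurable borel"
    using f by (auto cong: measurable_cong_sets)
  have cmom: "(\<integral>t. cnj (f t) * t powi k \<partial>circle) = 0" for k
  proof -
    have "(\<integral>t. cnj (f t) * t powi k \<partial>circle) = (\<integral>t. cnj (f t * t powi (- k)) \<partial>circle)"
    proof (rule integral_cong_AE)
      show "AE t in circle. cnj (f t) * t powi k = cnj (f t * t powi - k)"
        using AE_circle_norm
      proof eventually_elim
        case (elim t)
        then have "cnj t = inverse t"
          using cnj_mult_unit(1)[OF elim] by (metis inverse_unique mult.commute)
        then have "cnj (t powi - k) = t powi k"
          by (simp add: power_int_inverse power_int_minus)
        then show ?case by simp
      qed
    qed auto
    also have "\<dots> = 0" using mom[of "-k"] by (simp del: complex_cnj_mult)
    finally show ?thesis .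
  qed
  have "AE t in circle. Re (f t) = 0"
  proof (rule AE_zero_if_moments_zero_real)
    fix k
    have "(\<integral>t. Re (f t) *\<^sub>R t powi k \<partial>circle)
      = (\<integral>t. (f t * t powi k + cnj (f t) * t powi k) / 2 \<partial>circle)"
      by (rule Bochner_Integration.integral_cong)
         (auto simp: scaleR_conv_of_real complex_add_cnj ring_distribs[symmetric])
    also have "\<dots> = 0"
      using integrable_powi_mult[OF f, of k] integrable_powi_mult[of "\<lambda>t. cnj (f t)" k] f mom cmom by simp
    finally show "(\<integral>t. Re (f t) *\<^sub>R t powi k \<partial>circle) = 0" .
  qed (use f in auto)
  moreover have "AE t in circle. Im (f t) = 0"
  proof (rule AE_zero_if_moments_zero_real)
    fix k
    have "(\<integral>t. Im (f t) *\<^sub>R t powi k \<partial>circle)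
      = (\<integral>t. (f t * t powi k - cnj (f t) * t powi k) / (2 * \<i>) \<partial>circle)"
    proof (rule Bochner_Integration.integral_cong)
      fix t
      have "Im (f t) *\<^sub>R t powi k = (f t - cnj (f t)) * t powi k / (2 * \<i>)"
        by (simp add: complex_diff_cnj scaleR_conv_of_real complex_eq_iff)
      then show "Im (f t) *\<^sub>R t powi k = (f t * t powi k - cnj (f t) * t powi k) / (2 * \<i>)"
        by (simp add: left_diff_distrib)
    qed simp
    also have "\<dots> = 0"
      using integrable_powi_mult[OF f, of k] integrable_powi_mult[of "\<lambda>t. cnj (f t)" k] f mom cmom by simp
    finally show "(\<integral>t. Im (f t) *\<^sub>R t powi k \<partial>circle) = 0" .
  qed (use f in auto)
  ultimately show ?thesis by eventually_elim (simp add: complex_eq_iff)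
qed

section \<open>Density of the continuous functions in L1\<close>

definition L1_approximable :: "(complex \<Rightarrow> complex) \<Rightarrow> bool" where
  "L1_approximable f \<longleftrightarrow> (\<forall>e>0. \<exists>\<psi>. continuous_on UNIV \<psi> \<and> integrable circle \<psi>
     \<and> (\<integral>t. cmod (f t - \<psi> t) \<partial>circle) < e)"

lemma L1_approximable_limit:
  assumes f: "integrable circle f"
    and s: "\<And>n. integrable circle (s n)" "\<And>n. L1_approximable (s n)"
    and lim: "(\<lambda>n. \<integral>t. cmod (f t - s n t) \<partial>circle) \<longlonglongrightarrow> 0"
  shows "L1_approximable f"
  unfolding L1_approximable_def
proof (intro allI impI)
  fix e :: real assume e: "e > 0"
  then have "eventually (\<lambda>n. (\<integral>t. cmod (f t - s n t) \<partial>circle) < e / 2) sequentially"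
    using lim by (intro order_tendstoD) auto
  then obtain n where n: "(\<integral>t. cmod (f t - s n t) \<partial>circle) < e / 2"
    by (auto simp: eventually_sequentially)
  obtain \<psi> where \<psi>: "continuous_on UNIV \<psi>" "integrable circle \<psi>"
      "(\<integral>t. cmod (s n t - \<psi> t) \<partial>circle) < e / 2"
    using s(2)[of n] e unfolding L1_approximable_def by (meson half_gt_zero)
  have "(\<integral>t. cmod (f t - \<psi> t) \<partial>circle)
      \<le> (\<integral>t. cmod (f t - s n t) + cmod (s n t - \<psi> t) \<partial>circle)"
    using f s \<psi> by (intro integral_mono) (auto intro: norm_triangle_le norm_diff_triangle_le)
  also have "\<dots> < e" using n \<psi> f s by simp
  finally show "\<exists>\<psi>. continuous_on UNIV \<psi> \<and> integrable circle \<psi> \<and> (\<integral>t. cmod (f t - \<psi> t) \<partial>circle) < e"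
    using \<psi> by auto
qed

text \<open>Indicators are approached in two stages: inner regularity replaces a Borel set by a
  closed subset, and the distance bumps replace a closed set by continuous functions.\<close>

lemma integrable_L1_approximable:
  assumes "integrable circle f"
  shows "L1_approximable f"
  using assms
proof (induction rule: integrable_induct)
  case (base A c)
  have Ab: "A \<in> sets borel" using base by simp
  have zero: "L1_approximable (\<lambda>_. 0)"
    unfolding L1_approximable_def by (auto intro!: exI[of _ "\<lambda>_. 0"])
  have closed: "L1_approximable (\<lambda>t. indicator K t *\<^sub>R c)" if K: "closed K" for K
  proof (cases "K = {}")
    case False
    define s where "s n t = max 0 (1 - real n * infdist t K) *\<^sub>R c" for n t
    have cont: "continuous_on UNIV (s n)" for n
      unfolding s_def by (intro continuous_intros)
    have [measurable]: "s n \<in> borel_measurable borel" for n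
      using cont by (rule borel_measurable_continuous_onI)
    have [measurable]: "K \<in> sets borel" using K by auto
    have bd: "cmod (s n t) \<le> cmod c" for n t
      by (auto simp: s_def infdist_nonneg intro!: mult_left_le_one_le)
    have int: "integrable circle (s n)" for n
      by (rule circle.integrable_const_bound[where B="cmod c"]) (use bd in auto)
    show ?thesis
    proof (rule L1_approximable_limit)
      show "L1_approximable (s n)" for n
        unfolding L1_approximable_def using cont int by (auto intro!: exI[of _ "s n"])
      have "(\<lambda>n. \<integral>t. cmod (indicator K t *\<^sub>R c - s n t) \<partial>circle) \<longlonglongrightarrow> (\<integral>t. 0 \<partial>circle)"
      proof (rule integral_dominated_convergence[where w="\<lambda>_. 2 * cmod c"])
        show "AE t in circle. (\<lambda>n. cmod (indicator K t *\<^sub>R c - s n t)) \<longlonglongrightarrow> 0"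
        proof (rule AE_I2)
          fix t
          have "(\<lambda>n. cmod (indicator K t *\<^sub>R c - s n t)) \<longlonglongrightarrow> cmod (indicator K t *\<^sub>R c - indicator K t *\<^sub>R c)"
            unfolding s_def by (intro tendsto_intros closed_indicator_approx K False)
          then show "(\<lambda>n. cmod (indicator K t *\<^sub>R c - s n t)) \<longlonglongrightarrow> 0" by simp
        qed
        show "AE t in circle. norm (cmod (indicator K t *\<^sub>R c - s n t)) \<le> 2 * cmod c" for n
        proof (rule AE_I2)
          fix t
          have "cmod (indicator K t *\<^sub>R c) \<le> cmod c" by (auto simp: indicator_def)
          then show "norm (cmod (indicator K t *\<^sub>R c - s n t)) \<le> 2 * cmod c"
            using norm_triangle_ineq4[of "indicator K t *\<^sub>R c" "s n t"] bd[of n t] by simp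
        qed
      qed auto
      then show "(\<lambda>n. \<integral>t. cmod (indicator K t *\<^sub>R c - s n t) \<partial>circle) \<longlonglongrightarrow> 0" by simp
    qed (use int base K in \<open>auto intro!: integrable_scaleR_left integrable_real_indicator simp: circle.emeasure_eq_measure\<close>)
  qed (simp add: zero)
  have "\<exists>K. closed K \<and> K \<subseteq> A \<and> measure circle A < measure circle K + inverse (real (Suc n))" for n
  proof -
    have "emeasure circle A = (SUP K \<in> {K. K \<subseteq> A \<and> compact K}. emeasure circle K)"
      by (rule inner_regular) (use Ab in \<open>auto simp: emeasure_circle_UNIV\<close>)
    moreover have "emeasure circle A < emeasure circle A + ennreal (inverse (real (Suc n)))"
      by (auto simp: circle.emeasure_eq_measure ennreal_plus[symmetric] simp del: ennreal_plus intro!: ennreal_lessI add_nonneg_pos)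
    ultimately have "\<exists>K\<in>{K. K \<subseteq> A \<and> compact K}. emeasure circle A < emeasure circle K + ennreal (inverse (real (Suc n)))"
      by (intro SUP_approx_ennreal) auto
    then obtain K where K: "K \<subseteq> A" "compact K"
      "emeasure circle A < emeasure circle K + ennreal (inverse (real (Suc n)))"
      by auto
    from K(3) have "measure circle A < measure circle K + inverse (real (Suc n))"
      by (simp add: circle.emeasure_eq_measure ennreal_plus[symmetric] ennreal_less_iff del: ennreal_plus)
    with K show ?thesis using compact_imp_closed by blast
  qed
  then obtain K where K: "\<And>n. closed (K n)" "\<And>n. K n \<subseteq> A"
    "\<And>n. measure circle A < measure circle (K n) + inverse (real (Suc n))"
    by metis
  have Kb[measurable]: "K n \<in> sets borel" for n using K(1) by auto
  show ?case
  proof (rule L1_approximable_limit[where s="\<lambda>n t. indicator (K n) t *\<^sub>R c"])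
    have eq: "(\<integral>t. cmod (indicator A t *\<^sub>R c - indicator (K n) t *\<^sub>R c) \<partial>circle)
      = cmod c * (measure circle A - measure circle (K n))" for n
    proof -
      have "(\<integral>t. cmod (indicator A t *\<^sub>R c - indicator (K n) t *\<^sub>R c) \<partial>circle)
        = (\<integral>t. cmod c * (indicator A t - indicator (K n) t) \<partial>circle)"
        by (rule Bochner_Integration.integral_cong) (use K(2)[of n] in \<open>auto simp: indicator_def\<close>)
      also have "\<dots> = cmod c * (measure circle A - measure circle (K n))"
        using Ab Kb[of n] by (simp add: circle.emeasure_eq_measure)
      finally show ?thesis .
    qed
    have "(\<lambda>n. measure circle A - measure circle (K n)) \<longlonglongrightarrow> 0"
    proof (rule tendsto_sandwich[OF _ _ tendsto_const LIMSEQ_inverse_real_of_nat])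
      show "\<forall>\<^sub>F n in sequentially. 0 \<le> measure circle A - measure circle (K n)"
        using K(2) Ab by (auto intro!: always_eventually circle.finite_measure_mono)
      show "\<forall>\<^sub>F n in sequentially. measure circle A - measure circle (K n) \<le> inverse (real (Suc n))"
        using K(3) by (intro always_eventually allI) (simp add: less_imp_le algebra_simps)
    qed
    then show "(\<lambda>n. \<integral>t. cmod (indicator A t *\<^sub>R c - indicator (K n) t *\<^sub>R c) \<partial>circle) \<longlonglongrightarrow> 0"
      unfolding eq by (auto intro: tendsto_mult_right_zero)
  qed (use closed K(1) Ab Kb in \<open>auto intro!: integrable_scaleR_left integrable_real_indicator simp: circle.emeasure_eq_measure\<close>)
next
  case (add f g)
  show ?case
    unfolding L1_approximable_def
  proof (intro allI impI)
    fix e :: real assume e: "e > 0"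
    then have e2: "e / 2 > 0" by simp
    obtain \<phi> where \<phi>: "continuous_on UNIV \<phi>" "integrable circle \<phi>" "(\<integral>t. cmod (f t - \<phi> t) \<partial>circle) < e / 2"
      using add(3) e2 unfolding L1_approximable_def by blast
    obtain \<psi> where \<psi>: "continuous_on UNIV \<psi>" "integrable circle \<psi>" "(\<integral>t. cmod (g t - \<psi> t) \<partial>circle) < e / 2"
      using add(4) e2 unfolding L1_approximable_def by blast
    have "(\<integral>t. cmod (f t + g t - (\<phi> t + \<psi> t)) \<partial>circle)
        \<le> (\<integral>t. cmod (f t - \<phi> t) + cmod (g t - \<psi> t) \<partial>circle)"
      using \<phi> \<psi> add by (intro integral_mono) (auto intro: norm_diff_triangle_ineq)
    also have "\<dots> < e" using \<phi> \<psi> add by simp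
    finally show "\<exists>\<psi>. continuous_on UNIV \<psi> \<and> integrable circle \<psi> \<and> (\<integral>t. cmod (f t + g t - \<psi> t) \<partial>circle) < e"
      using \<phi> \<psi> by (intro exI[of _ "\<lambda>t. \<phi> t + \<psi> t"]) (auto intro!: continuous_intros)
  qed
next
  case (lim f s)
  show ?case
  proof (rule L1_approximable_limit[of f s])
    have [measurable]: "f \<in> borel_measurable circle" "s n \<in> borel_measurable circle" for n
      using lim by auto
    have "(\<lambda>n. \<integral>t. cmod (f t - s n t) \<partial>circle) \<longlonglongrightarrow> (\<integral>t. 0 \<partial>circle)"
    proof (rule integral_dominated_convergence[where w="\<lambda>t. 3 * cmod (f t)"])
      show "AE t in circle. (\<lambda>n. cmod (f t - s n t)) \<longlonglongrightarrow> 0"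
      proof (rule AE_I2)
        fix t assume "t \<in> space circle"
        from tendsto_norm[OF tendsto_diff[OF tendsto_const lim(2)[OF this], of "f t"]]
        show "(\<lambda>n. cmod (f t - s n t)) \<longlonglongrightarrow> 0" by simp
      qed
      \<comment> \<open>The induction rule bounds \<open>s n t\<close> by twice \<open>f t\<close>
        in modulus, and 3 = 1 + 2.\<close>
      show "AE t in circle. norm (cmod (f t - s n t)) \<le> 3 * cmod (f t)" for n
        using lim(3)[of _ n] norm_triangle_ineq4[of "f _" "s n _"]
        by (intro AE_I2) (smt (verit) norm_ge_zero real_norm_def)
    qed (use lim in auto)
    then show "(\<lambda>n. \<integral>t. cmod (f t - s n t) \<partial>circle) \<longlonglongrightarrow> 0" by simp
  qed (use lim in auto)
qed

section \<open>Products of functions with one-sided spectrum\<close>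

text \<open>Rotating the variable moves s from the merely measurable h to f. For continuous f,
  dominated convergence then gives continuity in s; approximating f in L1 changes the correlation by
  at most C times the error, uniformly in s.\<close>

lemma continuous_correlation_bounded:
  assumes f: "integrable circle f"
    and [measurable]: "h \<in> borel_measurable borel" and h: "\<And>t. cmod (h t) \<le> C"
  shows "continuous_on (sphere 0 1) (\<lambda>s. \<integral>t. f t * h (t * s) \<partial>circle)"
proof -
  have C: "C \<ge> 0" using order_trans[OF norm_ge_zero h] .
  define F where "F f s = (\<integral>t. f (t * cnj s) * h t \<partial>circle)" for f s
  have Feq: "(\<integral>t. f t * h (t * s) \<partial>circle) = F f s" if s: "s \<in> sphere 0 1" and f: "integrable circle f" for f s
  proof -
    have [measurable]: "f \<in> borel_measurable borel" using f by (auto cong: measurable_cong_sets)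
    have "F f s = (\<integral>t. f (t * s * cnj s) * h (t * s) \<partial>circle)"
      unfolding F_def using s by (subst integral_rotation[of s, symmetric]) auto
    then show ?thesis using s by (simp add: mult.assoc cnj_mult_unit)
  qed
  have cont: "continuous_on (sphere 0 1) (F \<psi>)" if \<psi>: "continuous_on UNIV \<psi>" for \<psi>
  proof -
    have [measurable]: "\<psi> \<in> borel_measurable borel"
      using \<psi> by (rule borel_measurable_continuous_onI)
    have "bounded (\<psi> ` sphere 0 1)"
      using \<psi> by (intro compact_imp_bounded compact_continuous_image continuous_on_subset[OF \<psi>]) auto
    then obtain B where B: "\<forall>t\<in>sphere 0 1. cmod (\<psi> t) \<le> B"
      by (auto simp: bounded_iff)
    have B0: "B \<ge> 0" using order_trans[OF norm_ge_zero bspec[OF B, of 1]] by simp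
    show ?thesis
      unfolding continuous_on_sequentially
    proof safe
      fix x :: "nat \<Rightarrow> complex" and a
      assume a: "a \<in> sphere 0 1" and x: "\<forall>n. x n \<in> sphere 0 1" and lim: "x \<longlonglongrightarrow> a"
      have "(\<lambda>n. \<integral>t. \<psi> (t * cnj (x n)) * h t \<partial>circle) \<longlonglongrightarrow> (\<integral>t. \<psi> (t * cnj a) * h t \<partial>circle)"
      proof (rule integral_dominated_convergence[where w="\<lambda>_. B * C"])
        show "AE t in circle. (\<lambda>n. \<psi> (t * cnj (x n)) * h t) \<longlonglongrightarrow> \<psi> (t * cnj a) * h t"
        proof (rule AE_I2)
          fix t
          have "isCont \<psi> (t * cnj a)" using \<psi> by (simp add: continuous_on_eq_continuous_at)
          then show "(\<lambda>n. \<psi> (t * cnj (x n)) * h t) \<longlonglongrightarrow> \<psi> (t * cnj a) * h t"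
            by (intro tendsto_mult tendsto_const isCont_tendsto_compose[where g=\<psi>] tendsto_cnj lim)
        qed
        show "AE t in circle. cmod (\<psi> (t * cnj (x n)) * h t) \<le> B * C" for n
          using AE_circle_norm
        proof eventually_elim
          case (elim t)
          then have "t * cnj (x n) \<in> sphere 0 1" using x by (auto simp: norm_mult)
          then show ?case using B B0 h[of t] by (auto simp: norm_mult intro!: mult_mono)
        qed
      qed auto
      then show "((F \<psi>) \<circ> x) \<longlonglongrightarrow> F \<psi> a" by (simp add: F_def o_def)
    qed
  qed
  have "\<exists>\<psi>. continuous_on UNIV \<psi> \<and> integrable circle \<psi> \<and> (\<integral>t. cmod (f t - \<psi> t) \<partial>circle) < inverse (real (Suc n))" for n
    using integrable_L1_approximable[OF f] by (simp add: L1_approximable_def)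
  then obtain \<psi> where \<psi>: "\<And>n. continuous_on UNIV (\<psi> n)" "\<And>n. integrable circle (\<psi> n)"
    "\<And>n. (\<integral>t. cmod (f t - \<psi> n t) \<partial>circle) < inverse (real (Suc n))"
    by metis
  have bd: "cmod (F (\<psi> n) s - F f s) \<le> C * inverse (real (Suc n))" if s: "s \<in> sphere 0 1" for n s
  proof -
    have int: "integrable circle (\<lambda>t. g t * h (t * s))" if g: "integrable circle g" for g
    proof (rule Bochner_Integration.integrable_bound[of circle "\<lambda>t. C * cmod (g t)"])
      show "AE t in circle. cmod (g t * h (t * s)) \<le> norm (C * cmod (g t))"
        using h C by (intro AE_I2) (auto simp: norm_mult mult.commute[of C] intro!: mult_left_mono)
    qed (use g in auto)
    have "F (\<psi> n) s - F f s = (\<integral>t. \<psi> n t * h (t * s) - f t * h (t * s) \<partial>circle)"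
      using int[OF f] int[OF \<psi>(2)] s f \<psi>(2) by (simp flip: Feq)
    also have "cmod \<dots> \<le> (\<integral>t. C * cmod (f t - \<psi> n t) \<partial>circle)"
    proof (rule Bochner_Integration.integral_norm_bound_integral)
      fix t
      have "cmod (\<psi> n t * h (t * s) - f t * h (t * s)) = cmod (h (t * s)) * cmod (f t - \<psi> n t)"
        by (metis left_diff_distrib mult.commute norm_minus_commute norm_mult)
      also have "\<dots> \<le> C * cmod (f t - \<psi> n t)" using h by (intro mult_right_mono) auto
      finally show "cmod (\<psi> n t * h (t * s) - f t * h (t * s)) \<le> C * cmod (f t - \<psi> n t)" .
    qed (use int[OF f] int[OF \<psi>(2)] f \<psi> in auto)
    also have "\<dots> \<le> C * inverse (real (Suc n))"
      using C \<psi>(3)[of n] by (auto intro!: mult_left_mono)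
    finally show ?thesis .
  qed
  have "uniform_limit (sphere 0 1) (\<lambda>n. F (\<psi> n)) (F f) sequentially"
  proof (rule uniform_limitI)
    fix e :: real assume e: "e > 0"
    have "(\<lambda>n. C * inverse (real (Suc n))) \<longlonglongrightarrow> 0"
      by (intro tendsto_mult_right_zero LIMSEQ_inverse_real_of_nat)
    then have "eventually (\<lambda>n. C * inverse (real (Suc n)) < e) sequentially"
      using e by (intro order_tendstoD)
    then show "\<forall>\<^sub>F n in sequentially. \<forall>s\<in>sphere 0 1. dist (F (\<psi> n) s) (F f s) < e"
      by eventually_elim (use bd in \<open>simp only: dist_norm, blast intro: le_less_trans\<close>)
  qed
  then have "continuous_on (sphere 0 1) (F f)"
    by (rule uniform_limit_theorem[rotated]) (use cont \<psi> in auto)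
  then show ?thesis
    by (rule continuous_on_cong[THEN iffD1, rotated -1]) (use Feq f in auto)
qed

context
  fixes p q :: real
  assumes p: "p > 1" and q: "q > 1" and pq: "1 / p + 1 / q = 1"
begin

text \<open>Young's pointwise inequality supplies the integrable majorant.\<close>

lemma integrable_mult_Lp:
  fixes f h :: "complex \<Rightarrow> complex"
  assumes [measurable]: "f \<in> borel_measurable borel" "h \<in> borel_measurable borel"
    and f: "integrable circle (\<lambda>t. cmod (f t) powr p)"
    and h: "integrable circle (\<lambda>t. cmod (h t) powr q)"
  shows "integrable circle (\<lambda>t. f t * h t)"
proof (rule Bochner_Integration.integrable_bound)
  show "integrable circle (\<lambda>t. cmod (f t) powr p / p + cmod (h t) powr q / q)"
    using f h by auto
  show "AE t in circle. cmod (f t * h t) \<le> norm (cmod (f t) powr p / p + cmod (h t) powr q / q)"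
    using p q Youngs_inequality[OF p q pq norm_ge_zero norm_ge_zero]
    by (intro AE_I2) (simp add: norm_mult)
qed auto

text \<open>Truncating h at height n reduces to bounded h. The error is uniform in s: Young's
  inequality is applied to \<open>d * cmod (f t)\<close> and the truncation error divided by d. A
  small d controls the first term, a large n the second, whose integral does not depend on s by
  rotation invariance.\<close>

lemma continuous_correlation_Lp:
  fixes f h :: "complex \<Rightarrow> complex"
  assumes fm[measurable]: "f \<in> borel_measurable borel" and hm[measurable]: "h \<in> borel_measurable borel"
    and f: "integrable circle (\<lambda>t. cmod (f t) powr p)"
    and h: "integrable circle (\<lambda>t. cmod (h t) powr q)"
  shows "continuous_on (sphere 0 1) (\<lambda>s. \<integral>t. f t * h (t * s) \<partial>circle)"
proof -
  define H where "H n t = (if cmod (h t) \<le> real n then h t else 0)" for n t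
  have [measurable]: "H n \<in> borel_measurable borel" for n
    unfolding H_def[abs_def] by measurable
  have f1: "integrable circle f"
    using integrable_mult_Lp[of f "\<lambda>_. 1"] f by simp
  define A where "A = (\<integral>t. cmod (f t) powr p \<partial>circle)"
  define T where "T n = (\<integral>t. cmod (h t - H n t) powr q \<partial>circle)" for n
  have hH: "cmod (h t - H n t) powr q \<le> cmod (h t) powr q" "cmod (H n t) powr q \<le> cmod (h t) powr q" for n t
    by (auto simp: H_def)
  have intH: "integrable circle (\<lambda>t. cmod (h t - H n t) powr q)" "integrable circle (\<lambda>t. cmod (H n t) powr q)" for n
    by (rule Bochner_Integration.integrable_bound[OF h]; use hH in auto)+
  have "T \<longlonglongrightarrow> (\<integral>t. 0 \<partial>circle)"
    unfolding T_def
  proof (rule integral_dominated_convergence[OF _ _ h])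
    show "AE t in circle. (\<lambda>n. cmod (h t - H n t) powr q) \<longlonglongrightarrow> 0"
    proof (rule AE_I2)
      fix t
      have "eventually (\<lambda>n. cmod (h t - H n t) powr q = 0) sequentially"
        using eventually_ge_at_top[of "nat \<lceil>cmod (h t)\<rceil>"]
      proof eventually_elim
        case (elim n)
        then have "cmod (h t) \<le> real n" by linarith
        then show ?case by (simp add: H_def)
      qed
      then show "(\<lambda>n. cmod (h t - H n t) powr q) \<longlonglongrightarrow> 0" by (rule tendsto_eventually)
    qed
  qed (use hH in auto)
  then have T0: "T \<longlonglongrightarrow> 0" by simp
  have rot: "integrable circle (\<lambda>t. cmod (k (t * s)) powr q)"
    if "s \<in> sphere 0 1" "integrable circle (\<lambda>t. cmod (k t) powr q)" "k \<in> borel_measurable borel" for k :: "complex \<Rightarrow> complex" and s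
    using that integrable_rotation[of s "\<lambda>t. cmod (k t) powr q"] by simp
  have bd: "cmod ((\<integral>t. f t * H n (t * s) \<partial>circle) - (\<integral>t. f t * h (t * s) \<partial>circle))
      \<le> d powr p * A / p + d powr (- q) * T n / q" if s: "s \<in> sphere 0 1" and d: "d > 0" for n s d
  proof -
    have i1: "integrable circle (\<lambda>t. f t * H n (t * s))"
      by (rule integrable_mult_Lp) (use f rot[OF s intH(2)[of n]] in auto)
    have i2: "integrable circle (\<lambda>t. f t * h (t * s))"
      by (rule integrable_mult_Lp) (use f rot[OF s h] in auto)
    have i3: "integrable circle (\<lambda>t. cmod (h (t * s) - H n (t * s)) powr q)"
      using rot[OF s intH(1)[of n]] by simp
    have "cmod ((\<integral>t. f t * H n (t * s) \<partial>circle) - (\<integral>t. f t * h (t * s) \<partial>circle))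
      = cmod (\<integral>t. f t * H n (t * s) - f t * h (t * s) \<partial>circle)"
      using i1 i2 by simp
    also have "\<dots> \<le> (\<integral>t. d powr p * cmod (f t) powr p / p + d powr (- q) * cmod (h (t * s) - H n (t * s)) powr q / q \<partial>circle)"
    proof (rule Bochner_Integration.integral_norm_bound_integral)
      fix t
      have "cmod (f t * H n (t * s) - f t * h (t * s)) = cmod (f t) * cmod (h (t * s) - H n (t * s))"
        by (metis norm_minus_commute norm_mult right_diff_distrib)
      also have "\<dots> = (d * cmod (f t)) * (cmod (h (t * s) - H n (t * s)) / d)"
        using d by simp
      also have "\<dots> \<le> (d * cmod (f t)) powr p / p + (cmod (h (t * s) - H n (t * s)) / d) powr q / q"
        using d by (intro Youngs_inequality p q pq) auto
      also have "\<dots> = d powr p * cmod (f t) powr p / p + d powr (- q) * cmod (h (t * s) - H n (t * s)) powr q / q"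
        using d by (simp add: powr_mult powr_divide powr_minus_divide)
      finally show "cmod (f t * H n (t * s) - f t * h (t * s)) \<le> \<dots>" .
    qed (use i1 i2 i3 f in auto)
    also have "\<dots> = d powr p * A / p + d powr (- q) * T n / q"
      using f i3 s unfolding A_def T_def
      by (subst integral_rotation[of s "\<lambda>t. cmod (h t - H n t) powr q", symmetric]) auto
    finally show ?thesis .
  qed
  have "uniform_limit (sphere 0 1) (\<lambda>n s. \<integral>t. f t * H n (t * s) \<partial>circle)
      (\<lambda>s. \<integral>t. f t * h (t * s) \<partial>circle) sequentially"
  proof (rule uniform_limitI)
    fix e :: real assume e: "e > 0"
    have A: "A \<ge> 0" by (simp add: A_def)
    \<comment> \<open>This makes \<open>d powr p * A\<close> equal to
      \<open>e / 2 * (A / (A + 1))\<close>, which is below \<open>e / 2\<close> even for A =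
      0.\<close>
    define d where "d = (e / 2 / (A + 1)) powr (1 / p)"
    have d: "d > 0" using e A by (simp add: d_def)
    have "d powr p * A / p \<le> d powr p * A"
    proof -
      have "d powr p * A \<ge> 0" using A by simp
      from mult_left_mono[OF less_imp_le[OF p] this] show ?thesis
        using p by (simp add: divide_le_eq)
    qed
    also have "\<dots> = e / 2 * (A / (A + 1))"
      using e A p by (simp add: d_def powr_powr)
    also have "\<dots> < e / 2 * 1" using A e by (intro mult_strict_left_mono) auto
    finally have dA: "d powr p * A / p < e / 2" by simp
    have "(\<lambda>n. d powr (- q) * T n / q) \<longlonglongrightarrow> d powr (- q) * 0 / q"
      by (intro tendsto_intros T0) (use q in auto)
    then have "eventually (\<lambda>n. d powr (- q) * T n / q < e / 2) sequentially"
      using e by (intro order_tendstoD) auto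
    then show "\<forall>\<^sub>F n in sequentially. \<forall>s\<in>sphere 0 1.
        dist (\<integral>t. f t * H n (t * s) \<partial>circle) (\<integral>t. f t * h (t * s) \<partial>circle) < e"
    proof eventually_elim
      case (elim n)
      show ?case
      proof
        fix s :: complex assume "s \<in> sphere 0 1"
        note bd[OF this d, of n]
        also have "d powr p * A / p + d powr (- q) * T n / q < e / 2 + e / 2"
          using dA elim by (rule add_strict_mono)
        finally show "dist (\<integral>t. f t * H n (t * s) \<partial>circle) (\<integral>t. f t * h (t * s) \<partial>circle) < e"
          by (simp only: dist_norm field_sum_of_halves)
      qed
    qed
  qed
  moreover have "continuous_on (sphere 0 1) (\<lambda>s. \<integral>t. f t * H n (t * s) \<partial>circle)" for n
    by (rule continuous_correlation_bounded[OF f1, where C="real n"]) (auto simp: H_def)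
  ultimately show ?thesis
    by (intro uniform_limit_theorem[where f="\<lambda>n s. \<integral>t. f t * H n (t * s) \<partial>circle"]) auto
qed

end

text \<open>A nonzero value at 1 would persist along a short arc, and arcs are not null
  sets.\<close>

lemma continuous_AE_zero_at_1:
  fixes F :: "complex \<Rightarrow> complex"
  assumes F: "continuous_on (sphere 0 1) F" and ae: "AE t in circle. F t = 0"
  shows "F 1 = 0"
proof (rule ccontr)
  assume nz: "F 1 \<noteq> 0"
  from ae obtain N where N: "N \<in> null_sets circle" "{t. F t \<noteq> 0} \<subseteq> N"
    by (auto simp: eventually_ae_filter)
  have neg: "negligible {x \<in> {0..2*pi}. cis x \<in> N}"
    using N(1) null_sets_circle_iff[of N] by (auto simp: null_sets_def)
  have c: "continuous_on UNIV (\<lambda>x. F (cis x))"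
    by (rule continuous_on_compose2[OF F]) (auto intro!: continuous_intros)
  have "open ((\<lambda>x. F (cis x)) -` (- {0}))"
    using c by (intro open_vimage) auto
  moreover have "0 \<in> (\<lambda>x. F (cis x)) -` (- {0})" using nz by simp
  ultimately obtain e where e: "e > 0" "ball 0 e \<subseteq> (\<lambda>x. F (cis x)) -` (- {0})"
    unfolding open_contains_ball by blast
  \<comment> \<open>Only positive angles, because 0 is the left end of the parameter interval; the
    bound 1 keeps the arc inside it.\<close>
  have "{0<..<min e 1} \<subseteq> {x \<in> {0..2*pi}. cis x \<in> N}"
  proof
    fix x assume x: "x \<in> {0<..<min e 1}"
    then have "x \<in> ball 0 e" by (auto simp: dist_norm)
    then have "F (cis x) \<noteq> 0" using e by auto
    then show "x \<in> {x \<in> {0..2*pi}. cis x \<in> N}"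
      using N(2) x pi_gt3 by auto
  qed
  then have "negligible {0<..<min e 1}" using neg negligible_subset by blast
  moreover have "\<not> negligible {0<..<min e 1}"
    using e by (intro open_not_negligible) auto
  ultimately show False by simp
qed

text \<open>All Fourier coefficients of the correlation \<open>s \<mapsto> \<integral> f(t) h(ts)\<close> vanish, so it is zero almost
  everywhere; its continuity is what gives the value at \<open>s = 1\<close>.\<close>

lemma moment_mult_Lp:
  fixes f h :: "complex \<Rightarrow> complex"
  assumes p: "p > 1" and q: "q > 1" and pq: "1 / p + 1 / q = 1"
    and fm[measurable]: "f \<in> borel_measurable borel" and hm[measurable]: "h \<in> borel_measurable borel"
    and f: "integrable circle (\<lambda>t. cmod (f t) powr p)"
    and h: "integrable circle (\<lambda>t. cmod (h t) powr q)"
    and zero: "\<And>k::int. (\<integral>t. f t * t powi (- k) \<partial>circle) * (\<integral>t. h t * t powi k \<partial>circle) = 0"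
  shows "(\<integral>t. f t * h t \<partial>circle) = 0"
proof -
  interpret pair_sigma_finite circle circle ..
  define F where "F s = (\<integral>t. f t * h (t * s) \<partial>circle)" for s
  have f1: "integrable circle f"
    using integrable_mult_Lp[OF p q pq, of f "\<lambda>_. 1"] f by simp
  have h1: "integrable circle h"
    using integrable_mult_Lp[OF p q pq, of "\<lambda>_. 1" h] h by simp
  have ints: "integrable circle (\<lambda>s. f t * h (t * s))" if "cmod t = 1" for t
    using integrable_rotation[of t h] that h1 by (simp add: mult.commute[of _ t])
  have prod: "integrable (circle \<Otimes>\<^sub>M circle) (\<lambda>(t, s). f t * h (t * s))"
  proof (rule Fubini_integrable)
    have "integrable circle (\<lambda>t. cmod (f t) * (\<integral>s. cmod (h s) \<partial>circle))"
      using f1 by auto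
    then show "integrable circle (\<lambda>t. \<integral>s. norm (case (t, s) of (t, s) \<Rightarrow> f t * h (t * s)) \<partial>circle)"
    proof (rule integrable_cong_AE_imp)
      show "AE t in circle. cmod (f t) * (\<integral>s. cmod (h s) \<partial>circle) =
          (\<integral>s. norm (case (t, s) of (t, s) \<Rightarrow> f t * h (t * s)) \<partial>circle)"
        using AE_circle_norm
      proof eventually_elim
        case (elim t)
        then show ?case using integral_rotation[of t "\<lambda>s. cmod (h s)"]
          by (simp add: norm_mult mult.commute[of _ t])
      qed
    qed measurable
    show "AE t in circle. integrable circle (\<lambda>s. case (t, s) of (t, s) \<Rightarrow> f t * h (t * s))"
      using AE_circle_norm by eventually_elim (simp add: ints)
  qed measurable
  have Fint: "integrable circle F"
    unfolding F_def using integrable_snd[OF prod] by simp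
  have "AE s in circle. F s = 0"
  proof (rule AE_zero_if_moments_zero[OF Fint])
    fix k :: int
    have ae: "AE x in circle \<Otimes>\<^sub>M circle. cmod (snd x) = 1"
    proof (rule AE_pair_measure)
      show "{x \<in> space (circle \<Otimes>\<^sub>M circle). cmod (snd x) = 1} \<in> sets (circle \<Otimes>\<^sub>M circle)"
        by measurable
    qed (simp add: AE_circle_norm)
    have prodk: "integrable (circle \<Otimes>\<^sub>M circle) (\<lambda>(t, s). f t * h (t * s) * s powi k)"
      by (rule Bochner_Integration.integrable_bound[OF prod])
         (use ae in \<open>auto elim!: eventually_mono simp: norm_mult norm_power_int\<close>)
    have "(\<integral>s. F s * s powi k \<partial>circle) = (\<integral>s. (\<integral>t. f t * h (t * s) * s powi k \<partial>circle) \<partial>circle)"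
      by (simp add: F_def)
    also have "\<dots> = (\<integral>t. (\<integral>s. f t * h (t * s) * s powi k \<partial>circle) \<partial>circle)"
      using Fubini_integral[OF prodk] by simp
    also have "\<dots> = (\<integral>t. (f t * t powi (- k)) * (\<integral>s. h s * s powi k \<partial>circle) \<partial>circle)"
    proof (rule integral_cong_AE)
      show "AE t in circle. (\<integral>s. f t * h (t * s) * s powi k \<partial>circle) =
          f t * t powi (- k) * (\<integral>s. h s * s powi k \<partial>circle)"
        using AE_circle_norm
      proof eventually_elim
        case (elim t)
        then have t: "t powi (- k) * t powi k = 1" by (subst power_int_add[symmetric]) auto
        \<comment> \<open>Inserting \<open>t powi (- k) * t powi k = 1\<close> makes the s-dependent
          part a function of \<open>s * t\<close>, so rotation invariance turns the double integral
          into one coefficient of f times one of h.\<close>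
        have "(\<integral>s. f t * h (t * s) * s powi k \<partial>circle)
          = (\<integral>s. f t * t powi (- k) * (h (s * t) * (s * t) powi k) \<partial>circle)"
          by (rule Bochner_Integration.integral_cong)
             (use t in \<open>auto simp: power_int_mult_distrib mult_ac\<close>)
        also have "\<dots> = f t * t powi (- k) * (\<integral>s. h (s * t) * (s * t) powi k \<partial>circle)"
          by simp
        also have "\<dots> = f t * t powi (- k) * (\<integral>s. h s * s powi k \<partial>circle)"
          using elim by (subst integral_rotation) auto
        finally show ?case .
      qed
    qed auto
    also have "\<dots> = 0" using zero[of k] by simp
    finally show "(\<integral>s. F s * s powi k \<partial>circle) = 0" .
  qed
  moreover have "continuous_on (sphere 0 1) F"
    unfolding F_def by (rule continuous_correlation_Lp[OF p q pq fm hm f h])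
  ultimately have "F 1 = 0" by (intro continuous_AE_zero_at_1)
  then show ?thesis by (simp add: F_def)
qed

section \<open>Fourier coefficients of classes of functions\<close>

lemma L0_exhaust:
  obtains h where "h \<in> borel_measurable borel" "f = abs_L0 h"
proof
  show "rep_L0 f \<in> borel_measurable borel"
    using Quotient3_rep_reflp[OF Quotient3_L0, of f] by (simp add: ae_eq_def cong: measurable_cong_sets)
  show "f = abs_L0 (rep_L0 f)"
    using Quotient3_abs_rep[OF Quotient3_L0] by simp
qed

lemma ae_eq_refl: "h \<in> borel_measurable borel \<Longrightarrow> ae_eq h h"
  by (simp add: ae_eq_def cong: measurable_cong_sets)

lemma abs_L0_eqI:
  assumes "h \<in> borel_measurable borel" "k \<in> borel_measurable borel"
    and "\<And>t. cmod t = 1 \<Longrightarrow> h t = k t"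
  shows "abs_L0 h = abs_L0 k"
proof (rule Quotient3_rel_abs[OF Quotient3_L0])
  show "ae_eq h k"
    using assms AE_circle_norm by (auto simp: ae_eq_def cong: measurable_cong_sets elim: eventually_mono)
qed

lemma abs_L0_eq_iff:
  assumes "h \<in> borel_measurable borel" "k \<in> borel_measurable borel"
  shows "abs_L0 h = abs_L0 k \<longleftrightarrow> (AE t in circle. h t = k t)"
proof -
  have "ae_eq h k \<longleftrightarrow> abs_L0 h = abs_L0 k"
    using Quotient3_rel[OF Quotient3_L0, of h k] ae_eq_refl assms by blast
  then show ?thesis using assms by (simp add: ae_eq_def cong: measurable_cong_sets)
qed

lemma abs_L0_binop:
  assumes "h \<in> borel_measurable borel" "k \<in> borel_measurable borel"
  shows "abs_L0 h + abs_L0 k = abs_L0 (\<lambda>t. h t + k t)"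
    "abs_L0 h - abs_L0 k = abs_L0 (\<lambda>t. h t - k t)"
    "abs_L0 h * abs_L0 k = abs_L0 (\<lambda>t. h t * k t)"
  using assms by (simp_all add: plus_L0.abs_eq minus_L0.abs_eq times_L0.abs_eq ae_eq_refl)

lemma abs_L0_unop:
  assumes "h \<in> borel_measurable borel"
  shows "inverse (abs_L0 h) = abs_L0 (\<lambda>t. inverse (h t))"
    "cscale c (abs_L0 h) = abs_L0 (\<lambda>t. c * h t)"
  using assms by (simp_all add: inverse_L0.abs_eq cscale.abs_eq ae_eq_refl)

lemmas abs_L0_simps = abs_L0_binop abs_L0_unop

lemma fourier_abs:
  "h \<in> borel_measurable borel \<Longrightarrow> fourier (abs_L0 h) n = (\<integral>t. h t * t powi (- n) \<partial>circle)"
  by (simp add: fourier.abs_eq ae_eq_refl)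

lemma Lp_abs:
  "h \<in> borel_measurable borel \<Longrightarrow> abs_L0 h \<in> Lp p \<longleftrightarrow> integrable circle (\<lambda>t. cmod (h t) powr p)"
  by (simp add: Lp_def in_Lp.abs_eq ae_eq_refl)

lemma L1_abs:
  assumes [measurable]: "h \<in> borel_measurable borel"
  shows "abs_L0 h \<in> Lp 1 \<longleftrightarrow> integrable circle h"
  using integrable_norm_iff[of h circle] by (simp add: Lp_abs)

lemma Linf_abs:
  "h \<in> borel_measurable borel \<Longrightarrow> abs_L0 h \<in> Linf \<longleftrightarrow> (\<exists>C. AE t in circle. cmod (h t) \<le> C)"
  by (simp add: Linf_def ess_bounded.abs_eq ae_eq_refl)

lemma LinfI:
  assumes "h \<in> borel_measurable borel" "\<And>t. cmod t = 1 \<Longrightarrow> cmod (h t) \<le> C"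
  shows "abs_L0 h \<in> Linf"
  using assms AE_circle_norm by (auto simp: Linf_abs intro!: exI[of _ C] elim: eventually_mono)

lemma fourier_add: "f \<in> Lp 1 \<Longrightarrow> g \<in> Lp 1 \<Longrightarrow> fourier (f + g) n = fourier f n + fourier g n"
  by (cases f rule: L0_exhaust; cases g rule: L0_exhaust)
     (simp add: abs_L0_simps L1_abs fourier_abs ring_distribs integrable_powi_mult)

lemma fourier_diff: "f \<in> Lp 1 \<Longrightarrow> g \<in> Lp 1 \<Longrightarrow> fourier (f - g) n = fourier f n - fourier g n"
  by (cases f rule: L0_exhaust; cases g rule: L0_exhaust)
     (simp add: abs_L0_simps L1_abs fourier_abs ring_distribs integrable_powi_mult)

lemma fourier_cscale: "fourier (cscale c f) n = c * fourier f n"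
  by (cases f rule: L0_exhaust) (simp add: abs_L0_simps fourier_abs mult.assoc)

lemma tpow_abs: "tpow k = abs_L0 (\<lambda>t. t powi k)"
  by (simp add: tpow_def)

lemma one_abs: "1 = abs_L0 (\<lambda>_. 1)" and zero_abs: "0 = abs_L0 (\<lambda>_. 0)"
  by (simp_all add: one_L0_def zero_L0_def)

lemma norm_1_nonzero: "cmod t = 1 \<Longrightarrow> t \<noteq> 0"
  by auto

lemma fourier_tpow_mult: "fourier (tpow j * f) n = fourier f (n - j)"
proof (cases f rule: L0_exhaust)
  case (1 h)
  have [measurable]: "h \<in> borel_measurable borel" by fact
  have "(\<integral>t. t powi j * h t * t powi (- n) \<partial>circle) = (\<integral>t. h t * t powi (- (n - j)) \<partial>circle)"
    by (rule integral_cong_AE)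
       (use AE_circle_norm in \<open>auto elim!: eventually_mono simp: power_int_diff power_int_minus divide_inverse dest: norm_1_nonzero\<close>)
  then show ?thesis using 1 by (simp add: tpow_abs abs_L0_simps fourier_abs)
qed

lemma tpow_0 [simp]: "tpow 0 = 1"
  by (simp add: tpow_abs one_abs)

lemma tpow_add: "tpow (i + j) = tpow i * tpow j"
  by (simp add: tpow_abs abs_L0_simps, rule abs_L0_eqI)
     (auto simp: power_int_add dest: norm_1_nonzero)

lemma tpow_power: "tpow k ^ n = tpow (k * int n)"
  by (induction n) (simp_all add: ring_distribs tpow_add)

lemma tpow_cancel [simp]: "tpow (- k) * tpow k = 1" "tpow k * tpow (- k) = 1"
  by (simp_all flip: tpow_add)

lemma tpow_Linf: "tpow k \<in> Linf"
  unfolding tpow_abs by (rule LinfI[where C=1]) (auto simp: norm_power_int)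

lemma fourier_1: "fourier 1 n = (if n = 0 then 1 else 0)"
  using circle_moment[of "-n"] by (simp add: one_abs fourier_abs)

lemma fourier_tpow: "fourier (tpow k) n = (if n = k then 1 else 0)"
  using fourier_tpow_mult[of k 1 n] by (simp add: fourier_1)

lemma fourier_0 [simp]: "fourier 0 n = 0"
  by (simp add: zero_abs fourier_abs)

lemma Linf_mult_Lp:
  assumes u: "u \<in> Linf" and f: "f \<in> Lp p" and p: "p > 0"
  shows "u * f \<in> Lp p"
proof (cases u rule: L0_exhaust; cases f rule: L0_exhaust)
  fix a h assume a[measurable]: "a \<in> borel_measurable borel" and ua: "u = abs_L0 a"
    and h[measurable]: "h \<in> borel_measurable borel" and fh: "f = abs_L0 h"
  obtain C where C: "AE t in circle. cmod (a t) \<le> C"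
    using u ua by (auto simp: Linf_abs)
  have hi: "integrable circle (\<lambda>t. cmod (h t) powr p)" using f fh by (simp add: Lp_abs)
  have "integrable circle (\<lambda>t. cmod (a t * h t) powr p)"
  proof (rule Bochner_Integration.integrable_bound)
    show "integrable circle (\<lambda>t. \<bar>C\<bar> powr p * cmod (h t) powr p)" using hi by simp
    show "AE t in circle. norm (cmod (a t * h t) powr p) \<le> norm (\<bar>C\<bar> powr p * cmod (h t) powr p)"
      using C
    proof eventually_elim
      case (elim t)
      then have "cmod (a t) powr p \<le> \<bar>C\<bar> powr p" using p by (intro powr_mono2) auto
      then show ?case by (simp add: norm_mult powr_mult mult_right_mono)
    qed
  qed measurable
  then show ?thesis using ua fh by (simp add: abs_L0_simps Lp_abs)
qed

lemma Linf_mult: "u \<in> Linf \<Longrightarrow> v \<in> Linf \<Longrightarrow> u * v \<in> Linf"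
proof (cases u rule: L0_exhaust; cases v rule: L0_exhaust)
  fix a h assume u: "u \<in> Linf" and v: "v \<in> Linf"
    and a: "a \<in> borel_measurable borel" and ua: "u = abs_L0 a"
    and h: "h \<in> borel_measurable borel" and fh: "v = abs_L0 h"
  obtain C D where C: "AE t in circle. cmod (a t) \<le> C" and D: "AE t in circle. cmod (h t) \<le> D"
    using u ua v fh a h by (auto simp: Linf_abs)
  have "AE t in circle. cmod (a t * h t) \<le> \<bar>C\<bar> * \<bar>D\<bar>"
    using C D
  proof eventually_elim
    case (elim t)
    then have "cmod (a t) \<le> \<bar>C\<bar>" "cmod (h t) \<le> \<bar>D\<bar>" by auto
    then show ?case by (simp add: norm_mult mult_mono)
  qed
  then show ?thesis using ua fh a h by (auto simp: abs_L0_simps Linf_abs)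
qed

lemma Linf_1: "1 \<in> Linf"
  using tpow_Linf[of 0] by simp

lemma Linf_power: "u \<in> Linf \<Longrightarrow> u ^ n \<in> Linf"
  by (induction n) (auto simp: Linf_1 intro: Linf_mult)

lemma Lp_1: "1 \<in> Lp p"
  by (simp add: one_abs Lp_abs)

lemma Linf_Lp: "u \<in> Linf \<Longrightarrow> p > 0 \<Longrightarrow> u \<in> Lp p"
  using Linf_mult_Lp[of u 1 p] by (simp add: Lp_1)

lemma Lp_cscale: "f \<in> Lp p \<Longrightarrow> cscale c f \<in> Lp p"
  by (cases f rule: L0_exhaust) (simp add: abs_L0_simps Lp_abs norm_mult powr_mult)

lemma Lp_add:
  assumes f: "f \<in> Lp p" and g: "g \<in> Lp p" and p: "p > 0"
  shows "f + g \<in> Lp p"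
proof (cases f rule: L0_exhaust; cases g rule: L0_exhaust)
  fix a h assume a[measurable]: "a \<in> borel_measurable borel" and fa: "f = abs_L0 a"
    and h[measurable]: "h \<in> borel_measurable borel" and gh: "g = abs_L0 h"
  have "integrable circle (\<lambda>t. cmod (a t + h t) powr p)"
  proof (rule Bochner_Integration.integrable_bound)
    show "integrable circle (\<lambda>t. 2 powr p * (cmod (a t) powr p + cmod (h t) powr p))"
      using f g fa gh by (simp add: Lp_abs)
    show "AE t in circle. norm (cmod (a t + h t) powr p) \<le> norm (2 powr p * (cmod (a t) powr p + cmod (h t) powr p))"
    proof (rule AE_I2)
      fix t
      have "cmod (a t + h t) \<le> 2 * max (cmod (a t)) (cmod (h t))"
        using norm_triangle_ineq[of "a t" "h t"] by linarith
      then have "cmod (a t + h t) powr p \<le> (2 * max (cmod (a t)) (cmod (h t))) powr p"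
        using p by (intro powr_mono2) auto
      also have "\<dots> = 2 powr p * max (cmod (a t)) (cmod (h t)) powr p"
        by (simp add: powr_mult)
      also have "\<dots> \<le> 2 powr p * (cmod (a t) powr p + cmod (h t) powr p)"
        by (intro mult_left_mono) (auto simp: max_def)
      finally show "norm (cmod (a t + h t) powr p) \<le> norm (2 powr p * (cmod (a t) powr p + cmod (h t) powr p))"
        by simp
    qed
  qed measurable
  then show ?thesis using fa gh by (simp add: abs_L0_simps Lp_abs)
qed

lemma cscale_eq_mult: "cscale c f = cscale c 1 * f"
  by (cases f rule: L0_exhaust) (simp add: one_abs abs_L0_simps)

lemma L0_minus_eq_cscale: "- f = cscale (-1) f"
  by (metis L0.scale_minus_left L0.scale_one)

lemma Lp_diff: "f \<in> Lp p \<Longrightarrow> g \<in> Lp p \<Longrightarrow> p > 0 \<Longrightarrow> f - g \<in> Lp p"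
  using Lp_add[of f p "cscale (-1) g"] Lp_cscale[of g p "-1"] by (simp add: L0_minus_eq_cscale[symmetric])

lemma Lp_0: "0 \<in> Lp p"
  by (simp add: zero_abs Lp_abs)

lemma Lp_mult_L1:
  assumes "p > 1" "q > 1" "1 / p + 1 / q = 1" "f \<in> Lp p" "h \<in> Lp q"
  shows "f * h \<in> Lp 1"
proof (cases f rule: L0_exhaust; cases h rule: L0_exhaust)
  fix a b assume "a \<in> borel_measurable borel" "f = abs_L0 a" "b \<in> borel_measurable borel" "h = abs_L0 b"
  then show ?thesis
    using assms integrable_mult_Lp[OF assms(1-3), of a b] by (simp add: abs_L0_simps Lp_abs L1_abs)
qed

lemma conj_exponent: "p > 1 \<Longrightarrow> p / (p - 1) > 1 \<and> 1 / p + 1 / (p / (p - 1)) = (1::real)"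
  by (auto simp: field_simps)

lemma Lp_L1: "p > 1 \<Longrightarrow> f \<in> Lp p \<Longrightarrow> f \<in> Lp 1"
  using Lp_mult_L1[of p "p / (p - 1)" f 1] conj_exponent[of p] by (simp add: Lp_1)

text \<open>Formally the coefficient is the sum over k of these products, but for general p that
  series need not converge absolutely. Multiplying f by \<open>tpow (- n)\<close> moves the question
  to coefficient 0, where the vanishing correlation decides.\<close>

lemma fourier_mult_eq_0:
  assumes pq: "p > 1" "q > 1" "1 / p + 1 / q = 1" and f: "f \<in> Lp p" and h: "h \<in> Lp q"
    and z: "\<And>k. fourier f (n - k) * fourier h k = 0"
  shows "fourier (f * h) n = 0"
proof -
  have fp: "tpow (- n) * f \<in> Lp p" using f pq by (intro Linf_mult_Lp tpow_Linf) auto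
  obtain a where a[measurable]: "a \<in> borel_measurable borel" "tpow (- n) * f = abs_L0 a"
    by (rule L0_exhaust)
  obtain b where b[measurable]: "b \<in> borel_measurable borel" "h = abs_L0 b"
    by (rule L0_exhaust)
  have "(\<integral>t. a t * b t \<partial>circle) = 0"
  proof (rule moment_mult_Lp[OF pq])
    fix k :: int
    have "fourier (tpow (- n) * f) k * fourier h (- k) = 0"
      using z[of "-k"] by (simp add: fourier_tpow_mult add.commute)
    then show "(\<integral>t. a t * t powi (- k) \<partial>circle) * (\<integral>t. b t * t powi k \<partial>circle) = 0"
      using a b by (simp add: fourier_abs)
  qed (use a b fp h in \<open>auto simp: Lp_abs\<close>)
  then have "fourier (abs_L0 a * abs_L0 b) 0 = 0"
    by (simp add: abs_L0_simps fourier_abs)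
  then have "fourier (tpow (- n) * (f * h)) 0 = 0" 
    by (metis a(2) b(2) mult.assoc)
  then show ?thesis by (simp add: fourier_tpow_mult)
qed

lemma fourier_bounded:
  assumes "f \<in> Lp 1"
  obtains C where "\<And>n. cmod (fourier f n) \<le> C"
proof (cases f rule: L0_exhaust)
  case (1 h)
  then have hi: "integrable circle h" using assms by (simp add: L1_abs)
  have "cmod (fourier f n) \<le> (\<integral>t. cmod (h t) \<partial>circle)" for n
  proof -
    have "cmod (fourier f n) \<le> (\<integral>t. cmod (h t * t powi (- n)) \<partial>circle)"
      using 1 by (simp add: fourier_abs integral_norm_bound)
    also have "\<dots> = (\<integral>t. cmod (h t) \<partial>circle)"
    proof (rule integral_cong_AE)
      have [measurable]: "h \<in> borel_measurable borel" by fact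
      show "(\<lambda>t. cmod (h t * t powi (- n))) \<in> borel_measurable circle"
        "(\<lambda>t. cmod (h t)) \<in> borel_measurable circle" by measurable
      show "AE t in circle. cmod (h t * t powi (- n)) = cmod (h t)"
        using AE_circle_norm by eventually_elim (simp add: norm_mult norm_power_int)
    qed
    finally show ?thesis .
  qed
  then show ?thesis by (rule that)
qed

lemma fourier_unique:
  assumes "f \<in> Lp 1" "g \<in> Lp 1" "\<And>n. fourier f n = fourier g n"
  shows "f = g"
proof -
  obtain h where h: "h \<in> borel_measurable borel" "f - g = abs_L0 h" by (rule L0_exhaust)
  have "AE t in circle. h t = 0"
  proof (rule AE_zero_if_moments_zero)
    show "integrable circle h" using Lp_diff[OF assms(1,2)] h by (simp add: L1_abs)
    show "(\<integral>t. h t * t powi k \<partial>circle) = 0" for k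
      using fourier_diff[OF assms(1,2), of "-k"] assms(3)[of "-k"] h by (simp add: fourier_abs)
  qed
  then have "f - g = 0" using h by (simp add: zero_abs abs_L0_eq_iff)
  then show ?thesis by simp
qed

section \<open>Division by a linear factor as a recursion for Fourier coefficients\<close>

lemma fourier_affine_mult:
  assumes "f \<in> Lp 1"
  shows "fourier ((cscale a (tpow 1) + cscale b 1) * f) n = a * fourier f (n - 1) + b * fourier f n"
proof -
  have "(cscale a (tpow 1) + cscale b 1) * f = cscale a (tpow 1 * f) + cscale b f"
    by (simp add: ring_distribs cscale_eq_mult[of a "tpow 1"] cscale_eq_mult[of a "tpow 1 * f"]
        cscale_eq_mult[of b f] mult.assoc)
  then show ?thesis using assms
    by (simp add: fourier_add Lp_cscale Linf_mult_Lp tpow_Linf fourier_cscale fourier_tpow_mult)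
qed

lemma geometric_bounded_zero:
  fixes a :: "nat \<Rightarrow> complex"
  assumes "\<And>j. a (Suc j) = c * a j" "cmod c > 1" "\<And>j. cmod (a j) \<le> C"
  shows "a j = 0"
proof -
  have aj: "a (i + j) = c ^ j * a i" for i j
    by (induction j) (simp_all add: assms(1))
  show ?thesis
  proof (rule ccontr)
    assume nz: "a j \<noteq> 0"
    obtain m where "C / cmod (a j) < cmod c ^ m"
      using real_arch_pow[OF assms(2)] by blast
    then have "C < cmod (a (j + m))"
      using nz by (simp add: aj norm_mult norm_power field_simps)
    then show False using assms(3)[of "j + m"] by simp
  qed
qed

text \<open>The coefficients of \<open>f\<close> satisfy a one-step recursion where those of the product vanish, so a
  nonzero one would make them grow like \<open>\<bar>\<beta>\<bar>\<^sup>j\<close>.\<close>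

lemma fourier_divide_outside:
  assumes \<beta>: "cmod \<beta> > 1" and f: "f \<in> Lp 1"
    and z: "\<And>k. k < m \<Longrightarrow> fourier ((tpow 1 - cscale \<beta> 1) * f) k = 0" and k: "k < m"
  shows "fourier f k = 0"
proof -
  obtain C where C: "\<And>n. cmod (fourier f n) \<le> C" using fourier_bounded[OF f] by blast
  have rec: "fourier f (k - 1) = \<beta> * fourier f k" if "k < m" for k
    using fourier_affine_mult[OF f, of 1 "-\<beta>" k] z[OF that] by (simp add: algebra_simps)
  have "fourier f (m - 1 - int j) = 0" for j
  proof (rule geometric_bounded_zero[of "\<lambda>j. fourier f (m - 1 - int j)" \<beta> C])
    show "fourier f (m - 1 - int (Suc i)) = \<beta> * fourier f (m - 1 - int i)" for i
      using rec[of "m - 1 - int i"] by (simp add: algebra_simps)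
  qed (use \<beta> C in auto)
  from this[of "nat (m - 1 - k)"] show ?thesis using k by simp
qed

text \<open>The same growth argument, run upwards: beyond m + 1 each coefficient of f is \<beta>
  times the previous one. The factor has degree one in t, so the bound on the frequencies drops by
  one under division.\<close>

lemma fourier_divide_inside:
  assumes \<beta>: "cmod \<beta> > 1" and f: "f \<in> Lp 1"
    and z: "\<And>k. k > m + 1 \<Longrightarrow> fourier ((cscale \<beta> (tpow 1) - 1) * f) k = 0" and k: "k > m"
  shows "fourier f k = 0"
proof -
  obtain C where C: "\<And>n. cmod (fourier f n) \<le> C" using fourier_bounded[OF f] by blast
  have rec: "fourier f k = \<beta> * fourier f (k - 1)" if "k > m + 1" for k
    using fourier_affine_mult[OF f, of \<beta> "-1" k] z[OF that] by (simp add: algebra_simps)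
  have "fourier f (m + 1 + int j) = 0" for j
  proof (rule geometric_bounded_zero[of "\<lambda>j. fourier f (m + 1 + int j)" \<beta> C])
    show "fourier f (m + 1 + int (Suc i)) = \<beta> * fourier f (m + 1 + int i)" for i
      using rec[of "m + 2 + int i"] by (simp add: algebra_simps)
  qed (use \<beta> C in auto)
  from this[of "nat (k - m - 1)"] show ?thesis using k by simp
qed

section \<open>The Carleman shift and one-sided spectra\<close>

lemma powi_cnj_unit:
  assumes "cmod t = 1"
  shows "cnj t powi k = t powi (- k)"
proof -
  have "cnj t = inverse t"
    using cnj_mult_unit(1)[OF assms] by (metis inverse_unique mult.commute)
  then show ?thesis by (simp only: power_int_inverse power_int_minus)
qed

text \<open>Conjugation exchanges the exponents k and -k, so two measures on the circle need to be
  compared for exponents of one sign only.\<close>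

lemma moment_cnj:
  assumes "sets M = sets borel" "AE t in M. cmod t = 1"
  shows "(\<integral>t. t powi (- k) \<partial>M) = cnj (\<integral>t. t powi k \<partial>M)"
proof -
  have [measurable_cong]: "sets M = sets borel" by fact
  have "(\<integral>t. t powi (- k) \<partial>M) = (\<integral>t. cnj (t powi k) \<partial>M)"
    using assms(2) by (intro integral_cong_AE) (auto elim!: eventually_mono simp: powi_cnj_unit)
  then show ?thesis by (simp only: Bochner_Integration.integral_cnj)
qed

text \<open>The zero \<open>\<beta>\<close> of \<open>lin_out\<close> lies outside the closed disc, the zero \<open>1 / cnj \<beta>\<close> of \<open>lin_in\<close>
  inside the open one.\<close>

definition lin_out :: "complex \<Rightarrow> L0" where
  "lin_out \<beta> = tpow 1 - cscale \<beta> 1"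

definition lin_in :: "complex \<Rightarrow> L0" where
  "lin_in \<beta> = cscale (cnj \<beta>) (tpow 1) - 1"

lemma lin_abs: "lin_out \<beta> = abs_L0 (\<lambda>t. t - \<beta>)" "lin_in \<beta> = abs_L0 (\<lambda>t. cnj \<beta> * t - 1)"
  by (simp_all add: lin_out_def lin_in_def tpow_abs one_abs abs_L0_simps)

context
  fixes \<beta> :: complex
  assumes \<beta>: "1 < cmod \<beta>"
begin

lemma lin_nonzero:
  assumes "cmod t = 1"
  shows "t - \<beta> \<noteq> 0" "cnj \<beta> * t - 1 \<noteq> 0"
  using assms \<beta> alpha_circle(1)[OF \<beta> assms] by auto

lemma lin_inverse: "lin_out \<beta> * inverse (lin_out \<beta>) = 1" "lin_in \<beta> * inverse (lin_in \<beta>) = 1"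
proof -
  show "lin_out \<beta> * inverse (lin_out \<beta>) = 1"
    unfolding lin_abs one_abs
    by (simp add: abs_L0_simps, rule abs_L0_eqI) (use lin_nonzero in auto)
  show "lin_in \<beta> * inverse (lin_in \<beta>) = 1"
    unfolding lin_abs one_abs
    by (simp add: abs_L0_simps, rule abs_L0_eqI) (use lin_nonzero in auto)
qed

lemma lin_cancel: "lin_out \<beta> * f = lin_out \<beta> * g \<longleftrightarrow> f = g" "lin_in \<beta> * f = lin_in \<beta> * g \<longleftrightarrow> f = g"
  using lin_inverse by (metis mult.assoc mult.commute mult_1)+

lemma lin_Linf: "lin_out \<beta> \<in> Linf" "lin_in \<beta> \<in> Linf"
proof -
  show "lin_out \<beta> \<in> Linf"
    unfolding lin_abs
    by (rule LinfI[where C="1 + cmod \<beta>"]) (auto intro: norm_triangle_le_diff)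
  show "lin_in \<beta> \<in> Linf"
    unfolding lin_abs
    by (rule LinfI[where C="cmod \<beta> + 1"]) (auto intro!: norm_triangle_le_diff simp: norm_mult)
qed

lemma inverse_lin_in_Linf: "inverse (lin_in \<beta>) \<in> Linf"
  unfolding lin_abs
proof (simp add: abs_L0_simps, rule LinfI)
  fix t :: complex assume t: "cmod t = 1"
  have "cmod \<beta> - 1 \<le> cmod (cnj \<beta> * t - 1)"
    using norm_triangle_ineq2[of "cnj \<beta> * t" 1] t by (simp add: norm_mult)
  then show "cmod (inverse (cnj \<beta> * t - 1)) \<le> 1 / (cmod \<beta> - 1)"
    using \<beta> by (simp add: norm_divide inverse_eq_divide frac_le)
qed auto

lemma fourier_lin_out: "f \<in> Lp 1 \<Longrightarrow> fourier (lin_out \<beta> * f) n = fourier f (n - 1) - \<beta> * fourier f n"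
  using fourier_affine_mult[of f 1 "-\<beta>" n] by (simp add: lin_out_def)

lemma fourier_lin_in: "f \<in> Lp 1 \<Longrightarrow> fourier (lin_in \<beta> * f) n = cnj \<beta> * fourier f (n - 1) - fourier f n"
  using fourier_affine_mult[of f "cnj \<beta>" "-1" n] by (simp add: lin_in_def)

lemma fourier_lin_outD:
  assumes "f \<in> Lp 1" "\<And>k. k < m \<Longrightarrow> fourier (lin_out \<beta> * f) k = 0" "k < m"
  shows "fourier f k = 0"
  using fourier_divide_outside[OF \<beta> assms(1), of m k] assms(2,3) by (simp add: lin_out_def)

lemma fourier_lin_inD:
  assumes "f \<in> Lp 1" "\<And>k. k > m + 1 \<Longrightarrow> fourier (lin_in \<beta> * f) k = 0" "k > m"
  shows "fourier f k = 0"
  using fourier_divide_inside[of "cnj \<beta>" f m k] \<beta> assms by (simp add: lin_in_def)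

section \<open>Composition with the shift, and the powers of the shift\<close>

lemma comp_alpha_simps:
  "comp_alpha \<beta> (f + g) = comp_alpha \<beta> f + comp_alpha \<beta> g"
  "comp_alpha \<beta> (f * g) = comp_alpha \<beta> f * comp_alpha \<beta> g"
  "comp_alpha \<beta> (inverse f) = inverse (comp_alpha \<beta> f)"
  "comp_alpha \<beta> (cscale c f) = cscale c (comp_alpha \<beta> f)"
  "comp_alpha \<beta> 1 = 1"
proof -
  obtain a b where a: "a \<in> borel_measurable borel" "f = abs_L0 a"
    and b: "b \<in> borel_measurable borel" "g = abs_L0 b"
    by (metis L0_exhaust)
  have [measurable]: "a \<in> borel_measurable borel" "b \<in> borel_measurable borel" by fact+
  show "comp_alpha \<beta> (f + g) = comp_alpha \<beta> f + comp_alpha \<beta> g"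
    "comp_alpha \<beta> (f * g) = comp_alpha \<beta> f * comp_alpha \<beta> g"
    "comp_alpha \<beta> (inverse f) = inverse (comp_alpha \<beta> f)"
    "comp_alpha \<beta> (cscale c f) = cscale c (comp_alpha \<beta> f)"
    "comp_alpha \<beta> 1 = 1"
    by (simp_all add: a(2) b(2) one_abs abs_L0_simps comp_alpha_abs[OF \<beta>])
qed

lemma comp_alpha_involutive: "comp_alpha \<beta> (comp_alpha \<beta> f) = f"
proof (cases f rule: L0_exhaust)
  case (1 h)
  have [measurable]: "h \<in> borel_measurable borel" by fact
  show ?thesis
    by (simp add: 1(2) comp_alpha_abs[OF \<beta>], rule abs_L0_eqI) (auto simp: alpha_circle[OF \<beta>])
qed

lemma comp_alpha_tpow_add: "comp_alpha \<beta> (tpow (i + j)) = comp_alpha \<beta> (tpow i) * comp_alpha \<beta> (tpow j)"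
  by (simp add: tpow_add comp_alpha_simps)

lemma comp_alpha_power: "comp_alpha \<beta> (f ^ n) = comp_alpha \<beta> f ^ n"
  by (induction n) (simp_all add: comp_alpha_simps)

lemma comp_alpha_tpow: "comp_alpha \<beta> (tpow k) = abs_L0 (\<lambda>t. alpha \<beta> t powi k)"
  by (simp add: tpow_abs comp_alpha_abs[OF \<beta>])

lemma comp_alpha_tpow_Linf: "comp_alpha \<beta> (tpow k) \<in> Linf"
  unfolding comp_alpha_tpow
  by (rule LinfI[where C=1]) (auto simp: norm_power_int alpha_circle[OF \<beta>])

lemma lin_in_alpha: "lin_in \<beta> * comp_alpha \<beta> (tpow 1) = lin_out \<beta>"
  unfolding comp_alpha_tpow lin_abs
  by (simp add: abs_L0_simps, rule abs_L0_eqI) (use lin_nonzero in \<open>auto simp: alpha_def\<close>)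

text \<open>The defining fraction of \<alpha> with its denominator cleared. Each use trades one
  power of \<alpha> for one division by a linear factor, which drives the inductions below.\<close>

lemma lin_in_alpha_Suc:
  "lin_in \<beta> * comp_alpha \<beta> (tpow (k + 1)) = lin_out \<beta> * comp_alpha \<beta> (tpow k)"
  by (simp add: comp_alpha_tpow_add lin_in_alpha[symmetric] mult_ac)

text \<open>The Poisson kernel of the point z = \<open>1 / cnj \<beta>\<close> of the disc, that is
  \<open>(1 - (cmod z)\<^sup>2) / (cmod (t - z))\<^sup>2\<close> with the fraction expanded. It is
  also the modulus of the derivative of \<alpha>.\<close>

definition poisson :: "complex \<Rightarrow> real" where
  "poisson t = ((cmod \<beta>)\<^sup>2 - 1) / (cmod (cnj \<beta> * t - 1))\<^sup>2"

definition poisson_L0 :: L0 where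
  "poisson_L0 = abs_L0 (\<lambda>t. of_real (poisson t))"

lemma poisson_measurable [measurable]: "poisson \<in> borel_measurable borel"
  unfolding poisson_def[abs_def] by measurable

lemma poisson_nonneg: "poisson t \<ge> 0"
  using \<beta> by (simp add: poisson_def)

lemma poisson_bound:
  assumes "cmod t = 1"
  shows "poisson t \<le> ((cmod \<beta>)\<^sup>2 - 1) / (cmod \<beta> - 1)\<^sup>2"
proof -
  have "cmod \<beta> - 1 \<le> cmod (cnj \<beta> * t - 1)"
    using norm_triangle_ineq2[of "cnj \<beta> * t" 1] assms by (simp add: norm_mult)
  then show ?thesis
    unfolding poisson_def using \<beta> by (intro divide_left_mono power_mono mult_pos_pos) auto
qed

lemma poisson_Linf: "poisson_L0 \<in> Linf"
  unfolding poisson_L0_def by (rule LinfI) (auto simp: poisson_nonneg intro: poisson_bound)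

text \<open>On the circle the conjugate of \<open>cnj \<beta> * t - 1\<close> is
  \<open>(\<beta> - t) / t\<close>, so the squared modulus in the kernel splits into the two linear
  factors. This opens the kernel to the division lemmas.\<close>

lemma poisson_factor: "lin_out \<beta> * (lin_in \<beta> * poisson_L0) = cscale (1 - (cmod \<beta>)\<^sup>2) (tpow 1)"
proof -
  have "(t - \<beta>) * ((cnj \<beta> * t - 1) * of_real (poisson t)) = of_real (1 - (cmod \<beta>)\<^sup>2) * t powi 1"
    if t: "cmod t = 1" for t
  proof -
    have nz: "cnj \<beta> * t - 1 \<noteq> 0" "cnj (cnj \<beta> * t - 1) \<noteq> 0"
      using lin_nonzero[OF t] by (simp_all del: complex_cnj_diff complex_cnj_mult)
    have e: "cnj (cnj \<beta> * t - 1) * t = \<beta> - t"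
      using cnj_mult_unit(1)[OF t] by (simp add: left_diff_distrib mult.assoc)
    have "(t - \<beta>) * ((cnj \<beta> * t - 1) * of_real (poisson t))
      = (t - \<beta>) * ((cnj \<beta> * t - 1) * ((cmod \<beta>)\<^sup>2 - 1) / ((cnj \<beta> * t - 1) * cnj (cnj \<beta> * t - 1)))"
      unfolding poisson_def complex_norm_square[symmetric] by simp
    also have "\<dots> = (t - \<beta>) * ((cmod \<beta>)\<^sup>2 - 1) / cnj (cnj \<beta> * t - 1)"
      using nz by simp
    also have "\<dots> = - (cnj (cnj \<beta> * t - 1) * t) * ((cmod \<beta>)\<^sup>2 - 1) / cnj (cnj \<beta> * t - 1)"
      unfolding e by simp
    also have "\<dots> = of_real (1 - (cmod \<beta>)\<^sup>2) * t powi 1"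
      using nz(2) by (simp add: field_simps)
    finally show ?thesis .
  qed
  then show ?thesis
    unfolding lin_abs poisson_L0_def tpow_abs
    by (simp add: abs_L0_simps, intro abs_L0_eqI) auto
qed

lemma norm_square_beta: "of_real ((cmod \<beta>)\<^sup>2) = \<beta> * cnj \<beta>"
  by (rule complex_norm_square)

text \<open>By \<open>poisson_factor\<close>, \<open>lin_out \<beta> * y\<close> is a multiple of t,
  and boundedness forces y to start at frequency 1, so its coefficients are explicit. Those of the
  kernel follow from the recursion through \<open>lin_in\<close>, once the mean is known.\<close>

lemma fourier_poisson: "fourier poisson_L0 (int n) = (1 / \<beta>) ^ n"
proof -
  have b0: "\<beta> \<noteq> 0" using \<beta> by auto
  have W: "poisson_L0 \<in> Lp 1" by (simp add: Linf_Lp poisson_Linf)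
  define y where "y = lin_in \<beta> * poisson_L0"
  have y1: "y \<in> Lp 1" by (simp add: y_def Linf_Lp Linf_mult lin_Linf poisson_Linf)
  have xy: "fourier (lin_out \<beta> * y) k = (if k = 1 then 1 - \<beta> * cnj \<beta> else 0)" for k
    using norm_square_beta by (simp add: y_def poisson_factor fourier_cscale fourier_tpow)
  have yneg: "fourier y k = 0" if "k \<le> 0" for k
    by (rule fourier_lin_outD[OF y1, of 1]) (use that xy in auto)
  have y1': "fourier y 1 = cnj \<beta> - 1 / \<beta>"
    using xy[of 1] yneg[of 0] b0 fourier_lin_out[OF y1, of 1] by (simp add: field_simps)
  have ypos: "fourier y (int n + 1) = (cnj \<beta> - 1 / \<beta>) * (1 / \<beta>) ^ n" for n
  proof (induction n)
    case (Suc n)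
    have "fourier y (int n + 1) = \<beta> * fourier y (int (Suc n) + 1)"
      using xy[of "int (Suc n) + 1"] fourier_lin_out[OF y1, of "int (Suc n) + 1"]
      by (simp add: add_ac)
    with Suc b0 show ?case by (simp add: divide_simps) (simp add: mult_ac)
  qed (simp add: y1')
  have rec: "fourier y k = cnj \<beta> * fourier poisson_L0 (k - 1) - fourier poisson_L0 k" for k
    unfolding y_def by (rule fourier_lin_in[OF W])
  have cn: "fourier poisson_L0 (- k) = cnj (fourier poisson_L0 k)" for k
  proof -
    have "(\<integral>t. of_real (poisson t) * t powi (- (- k)) \<partial>circle)
      = (\<integral>t. cnj (of_real (poisson t) * t powi (- k)) \<partial>circle)"
    proof (rule integral_cong_AE)
      show "AE t in circle. of_real (poisson t) * t powi (- (- k)) = cnj (of_real (poisson t) * t powi (- k))"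
        using AE_circle_norm by eventually_elim (simp add: powi_cnj_unit)
    qed measurable
    also have "\<dots> = cnj (\<integral>t. of_real (poisson t) * t powi (- k) \<partial>circle)"
      by (rule Bochner_Integration.integral_cnj)
    finally show ?thesis by (simp add: poisson_L0_def fourier_abs)
  qed
  \<comment> \<open>The recursion at 0 ties the coefficient at -1 to the mean, realness of the
    kernel carries this to the coefficient at 1, and the recursion at 1 then determines the
    mean.\<close>
  have W0: "fourier poisson_L0 0 = 1"
  proof -
    define w where "w = fourier poisson_L0 0"
    have "cnj w = w" using cn[of 0] by (simp add: w_def)
    have "w = cnj \<beta> * fourier poisson_L0 (-1)"
      using rec[of 0] yneg[of 0] by (simp add: w_def)
    then have "cnj (fourier poisson_L0 (-1)) = cnj (w / cnj \<beta>)" using b0 by simp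
    then have "fourier poisson_L0 1 = w / \<beta>"
      using cn[of 1] \<open>cnj w = w\<close> by simp
    then have "(cnj \<beta> - 1 / \<beta>) * w = cnj \<beta> - 1 / \<beta>"
      using rec[of 1] y1' by (simp add: w_def algebra_simps)
    moreover have "cnj \<beta> - 1 / \<beta> \<noteq> 0"
    proof
      assume "cnj \<beta> - 1 / \<beta> = 0"
      then have "\<beta> * cnj \<beta> = 1" using b0 by (simp add: field_simps)
      then have "(cmod \<beta>)\<^sup>2 = 1" using norm_square_beta by (metis of_real_eq_1_iff)
      then show False using \<beta> by (simp add: power2_eq_1_iff)
    qed
    ultimately show ?thesis by (simp add: w_def)
  qed
  show ?thesis
  proof (induction n)
    case (Suc n)
    have "fourier poisson_L0 (int n + 1) = cnj \<beta> * fourier poisson_L0 (int n) - fourier y (int n + 1)"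
      using rec[of "int n + 1"] by simp
    also have "\<dots> = (1 / \<beta>) ^ Suc n"
      using Suc ypos[of n] b0 by (simp add: algebra_simps)
    finally show ?case by (simp add: add.commute)
  qed (simp add: W0)
qed

text \<open>The poles of the negative powers of \<alpha> lie at \<beta>, outside the closed disc, so
  these powers are analytic inside; on coefficients, each power is one division by
  \<open>lin_out\<close>.\<close>

lemma comp_alpha_tpow_neg_mult:
  assumes f: "f \<in> Lp 1" "\<And>k. k < 0 \<Longrightarrow> fourier f k = 0" and k: "k < 0"
  shows "fourier (comp_alpha \<beta> (tpow (- int j)) * f) k = 0"
  using k
proof (induction j arbitrary: k)
  case 0
  then show ?case using f by (simp add: comp_alpha_simps)
next
  case (Suc j)
  have m: "comp_alpha \<beta> (tpow i) * f \<in> Lp 1" for i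
    by (rule Linf_mult_Lp[OF comp_alpha_tpow_Linf f(1)]) simp
  have e: "lin_out \<beta> * (comp_alpha \<beta> (tpow (- int (Suc j))) * f) = lin_in \<beta> * (comp_alpha \<beta> (tpow (- int j)) * f)"
    using lin_in_alpha_Suc[of "- int (Suc j)"] by (simp flip: mult.assoc)
  have "fourier (lin_out \<beta> * (comp_alpha \<beta> (tpow (- int (Suc j))) * f)) i = 0" if "i < 0" for i
    unfolding e fourier_lin_in[OF m] using Suc.IH that by simp
  then show ?case using Suc.prems by (rule fourier_lin_outD[OF m])
qed

text \<open>Here the poles lie at \<open>1 / cnj \<beta>\<close>, inside the disc. Multiplication by
  \<open>lin_out\<close> raises the top frequency by one and division by \<open>lin_in\<close>
  lowers it again.\<close>

lemma comp_alpha_tpow_pos_mult: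
  assumes f: "f \<in> Lp 1" "\<And>k. k > 0 \<Longrightarrow> fourier f k = 0" and k: "k > 0"
  shows "fourier (comp_alpha \<beta> (tpow (int j)) * f) k = 0"
  using k
proof (induction j arbitrary: k)
  case 0
  then show ?case using f by (simp add: comp_alpha_simps)
next
  case (Suc j)
  have m: "comp_alpha \<beta> (tpow i) * f \<in> Lp 1" for i
    by (rule Linf_mult_Lp[OF comp_alpha_tpow_Linf f(1)]) simp
  have e: "lin_in \<beta> * (comp_alpha \<beta> (tpow (int (Suc j))) * f) = lin_out \<beta> * (comp_alpha \<beta> (tpow (int j)) * f)"
    using lin_in_alpha_Suc[of "int j"] by (simp add: add.commute flip: mult.assoc)
  have "fourier (lin_in \<beta> * (comp_alpha \<beta> (tpow (int (Suc j))) * f)) i = 0" if "i > 0 + 1" for i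
    unfolding e fourier_lin_out[OF m] using Suc.IH that by simp
  then show ?case using Suc.prems by (rule fourier_lin_inD[OF m])
qed

text \<open>The shift sends 0 to \<beta>, and the mean of a function analytic in the disc is its
  value at 0.\<close>

lemma alpha_moment: "(\<integral>t. alpha \<beta> t powi (- int j) \<partial>circle) = (1 / \<beta>) ^ j"
proof -
  have b0: "\<beta> \<noteq> 0" using \<beta> by auto
  define v where "v j = comp_alpha \<beta> (tpow (- int j))" for j
  have v1: "v j \<in> Lp 1" for j by (simp add: v_def Linf_Lp comp_alpha_tpow_Linf)
  have neg: "fourier (v j) (-1) = 0" for j
    using comp_alpha_tpow_neg_mult[of 1 "-1" j] by (simp add: v_def Lp_1 fourier_1)
  have "fourier (v j) 0 = (1 / \<beta>) ^ j"
  proof (induction j)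
    case 0
    then show ?case by (simp add: v_def comp_alpha_simps fourier_1)
  next
    case (Suc j)
    have "lin_out \<beta> * v (Suc j) = lin_in \<beta> * v j"
      using lin_in_alpha_Suc[of "- int (Suc j)"] by (simp add: v_def)
    then have "fourier (lin_out \<beta> * v (Suc j)) 0 = fourier (lin_in \<beta> * v j) 0" by simp
    then have "\<beta> * fourier (v (Suc j)) 0 = fourier (v j) 0"
      using neg by (simp add: fourier_lin_in[OF v1] fourier_lin_out[OF v1])
    then show ?case using Suc b0 by (simp add: field_simps)
  qed
  then show ?thesis by (simp add: v_def comp_alpha_tpow fourier_abs)
qed

text \<open>Both measures have the moment \<open>(1 / \<beta>) ^ j\<close> at the exponent
  \<open>- int j\<close>, and conjugation gives the other exponents. This is the change of variables
  for \<alpha>.\<close>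

theorem distr_alpha: "distr circle borel (alpha \<beta>) = density circle poisson"
proof (rule circle_moments_determine_measure)
  have ci: "integrable circle poisson"
    by (rule circle.integrable_const_bound)
       (use AE_circle_norm poisson_bound in \<open>auto simp: poisson_nonneg elim: eventually_mono\<close>)
  show f1: "finite_measure (distr circle borel (alpha \<beta>))"
    by (rule circle.finite_measure_distr) simp
  show f2: "finite_measure (density circle poisson)"
    using nn_integral_eq_integral[OF ci] poisson_nonneg
    by (intro finite_measureI) (simp add: emeasure_density)
  show a1: "AE t in distr circle borel (alpha \<beta>). cmod t = 1"
    using AE_circle_norm by (subst AE_distr_iff) (auto elim!: eventually_mono simp: alpha_circle[OF \<beta>])
  show a2: "AE t in density circle poisson. cmod t = 1"
    using AE_circle_norm by (auto simp: AE_density elim: eventually_mono)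
  have *: "(\<integral>t. t powi (- int j) \<partial>distr circle borel (alpha \<beta>)) = (\<integral>t. t powi (- int j) \<partial>density circle poisson)" for j
  proof -
    have "(\<integral>t. t powi (- int j) \<partial>distr circle borel (alpha \<beta>)) = (1 / \<beta>) ^ j"
      by (subst integral_distr) (auto simp: alpha_moment)
    moreover have "(\<integral>t. t powi (- int j) \<partial>density circle poisson) = (1 / \<beta>) ^ j"
      using fourier_poisson[of j]
      by (subst integral_density) (auto simp: poisson_nonneg poisson_L0_def fourier_abs scaleR_conv_of_real)
    ultimately show ?thesis by simp
  qed
  show "(\<integral>t. t powi k \<partial>distr circle borel (alpha \<beta>)) = (\<integral>t. t powi k \<partial>density circle poisson)" for k
  proof (cases "k \<le> 0")
    case True
    then show ?thesis using *[of "nat (- k)"] by simp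
  next
    case False
    then show ?thesis
      using moment_cnj[OF _ a1, of "-k"] moment_cnj[OF _ a2, of "-k"] *[of "nat k"] by simp
  qed
qed simp_all

lemma integral_alpha:
  fixes f :: "complex \<Rightarrow> 'b::{banach, second_countable_topology}"
  assumes [measurable]: "f \<in> borel_measurable borel"
  shows "(\<integral>t. f (alpha \<beta> t) \<partial>circle) = (\<integral>t. poisson t *\<^sub>R f t \<partial>circle)"
  using integral_distr[of "alpha \<beta>" circle borel f] integral_density[of f circle poisson] poisson_nonneg
  by (simp add: distr_alpha)

lemma comp_alpha_Lp:
  assumes "f \<in> Lp p"
  shows "comp_alpha \<beta> f \<in> Lp p"
proof (cases f rule: L0_exhaust)
  case (1 h)
  have [measurable]: "h \<in> borel_measurable borel" by fact
  have hi: "integrable circle (\<lambda>t. cmod (h t) powr p)" using 1 assms by (simp add: Lp_abs)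
  have "integrable circle (\<lambda>t. poisson t *\<^sub>R cmod (h t) powr p)"
  proof (rule Bochner_Integration.integrable_bound)
    show "integrable circle (\<lambda>t. ((cmod \<beta>)\<^sup>2 - 1) / (cmod \<beta> - 1)\<^sup>2 * cmod (h t) powr p)"
      using hi by simp
    show "AE t in circle. norm (poisson t *\<^sub>R cmod (h t) powr p)
        \<le> norm (((cmod \<beta>)\<^sup>2 - 1) / (cmod \<beta> - 1)\<^sup>2 * cmod (h t) powr p)"
      using AE_circle_norm
    proof eventually_elim
      case (elim t)
      have "poisson t * cmod (h t) powr p \<le> ((cmod \<beta>)\<^sup>2 - 1) / (cmod \<beta> - 1)\<^sup>2 * cmod (h t) powr p"
        by (intro mult_right_mono poisson_bound elim) auto
      then show ?case using poisson_nonneg[of t] by (simp del: times_divide_eq_left)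
    qed
  qed measurable
  then have "integrable (density circle poisson) (\<lambda>t. cmod (h t) powr p)"
    by (subst integrable_density) (auto simp: poisson_nonneg)
  then have "integrable circle (\<lambda>t. cmod (h (alpha \<beta> t)) powr p)"
    unfolding distr_alpha[symmetric] by (subst (asm) integrable_distr_eq) auto
  then show ?thesis using 1 by (simp add: comp_alpha_abs[OF \<beta>] Lp_abs)
qed

text \<open>Substituting \<alpha>, which is its own inverse on the circle, takes the shift off f and
  puts it on the monomial, at the price of the Poisson kernel.\<close>

lemma fourier_comp_alpha:
  "fourier (comp_alpha \<beta> f) n = fourier (poisson_L0 * (comp_alpha \<beta> (tpow (- n)) * f)) 0"
proof (cases f rule: L0_exhaust)
  case (1 h)
  have [measurable]: "h \<in> borel_measurable borel" by fact
  have "(\<integral>t. h (alpha \<beta> t) * t powi (- n) \<partial>circle)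
    = (\<integral>t. h (alpha \<beta> t) * alpha \<beta> (alpha \<beta> t) powi (- n) \<partial>circle)"
  proof (rule integral_cong_AE)
    show "AE t in circle. h (alpha \<beta> t) * t powi (- n) = h (alpha \<beta> t) * alpha \<beta> (alpha \<beta> t) powi (- n)"
      using AE_circle_norm by eventually_elim (simp add: alpha_circle[OF \<beta>])
  qed measurable
  also have "\<dots> = (\<integral>t. poisson t *\<^sub>R (h t * alpha \<beta> t powi (- n)) \<partial>circle)"
    by (rule integral_alpha) measurable
  finally show ?thesis
    by (simp add: 1(2) comp_alpha_abs[OF \<beta>] comp_alpha_tpow poisson_L0_def abs_L0_simps fourier_abs
        scaleR_conv_of_real mult_ac)
qed

text \<open>The shift maps the disc to the exterior, so nonnegative spectrum becomes nonpositive.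
  The n-th coefficient is a mean of the kernel times the power -n of \<alpha> times f. The power has
  a zero at \<open>1 / cnj \<beta>\<close> that cancels the pole of the kernel there, and the kernel
  vanishes at 0, so the product is analytic with mean 0.\<close>

lemma comp_alpha_analytic:
  assumes f: "f \<in> Lp 1" "\<And>k. k < 0 \<Longrightarrow> fourier f k = 0" and n: "n > 0"
  shows "fourier (comp_alpha \<beta> f) n = 0"
proof -
  define j where "j = nat n - 1"
  have nj: "- n = - int (Suc j)" using n by (simp add: j_def)
  define v where "v = comp_alpha \<beta> (tpow (- n)) * f"
  define u where "u = comp_alpha \<beta> (tpow (- int j)) * f"
  have v1: "v \<in> Lp 1" and u1: "u \<in> Lp 1"
    by (simp_all add: v_def u_def Linf_mult_Lp comp_alpha_tpow_Linf f(1))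
  have z1: "poisson_L0 * v \<in> Lp 1" by (simp add: Linf_mult_Lp poisson_Linf v1)
  have z2: "lin_out \<beta> * (poisson_L0 * v) \<in> Lp 1" by (simp add: Linf_mult_Lp lin_Linf z1)
  have vu: "lin_out \<beta> * v = lin_in \<beta> * u"
    using lin_in_alpha_Suc[of "- int (Suc j)"] nj by (simp add: v_def u_def flip: mult.assoc)
  \<comment> \<open>One factor \<open>lin_out\<close> clears the pole of the kernel at \<beta>, the
    other one power of \<alpha>. The remaining \<open>tpow 1\<close> is the zero of the kernel at
    0.\<close>
  have e: "lin_out \<beta> * (lin_out \<beta> * (poisson_L0 * v)) = cscale (1 - (cmod \<beta>)\<^sup>2) (tpow 1 * u)"
  proof -
    have "lin_out \<beta> * (lin_out \<beta> * (poisson_L0 * v)) = lin_out \<beta> * (poisson_L0 * (lin_out \<beta> * v))"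
      by (simp add: mult_ac)
    also have "\<dots> = (lin_out \<beta> * (lin_in \<beta> * poisson_L0)) * u"
      unfolding vu by (simp add: mult_ac)
    also have "\<dots> = cscale (1 - (cmod \<beta>)\<^sup>2) (tpow 1 * u)"
      unfolding poisson_factor by (metis cscale_eq_mult mult.assoc)
    finally show ?thesis .
  qed
  have "fourier (lin_out \<beta> * (poisson_L0 * v)) k = 0" if "k < 1" for k
    by (rule fourier_lin_outD[OF z2, of 1])
       (use that comp_alpha_tpow_neg_mult[OF f, of _ j] in
         \<open>auto simp: e fourier_cscale fourier_tpow_mult u_def\<close>)
  then have "fourier (poisson_L0 * v) 0 = 0"
    by (intro fourier_lin_outD[OF z1, of 1]) auto
  then show ?thesis by (simp add: fourier_comp_alpha v_def)
qed

text \<open>The mirror image, with infinity in the place of 0: the positive power of \<alpha> has a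
  zero at \<beta> that cancels the outer pole of the kernel, and the kernel vanishes at
  infinity.\<close>

lemma comp_alpha_coanalytic:
  assumes f: "f \<in> Lp 1" "\<And>k. k > 0 \<Longrightarrow> fourier f k = 0" and n: "n < 0"
  shows "fourier (comp_alpha \<beta> f) n = 0"
proof -
  define j where "j = nat (- n) - 1"
  have nj: "- n = int j + 1" using n by (simp add: j_def)
  define v where "v = comp_alpha \<beta> (tpow (- n)) * f"
  define u where "u = comp_alpha \<beta> (tpow (int j)) * f"
  have v1: "v \<in> Lp 1" and u1: "u \<in> Lp 1"
    by (simp_all add: v_def u_def Linf_mult_Lp comp_alpha_tpow_Linf f(1))
  have z1: "poisson_L0 * v \<in> Lp 1" by (simp add: Linf_mult_Lp poisson_Linf v1)
  have z2: "lin_in \<beta> * (poisson_L0 * v) \<in> Lp 1" by (simp add: Linf_mult_Lp lin_Linf z1)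
  have vu: "lin_in \<beta> * v = lin_out \<beta> * u"
    using lin_in_alpha_Suc[of "int j"] nj by (simp add: v_def u_def flip: mult.assoc)
  have e: "lin_in \<beta> * (lin_in \<beta> * (poisson_L0 * v)) = cscale (1 - (cmod \<beta>)\<^sup>2) (tpow 1 * u)"
  proof -
    have "lin_in \<beta> * (lin_in \<beta> * (poisson_L0 * v)) = lin_in \<beta> * (poisson_L0 * (lin_in \<beta> * v))"
      by (simp add: mult_ac)
    also have "\<dots> = (lin_out \<beta> * (lin_in \<beta> * poisson_L0)) * u"
      unfolding vu by (simp add: mult_ac)
    also have "\<dots> = cscale (1 - (cmod \<beta>)\<^sup>2) (tpow 1 * u)"
      unfolding poisson_factor by (metis cscale_eq_mult mult.assoc)
    finally show ?thesis .
  qed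
  have "fourier (lin_in \<beta> * (poisson_L0 * v)) k = 0" if "k > 0" for k
    by (rule fourier_lin_inD[OF z2, of 0])
       (use that comp_alpha_tpow_pos_mult[OF f, of _ j] in
         \<open>auto simp: e fourier_cscale fourier_tpow_mult u_def\<close>)
  \<comment> \<open>The second division by \<open>lin_in\<close> lowers the top frequency from 0 to
    -1, which reaches the coefficient at 0.\<close>
  then have "fourier (poisson_L0 * v) 0 = 0"
    by (intro fourier_lin_inD[OF z1, of "-1"]) auto
  then show ?thesis by (simp add: fourier_comp_alpha v_def)
qed

end

section \<open>Evaluation in the disc and kernels of Toeplitz operators\<close>

interpretation L0_pair: vector_space_pair cscale cscale ..

lemma mult_cscale: "cscale c f * g = cscale c (f * g)" "f * cscale c g = cscale c (f * g)"
  by (metis cscale_eq_mult mult.assoc mult.left_commute)+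

lemma lam_square: "1 < cmod \<beta> \<Longrightarrow> lam \<beta> * lam \<beta> = 1 - \<beta> * cnj \<beta>"
proof -
  assume "1 < cmod \<beta>"
  then have *: "0 \<le> (cmod \<beta>)\<^sup>2 - 1" by simp
  define s where "s = sqrt ((cmod \<beta>)\<^sup>2 - 1)"
  have "lam \<beta> = \<i> * of_real s" by (simp add: lam_def s_def)
  then have "lam \<beta> * lam \<beta> = - of_real (s * s)" by (simp add: algebra_simps)
  also have "s * s = (cmod \<beta>)\<^sup>2 - 1"
    unfolding s_def using * by (rule real_sqrt_mult_self[THEN trans, OF abs_of_nonneg])
  finally show ?thesis by (simp add: complex_norm_square[symmetric])
qed

lemma lam_nonzero: "1 < cmod \<beta> \<Longrightarrow> lam \<beta> \<noteq> 0"
  by (simp add: lam_def power2_eq_1_iff)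

context
  fixes \<beta> :: complex
  assumes \<beta>: "1 < cmod \<beta>"
begin

lemma lin_in_chi: "lin_in \<beta> = cscale (lam \<beta>) (chi \<beta>)"
  by (simp add: lin_abs chi_def abs_L0_simps lam_nonzero[OF \<beta>])

lemma chi_inverse: "chi \<beta> * inverse (chi \<beta>) = 1"
  unfolding chi_def one_abs
  by (simp add: abs_L0_simps, rule abs_L0_eqI) (use lin_nonzero[OF \<beta>] lam_nonzero[OF \<beta>] in auto)

text \<open>This is the reason for dividing by \<open>lam\<close> in \<open>chi\<close>: at
  \<open>alpha \<beta> t\<close> the affine factor equals
  \<open>(1 - \<beta> * cnj \<beta>) / (cnj \<beta> * t - 1)\<close>, and the numerator is the
  square of \<open>lam \<beta>\<close>.\<close>

lemma comp_alpha_chi: "comp_alpha \<beta> (chi \<beta>) = inverse (chi \<beta>)"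
  unfolding chi_def
proof (simp add: comp_alpha_abs[OF \<beta>] abs_L0_simps, rule abs_L0_eqI)
  fix t :: complex assume t: "cmod t = 1"
  have nz: "cnj \<beta> * t - 1 \<noteq> 0" using lin_nonzero[OF \<beta> t] by simp
  have "cnj \<beta> * alpha \<beta> t - 1 = lam \<beta> * lam \<beta> / (cnj \<beta> * t - 1)"
    using nz unfolding alpha_def lam_square[OF \<beta>] by (simp add: field_simps)
  then show "(cnj \<beta> * alpha \<beta> t - 1) / lam \<beta> = lam \<beta> / (cnj \<beta> * t - 1)"
    using lam_nonzero[OF \<beta>] by simp
qed measurable

lemma inverse_lin_out: "inverse (lin_out \<beta>) = inverse (lin_in \<beta>) * comp_alpha \<beta> (tpow (- 1))"
proof -
  have "lin_out \<beta> * (inverse (lin_in \<beta>) * comp_alpha \<beta> (tpow (- 1)))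
    = (lin_in \<beta> * inverse (lin_in \<beta>)) * comp_alpha \<beta> (tpow 1 * tpow (- 1))"
    by (simp only: lin_in_alpha[OF \<beta>, symmetric] comp_alpha_simps[OF \<beta>] mult_ac)
  also have "\<dots> = lin_out \<beta> * inverse (lin_out \<beta>)"
    by (simp add: lin_inverse[OF \<beta>] comp_alpha_simps[OF \<beta>])
  finally show ?thesis using lin_cancel[OF \<beta>] by metis
qed

lemma inverse_lin_out_Linf: "inverse (lin_out \<beta>) \<in> Linf"
  unfolding inverse_lin_out by (intro Linf_mult inverse_lin_in_Linf comp_alpha_tpow_Linf \<beta>)

lemma inverse_lin_out_power_analytic:
  assumes f: "f \<in> Lp 1" "\<And>k. k < 0 \<Longrightarrow> fourier f k = 0" and "k < 0"
  shows "fourier (inverse (lin_out \<beta>) ^ j * f) k = 0"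
  using \<open>k < 0\<close>
proof (induction j arbitrary: k)
  case (Suc j)
  have m: "inverse (lin_out \<beta>) ^ i * f \<in> Lp 1" for i
    using f by (intro Linf_mult_Lp Linf_power inverse_lin_out_Linf) auto
  have "lin_out \<beta> * (inverse (lin_out \<beta>) ^ Suc j * f) = (lin_out \<beta> * inverse (lin_out \<beta>)) * (inverse (lin_out \<beta>) ^ j * f)"
    by (simp add: mult_ac)
  then show ?case
    using Suc by (intro fourier_lin_outD[OF \<beta> m, of 0]) (auto simp: lin_inverse[OF \<beta>])
qed (use f in auto)

text \<open>The function \<open>t / (cnj \<beta> * t - 1)\<close> has its pole inside the disc and
  is finite at infinity, so multiplication by its powers keeps the spectrum nonpositive.\<close>

lemma inverse_lin_in_power_coanalytic:
  assumes f: "f \<in> Lp 1" "\<And>k. k > 0 \<Longrightarrow> fourier f k = 0" and "k > 0"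
  shows "fourier ((tpow 1 * inverse (lin_in \<beta>)) ^ j * f) k = 0"
  using \<open>k > 0\<close>
proof (induction j arbitrary: k)
  case (Suc j)
  have m: "(tpow 1 * inverse (lin_in \<beta>)) ^ i * f \<in> Lp 1" for i
    using f by (intro Linf_mult_Lp Linf_power Linf_mult inverse_lin_in_Linf[OF \<beta>] tpow_Linf) auto
  have "lin_in \<beta> * ((tpow 1 * inverse (lin_in \<beta>)) ^ Suc j * f)
    = (lin_in \<beta> * inverse (lin_in \<beta>)) * (tpow 1 * ((tpow 1 * inverse (lin_in \<beta>)) ^ j * f))"
    by (simp add: mult_ac)
  then have "lin_in \<beta> * ((tpow 1 * inverse (lin_in \<beta>)) ^ Suc j * f) = tpow 1 * ((tpow 1 * inverse (lin_in \<beta>)) ^ j * f)"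
    by (simp only: lin_inverse[OF \<beta>] mult_1)
  then show ?case
    using Suc by (intro fourier_lin_inD[OF \<beta> m, of 0]) (auto simp: fourier_tpow_mult simp del: power_Suc)
qed (use f in auto)

text \<open>Multiplication by the Cauchy kernel \<open>1 / (1 - z / t)\<close> for z =
  \<open>1 / cnj \<beta>\<close>. Its expansion in powers of \<open>z / t\<close> makes evaluation
  at z the coefficient at 0 of the result.\<close>

definition cauchy :: "L0 \<Rightarrow> L0" where
  "cauchy f = cscale (cnj \<beta>) (tpow 1 * (inverse (lin_in \<beta>) * f))"

lemma cauchy_L1: "f \<in> Lp 1 \<Longrightarrow> cauchy f \<in> Lp 1"
  by (simp add: cauchy_def Lp_cscale Linf_mult_Lp inverse_lin_in_Linf[OF \<beta>] tpow_Linf)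

lemma lin_in_cauchy: "lin_in \<beta> * cauchy f = cscale (cnj \<beta>) (tpow 1 * f)"
proof -
  have "lin_in \<beta> * cauchy f = cscale (cnj \<beta>) 1 * (tpow 1 * ((lin_in \<beta> * inverse (lin_in \<beta>)) * f))"
    unfolding cauchy_def cscale_eq_mult[of "cnj \<beta>" "tpow 1 * (inverse (lin_in \<beta>) * f)"] by (simp add: mult_ac)
  then show ?thesis by (simp add: lin_inverse[OF \<beta>] flip: cscale_eq_mult)
qed

lemma fourier_cauchy:
  assumes "f \<in> Lp 1"
  shows "fourier f k = fourier (cauchy f) k - 1 / cnj \<beta> * fourier (cauchy f) (k + 1)"
proof -
  have b0: "cnj \<beta> \<noteq> 0" using \<beta> by auto
  have "cnj \<beta> * fourier (cauchy f) k - fourier (cauchy f) (k + 1) = cnj \<beta> * fourier f k"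
    using fourier_lin_in[OF \<beta> cauchy_L1[OF assms], of "k + 1"]
    by (simp add: lin_in_cauchy fourier_cscale fourier_tpow_mult)
  then show ?thesis using b0 by (simp add: field_simps)
qed

text \<open>By \<open>fourier_cauchy\<close> the partial sums telescope; the remainder is
  \<open>z ^ N\<close> times a bounded coefficient.\<close>

lemma disc_ext_cauchy:
  assumes f: "f \<in> Lp 1"
  shows "disc_ext f (1 / cnj \<beta>) = fourier (cauchy f) 0"
proof -
  define z where "z = 1 / cnj \<beta>"
  obtain C where C: "\<And>n. cmod (fourier (cauchy f) n) \<le> C"
    using fourier_bounded[OF cauchy_L1[OF f]] by blast
  have part: "(\<Sum>k<N. fourier f (int k) * z ^ k) = fourier (cauchy f) 0 - z ^ N * fourier (cauchy f) (int N)" for N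
  proof (induction N)
    case (Suc N)
    have e: "fourier f (int N) = fourier (cauchy f) (int N) - z * fourier (cauchy f) (int (Suc N))"
      using fourier_cauchy[OF f, of "int N"] by (simp add: z_def add.commute)
    show ?case unfolding sum.lessThan_Suc Suc.IH e by (simp add: algebra_simps)
  qed simp
  have z: "cmod z < 1" using \<beta> by (simp add: z_def norm_divide divide_less_eq)
  have "(\<lambda>N. z ^ N * fourier (cauchy f) (int N)) \<longlonglongrightarrow> 0"
  proof (rule Lim_null_comparison)
    show "\<forall>\<^sub>F N in sequentially. cmod (z ^ N * fourier (cauchy f) (int N)) \<le> cmod z ^ N * C"
      using C by (intro always_eventually) (simp add: norm_mult norm_power mult_left_mono)
    show "(\<lambda>N. cmod z ^ N * C) \<longlonglongrightarrow> 0"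
      using z by (intro tendsto_mult_left_zero LIMSEQ_power_zero) auto
  qed
  from tendsto_diff[OF tendsto_const this, of "fourier (cauchy f) 0"]
  have "(\<lambda>k. fourier f (int k) * z ^ k) sums fourier (cauchy f) 0"
    by (simp add: sums_def part)
  then show ?thesis by (simp add: disc_ext_def z_def sums_iff)
qed

lemma disc_ext_cscale:
  assumes "f \<in> Lp 1"
  shows "disc_ext (cscale c f) (1 / cnj \<beta>) = c * disc_ext f (1 / cnj \<beta>)"
proof -
  have "cauchy (cscale c f) = cscale c (cauchy f)"
    by (simp add: cauchy_def mult_cscale mult_ac)
  then show ?thesis using assms by (simp add: disc_ext_cauchy Lp_cscale fourier_cscale)
qed

lemma disc_ext_lin_out_power:
  assumes f: "f \<in> Lp 1" "\<And>k. k < 0 \<Longrightarrow> fourier f k = 0"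
  shows "disc_ext (lin_out \<beta> ^ n * f) (1 / cnj \<beta>) = (1 / cnj \<beta> - \<beta>) ^ n * disc_ext f (1 / cnj \<beta>)"
proof (induction n)
  case (Suc n)
  define h where "h = lin_out \<beta> ^ n * f"
  have m: "lin_out \<beta> ^ i * f \<in> Lp 1" for i
    using f by (intro Linf_mult_Lp Linf_power lin_Linf \<beta>) auto
  have hneg: "fourier h k = 0" if "k < 0" for k
    unfolding h_def using that
  proof (induction n arbitrary: k)
    case (Suc n)
    have "fourier (lin_out \<beta> * (lin_out \<beta> ^ n * f)) k = 0"
      using Suc by (simp add: fourier_lin_out[OF \<beta> m])
    then show ?case by (simp add: mult.assoc)
  qed (use f in auto)
  have h1: "h \<in> Lp 1" unfolding h_def by (rule m)
  have c: "cauchy (lin_out \<beta> * h) = lin_out \<beta> * cauchy h"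
    by (simp add: cauchy_def mult_cscale mult_ac)
  have "disc_ext (lin_out \<beta> ^ Suc n * f) (1 / cnj \<beta>) = fourier (lin_out \<beta> * cauchy h) 0"
    using m[of "Suc n"] by (simp add: disc_ext_cauchy h_def[symmetric] mult.assoc c)
  \<comment> \<open>As h has no coefficient at -1, that of \<open>cauchy h\<close> is
    \<open>1 / cnj \<beta>\<close> times the one at 0, so here \<open>tpow 1\<close> acts as its
    value at the point.\<close>
  also have "\<dots> = (1 / cnj \<beta> - \<beta>) * fourier (cauchy h) 0"
    using fourier_cauchy[OF h1, of "-1"] hneg[of "-1"]
    by (simp add: fourier_lin_out[OF \<beta> cauchy_L1[OF h1]] algebra_simps)
  finally show ?case using Suc by (simp add: h_def disc_ext_cauchy[OF m] mult.assoc)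
qed simp

text \<open>The shift sends \<open>1 / cnj \<beta>\<close> to infinity, where f has the value
  \<open>fourier f 0\<close>. That number is the Poisson mean of h, and the value of h is its Cauchy
  mean. They agree since \<open>lin_out \<beta> * d = tpow 1 * h\<close> leaves the difference d
  with positive frequencies only.\<close>

lemma disc_ext_comp_alpha:
  assumes f: "f \<in> Lp 1" "\<And>k. k > 0 \<Longrightarrow> fourier f k = 0"
  shows "disc_ext (comp_alpha \<beta> f) (1 / cnj \<beta>) = fourier f 0"
proof -
  define h where "h = comp_alpha \<beta> f"
  have h1: "h \<in> Lp 1" unfolding h_def by (rule comp_alpha_Lp[OF \<beta> f(1)])
  have hneg: "fourier h k = 0" if "k < 0" for k
    unfolding h_def by (rule comp_alpha_coanalytic[OF \<beta> f that])
  have f0: "fourier f 0 = fourier (poisson_L0 \<beta> * h) 0"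
    using fourier_comp_alpha[OF \<beta>, of h 0] by (simp add: h_def comp_alpha_involutive[OF \<beta>] comp_alpha_simps[OF \<beta>])
  define d where "d = cauchy h - poisson_L0 \<beta> * h"
  have p1: "poisson_L0 \<beta> * h \<in> Lp 1" by (simp add: Linf_mult_Lp poisson_Linf[OF \<beta>] h1)
  have d1: "d \<in> Lp 1" by (simp add: d_def Lp_diff p1 cauchy_L1 h1)
  have "lin_in \<beta> * (lin_out \<beta> * d)
    = lin_out \<beta> * (lin_in \<beta> * cauchy h) - (lin_out \<beta> * (lin_in \<beta> * poisson_L0 \<beta>)) * h"
    by (simp add: d_def algebra_simps)
  also have "\<dots> = (cscale (cnj \<beta>) (tpow 1 * lin_out \<beta>) - cscale (1 - (cmod \<beta>)\<^sup>2) (tpow 1)) * h"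
    unfolding lin_in_cauchy poisson_factor[OF \<beta>]
    by (simp add: mult_cscale algebra_simps)
  also have "cscale (cnj \<beta>) (tpow 1 * lin_out \<beta>) - cscale (1 - (cmod \<beta>)\<^sup>2) (tpow 1) = lin_in \<beta> * tpow 1"
  proof -
    have "cnj \<beta> * (t * (t - \<beta>)) - (1 - \<beta> * cnj \<beta>) * t = (cnj \<beta> * t - 1) * t" for t
      by (simp add: algebra_simps)
    moreover have "(complex_of_real (cmod \<beta>))\<^sup>2 = \<beta> * cnj \<beta>"
      by (metis complex_norm_square of_real_power)
    ultimately show ?thesis
      by (simp add: lin_abs tpow_abs abs_L0_simps)
  qed
  finally have "lin_out \<beta> * d = tpow 1 * h"
    using lin_cancel(2)[OF \<beta>, of "lin_out \<beta> * d" "tpow 1 * h"] by (simp add: mult.assoc)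
  then have "fourier d 0 = 0"
    by (intro fourier_lin_outD[OF \<beta> d1, of 1]) (auto simp: fourier_tpow_mult hneg)
  then show ?thesis
    using f0 by (simp add: d_def fourier_diff cauchy_L1 h1 p1 disc_ext_cauchy flip: h_def)
qed

end

section \<open>The Riesz projection and the kernel in terms of coefficients\<close>

lemma riesz_P_eqI:
  assumes "h \<in> Lp 1" "\<And>n. fourier h n = (if n \<ge> 0 then fourier f n else 0)"
  shows "riesz_P f = h"
  unfolding riesz_P_def
  by (rule the_equality) (use assms in \<open>auto intro!: fourier_unique\<close>)

lemma riesz_P_Hp: "1 < p \<Longrightarrow> f \<in> Hp p \<Longrightarrow> riesz_P f = f"
  by (rule riesz_P_eqI) (auto simp: Hp_def Lp_L1)

lemma Hp_add: "1 < p \<Longrightarrow> f \<in> Hp p \<Longrightarrow> g \<in> Hp p \<Longrightarrow> f + g \<in> Hp p"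
  by (auto simp: Hp_def Lp_add fourier_add Lp_L1)

lemma Hp_cscale: "f \<in> Hp p \<Longrightarrow> cscale c f \<in> Hp p"
  by (auto simp: Hp_def Lp_cscale fourier_cscale)

lemma fourier_sum:
  assumes "\<And>i. i \<in> I \<Longrightarrow> f i \<in> Lp 1"
  shows "(\<Sum>i\<in>I. f i) \<in> Lp 1 \<and> fourier (\<Sum>i\<in>I. f i) n = (\<Sum>i\<in>I. fourier (f i) n)"
  using assms by (induction I rule: infinite_finite_induct) (auto simp: Lp_0 Lp_add fourier_add)

lemma inj_tpow: "inj tpow"
proof (rule injI)
  fix i j assume "tpow i = tpow j"
  then have "fourier (tpow i) i = fourier (tpow j) i" by simp
  then show "i = j" by (simp add: fourier_tpow split: if_splits)
qed

lemma independent_tpow: "L0.independent (tpow ` S)"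
  unfolding L0.independent_explicit_module
proof (intro allI impI)
  fix t u v
  assume t: "finite t" "t \<subseteq> tpow ` S" and z: "(\<Sum>v\<in>t. cscale (u v) v) = 0" and v: "v \<in> t"
  obtain k where k: "v = tpow k" using t v by auto
  have "0 = fourier (\<Sum>v\<in>t. cscale (u v) v) k" using z by simp
  also have "\<dots> = (\<Sum>w\<in>t. fourier (cscale (u w) w) k)"
    using t by (intro conjunct2[OF fourier_sum]) (auto intro!: Lp_cscale Linf_Lp tpow_Linf)
  also have "\<dots> = (\<Sum>w\<in>t. if w = v then u v else 0)"
  proof (rule sum.cong)
    fix w assume "w \<in> t"
    then obtain j where "w = tpow j" using t by auto
    then show "fourier (cscale (u w) w) k = (if w = v then u v else 0)"
      using k by (auto simp: fourier_cscale fourier_tpow inj_eq[OF inj_tpow])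
  qed simp
  also have "\<dots> = u v" using t v by simp
  finally show "u v = 0" by simp
qed

text \<open>\<open>riesz_P f\<close> has a fixed junk value \<open>u\<close> when no projection of \<open>f\<close> exists. If that occurred for
  some \<open>g * \<phi>\<close>, homogeneity would give \<open>u = 0\<close> and additivity would then make \<open>toeplitz g\<close> vanish on
  \<open>Hp p\<close>, contradicting that its kernel is finite dimensional. So M. Riesz's theorem is not needed.\<close>

lemma fredholm_riesz_exists:
  assumes p: "1 < p" and g: "g \<in> Linf" and F: "fredholm p (toeplitz g)" and \<phi>: "\<phi> \<in> Hp p"
  shows "\<exists>h\<in>Lp 1. \<forall>n. fourier h n = (if n \<ge> 0 then fourier (g * \<phi>) n else 0)"
proof (rule ccontr)
  define E where "E \<psi> \<longleftrightarrow> (\<exists>h\<in>Lp 1. \<forall>n. fourier h n = (if n \<ge> 0 then fourier (g * \<psi>) n else 0))" for \<psi>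
  define u :: L0 where "u = (THE h. False)"
  assume "\<not> (\<exists>h\<in>Lp 1. \<forall>n. fourier h n = (if n \<ge> 0 then fourier (g * \<phi>) n else 0))"
  then have nE: "\<not> E \<phi>" by (simp add: E_def)
  have A: "toeplitz g \<psi> = u" if "\<not> E \<psi>" for \<psi>
    using that unfolding toeplitz_def riesz_P_def u_def E_def by (intro arg_cong[where f=The] ext) blast
  have gL: "g * \<psi> \<in> Lp 1" if "\<psi> \<in> Hp p" for \<psi>
    using that g p by (intro Linf_mult_Lp Lp_L1[OF p]) (auto simp: Hp_def)
  have add: "toeplitz g (x + y) = toeplitz g x + toeplitz g y" if "x \<in> Hp p" "y \<in> Hp p" for x y
    using F that by (simp add: fredholm_def bounded_operator_def)
  have Eadd: "\<not> E (\<phi> + \<psi>)" if \<psi>: "\<psi> \<in> Hp p" "E \<psi>" for \<psi>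
  proof
    assume "E (\<phi> + \<psi>)"
    then obtain h where h: "h \<in> Lp 1" "\<And>n. fourier h n = (if n \<ge> 0 then fourier (g * (\<phi> + \<psi>)) n else 0)"
      by (auto simp: E_def)
    obtain k where k: "k \<in> Lp 1" "\<And>n. fourier k n = (if n \<ge> 0 then fourier (g * \<psi>) n else 0)"
      using \<psi>(2) by (auto simp: E_def)
    have "fourier (h - k) n = (if n \<ge> 0 then fourier (g * \<phi>) n else 0)" for n
      using h k gL[OF \<phi>] gL[OF \<psi>(1)] by (simp add: fourier_diff ring_distribs fourier_add)
    moreover have "h - k \<in> Lp 1" using h k by (simp add: Lp_diff)
    ultimately show False using nE by (auto simp: E_def)
  qed
  have "\<not> E (\<phi> + \<phi>)"
  proof
    assume "E (\<phi> + \<phi>)"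
    then obtain h where h: "h \<in> Lp 1" "\<And>n. fourier h n = (if n \<ge> 0 then fourier (g * (\<phi> + \<phi>)) n else 0)"
      by (auto simp: E_def)
    have "fourier (g * (\<phi> + \<phi>)) n = 2 * fourier (g * \<phi>) n" for n
      unfolding ring_distribs fourier_add[OF gL[OF \<phi>] gL[OF \<phi>]] by simp
    then have "fourier (cscale (1/2) h) n = (if n \<ge> 0 then fourier (g * \<phi>) n else 0)" for n
      using h by (simp add: fourier_cscale)
    then show False using nE Lp_cscale[OF h(1), of "1/2"] by (auto simp: E_def)
  qed
  then have "u = u + u" using add[OF \<phi> \<phi>] A nE by simp
  then have u: "u = 0" by simp
  have zero: "toeplitz g \<psi> = 0" if \<psi>: "\<psi> \<in> Hp p" for \<psi>
  proof (cases "E \<psi>")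
    case True
    then show ?thesis using add[OF \<phi> \<psi>] A[OF Eadd[OF \<psi> True]] A[OF nE] u by simp
  qed (simp add: A u)
  obtain B where B: "finite B" "ker_Hp p (toeplitz g) \<subseteq> L0.span B"
    using F by (auto simp: fredholm_def)
  have "tpow k \<in> Hp p" if "k \<ge> 0" for k
    using that p by (auto simp: Hp_def fourier_tpow Linf_Lp tpow_Linf)
  then have "tpow ` {0..} \<subseteq> L0.span B"
    using B(2) zero by (auto simp: ker_Hp_def)
  then have "finite (tpow ` {0..})"
    using L0.independent_span_bound[OF B(1) independent_tpow] by blast
  then show False
    using finite_imageD[OF _ inj_on_subset[OF inj_tpow]] infinite_Ici[of "0::int"] by blast
qed

text \<open>Existence of the projection turns the definite description in \<open>riesz_P\<close>
  into a condition on coefficients, to which the factorization can be applied.\<close>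

lemma ker_toeplitz_iff:
  assumes p: "1 < p" and g: "g \<in> Linf" and F: "fredholm p (toeplitz g)"
  shows "\<phi> \<in> ker_Hp p (toeplitz g) \<longleftrightarrow> \<phi> \<in> Hp p \<and> (\<forall>k\<ge>0. fourier (g * \<phi>) k = 0)"
proof (cases "\<phi> \<in> Hp p")
  case True
  obtain h where h: "h \<in> Lp 1" "\<And>n. fourier h n = (if n \<ge> 0 then fourier (g * \<phi>) n else 0)"
    using fredholm_riesz_exists[OF p g F True] by blast
  then have "toeplitz g \<phi> = h" unfolding toeplitz_def by (rule riesz_P_eqI)
  moreover have "h = 0 \<longleftrightarrow> (\<forall>n. fourier h n = 0)"
    using fourier_unique[OF h(1) Lp_0] by auto
  ultimately show ?thesis using True h(2) by (auto simp: ker_Hp_def)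
qed (simp add: ker_Hp_def)

section \<open>Spans of powers and a dimension count\<close>

lemma Laurent_polynomial_span:
  assumes f: "f \<in> Lp 1" and z: "\<And>k. k < 0 \<or> k \<ge> int N \<Longrightarrow> fourier f k = 0"
  shows "f \<in> L0.span ((\<lambda>j. tpow 1 ^ j) ` {..<N})"
proof -
  have "f = (\<Sum>j<N. cscale (fourier f (int j)) (tpow (int j)))"
  proof (rule fourier_unique[OF f])
    show "(\<Sum>j<N. cscale (fourier f (int j)) (tpow (int j))) \<in> Lp 1"
      by (intro conjunct1[OF fourier_sum] Lp_cscale Linf_Lp tpow_Linf) auto
    fix n
    have "fourier (\<Sum>j<N. cscale (fourier f (int j)) (tpow (int j))) n
      = (\<Sum>j<N. fourier (cscale (fourier f (int j)) (tpow (int j))) n)"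
      by (intro conjunct2[OF fourier_sum] Lp_cscale Linf_Lp tpow_Linf) auto
    also have "\<dots> = (\<Sum>j<N. if n = int j then fourier f n else 0)"
      by (rule sum.cong) (auto simp: fourier_cscale fourier_tpow)
    also have "\<dots> = fourier f n"
    proof (cases "0 \<le> n \<and> n < int N")
      case True
      then have "(\<Sum>j<N. if n = int j then fourier f n else 0) = (\<Sum>j<N. if nat n = j then fourier f n else 0)"
        by (intro sum.cong) auto
      then show ?thesis using True by (simp add: nat_less_iff)
    next
      case False
      then have "fourier f n = 0" using z by auto
      then show ?thesis by (metis (mono_tags, lifting) sum.neutral)
    qed
    finally show "fourier f n = fourier (\<Sum>j<N. cscale (fourier f (int j)) (tpow (int j))) n" ..
  qed
  moreover have "\<dots> \<in> L0.span ((\<lambda>j. tpow 1 ^ j) ` {..<N})"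
    by (intro L0.span_sum L0.span_scale L0.span_base) (auto simp: tpow_power)
  ultimately show ?thesis by simp
qed

text \<open>A power of an affine function of x is a polynomial in x of no larger degree; it is used
  in both directions between t and \<open>chi\<close>.\<close>

lemma span_powers_affine:
  assumes y: "y = cscale a x + cscale b 1"
  shows "L0.span ((\<lambda>j. y ^ j) ` {..<N}) \<subseteq> L0.span ((\<lambda>j. x ^ j) ` {..<N})"
proof (rule L0.span_minimal)
  have "y ^ j \<in> L0.span ((\<lambda>j. x ^ j) ` {..<Suc j})" for j
  proof (induction j)
    case (Suc j)
    have "y * v \<in> L0.span ((\<lambda>j. x ^ j) ` {..<Suc (Suc j)})"
      if "v \<in> L0.span ((\<lambda>j. x ^ j) ` {..<Suc j})" for v
      using that
    proof (induction rule: L0.span_induct_alt)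
      case base
      then show ?case by (simp add: L0.span_zero)
    next
      case (step c w v)
      then obtain i where i: "i < Suc j" "w = x ^ i" by auto
      have "y * (cscale c w + v) = cscale (c * a) (x ^ Suc i) + cscale (c * b) (x ^ i) + y * v"
      proof -
        have "cscale c w = cscale c 1 * x ^ i" "cscale (c * a) (x ^ Suc i) = cscale c 1 * cscale a 1 * (x * x ^ i)"
          "cscale (c * b) (x ^ i) = cscale c 1 * cscale b 1 * x ^ i" "cscale a x = cscale a 1 * x"
          using i by (metis L0.scale_scale cscale_eq_mult mult.assoc power_Suc)+
        then show ?thesis by (simp add: y algebra_simps)
      qed
      moreover have "x ^ Suc i \<in> L0.span ((\<lambda>j. x ^ j) ` {..<Suc (Suc j)})"
        "x ^ i \<in> L0.span ((\<lambda>j. x ^ j) ` {..<Suc (Suc j)})"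
        using i by (auto intro!: L0.span_base simp del: power_Suc)
      ultimately show ?case using step
        by (metis L0.span_add L0.span_scale)
    qed
    from this[OF Suc] show ?case by simp
  qed (auto intro: L0.span_base)
  moreover have "L0.span ((\<lambda>j. x ^ j) ` {..<Suc j}) \<subseteq> L0.span ((\<lambda>j. x ^ j) ` {..<N})" if "j < N" for j
    using that by (intro L0.span_mono) auto
  ultimately show "(\<lambda>j. y ^ j) ` {..<N} \<subseteq> L0.span ((\<lambda>j. x ^ j) ` {..<N})"
    by blast
qed auto

lemma span_chi_powers:
  assumes \<beta>: "1 < cmod \<beta>"
  shows "L0.span ((\<lambda>j. tpow 1 ^ j) ` {..<N}) = L0.span ((\<lambda>j. chi \<beta> ^ j) ` {..<N})"
proof
  have b0: "cnj \<beta> \<noteq> 0" using \<beta> by auto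
  show "L0.span ((\<lambda>j. tpow 1 ^ j) ` {..<N}) \<subseteq> L0.span ((\<lambda>j. chi \<beta> ^ j) ` {..<N})"
    by (rule span_powers_affine[of _ "lam \<beta> / cnj \<beta>" _ "1 / cnj \<beta>"])
       (use b0 lam_nonzero[OF \<beta>] in \<open>auto simp: tpow_abs one_abs chi_def abs_L0_simps field_simps\<close>)
  show "L0.span ((\<lambda>j. chi \<beta> ^ j) ` {..<N}) \<subseteq> L0.span ((\<lambda>j. tpow 1 ^ j) ` {..<N})"
    by (rule span_powers_affine[of _ "cnj \<beta> / lam \<beta>" _ "- 1 / lam \<beta>"])
       (auto simp: tpow_abs one_abs chi_def abs_L0_simps diff_divide_distrib)
qed

lemma mult_linear: "Vector_Spaces.linear cscale cscale (\<lambda>q. a * q)"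
proof unfold_locales
  show "a * cscale c x = cscale c (a * x)" for c x
    by (metis cscale_eq_mult mult.left_commute)
qed (simp add: ring_distribs)

text \<open>A spanning set with at most \<open>b + c \<le> N\<close> elements in dimension N is a
  basis with exactly N. So both cardinality bounds are attained, and distinctness of the generators
  need not be shown beforehand.\<close>

lemma two_bases:
  assumes V: "L0.dim V = N" "L0.subspace V"
    and fin: "finite B" "finite C" and span: "L0.span B \<subseteq> V" "L0.span C \<subseteq> V" "V \<subseteq> L0.span (B \<union> C)"
    and card: "card B \<le> b" "card C \<le> c" "b + c \<le> N"
  shows "L0.independent B \<and> L0.dim (L0.span B) = b"
    "L0.independent C \<and> L0.dim (L0.span C) = c"
proof -
  have BC: "B \<subseteq> V" "C \<subseteq> V" using span L0.span_superset by blast+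
  have cBC: "card (B \<union> C) \<le> card B + card C" by (rule card_Un_le)
  have "L0.span (B \<union> C) = V"
    using L0.span_minimal[of "B \<union> C" V] BC V(2) span(3) by blast
  then have dim: "L0.dim (B \<union> C) = N" using V(1) L0.dim_span[of "B \<union> C"] by simp
  obtain D where D: "D \<subseteq> B \<union> C" "L0.independent D" "card D = N"
    using L0.basis_exists[of "B \<union> C"] dim by metis
  then have "D = B \<union> C"
    using fin card cBC by (intro card_seteq) auto
  then have ind: "L0.independent (B \<union> C)" and "card (B \<union> C) = N" using D by auto
  then have eq: "card B = b" "card C = c" using card cBC by linarith+
  have iB: "L0.independent B" "L0.independent C" using ind L0.independent_mono by blast+
  show "L0.independent B \<and> L0.dim (L0.span B) = b"
    "L0.independent C \<and> L0.dim (L0.span C) = c"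
    using iB eq L0.dim_span_eq_card_independent by auto
qed

section \<open>The two symmetric systems in the kernel\<close>

context
  fixes \<beta> :: complex and p q :: real and N :: nat and g gm gp :: L0
  assumes \<beta>: "1 < cmod \<beta>" and p: "1 < p" and q_def: "q = p / (p - 1)"
    and g: "g \<in> Linf" and F: "fredholm p (toeplitz g)"
    and fact: "g = gm * tpow (- int N) * gp"
    and gm: "gm * inverse gm = 1" "gm \<in> Hp_bar p" "inverse gm \<in> Hp_bar q"
    and gp: "gp * inverse gp = 1" "gp \<in> Hp q" "inverse gp \<in> Hp p"
begin

lemma q: "1 < q" "1 / p + 1 / q = 1" "1 / q + 1 / p = 1"
  using conj_exponent[OF p] by (simp_all add: q_def add.commute)

lemma ker_subspace: "L0.subspace (ker_Hp p (toeplitz g))"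
proof (rule L0.subspaceI)
  have gL: "g * x \<in> Lp 1" if "x \<in> Hp p" for x
    using that g p by (intro Lp_L1[OF p] Linf_mult_Lp) (auto simp: Hp_def)
  show "0 \<in> ker_Hp p (toeplitz g)"
    by (simp add: ker_toeplitz_iff[OF p g F] Hp_def Lp_0)
  show "x + y \<in> ker_Hp p (toeplitz g)" if "x \<in> ker_Hp p (toeplitz g)" "y \<in> ker_Hp p (toeplitz g)" for x y
    using that by (simp add: ker_toeplitz_iff[OF p g F] Hp_add[OF p] ring_distribs fourier_add gL)
  show "cscale c x \<in> ker_Hp p (toeplitz g)" if "x \<in> ker_Hp p (toeplitz g)" for c x
    using that by (simp add: ker_toeplitz_iff[OF p g F] Hp_cscale mult_cscale fourier_cscale)
qed

lemma ker_eq: "ker_Hp p (toeplitz g) = (\<lambda>f. inverse gp * f) ` L0.span ((\<lambda>j. tpow 1 ^ j) ` {..<N})"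
proof
  show "ker_Hp p (toeplitz g) \<subseteq> (\<lambda>f. inverse gp * f) ` L0.span ((\<lambda>j. tpow 1 ^ j) ` {..<N})"
  proof
    fix \<phi> assume "\<phi> \<in> ker_Hp p (toeplitz g)"
    then have \<phi>: "\<phi> \<in> Hp p" and ker: "\<And>k. k \<ge> 0 \<Longrightarrow> fourier (g * \<phi>) k = 0"
      by (auto simp: ker_toeplitz_iff[OF p g F])
    have g\<phi>: "g * \<phi> \<in> Lp p" using \<phi> g p by (intro Linf_mult_Lp) (auto simp: Hp_def)
    define f where "f = gp * \<phi>"
    have f1: "f \<in> Lp 1"
      unfolding f_def by (rule Lp_mult_L1[OF q(1) p q(3)]) (use gp \<phi> in \<open>auto simp: Hp_def\<close>)
    have low: "fourier f k = 0" if "k < 0" for k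
      unfolding f_def
    proof (rule fourier_mult_eq_0[OF q(1) p q(3)])
      show "fourier gp (k - j) * fourier \<phi> j = 0" for j
        using gp \<phi> that by (cases "j < 0") (auto simp: Hp_def)
    qed (use gp \<phi> in \<open>auto simp: Hp_def\<close>)
    have inv: "f = tpow (int N) * (inverse gm * (g * \<phi>))"
    proof -
      have "tpow (int N) * (inverse gm * (g * \<phi>)) = (tpow (int N) * tpow (- int N)) * (gm * inverse gm) * (gp * \<phi>)"
        unfolding fact by (simp only: mult_ac)
      then show ?thesis by (simp add: gm f_def)
    qed
    have high: "fourier f k = 0" if "k \<ge> int N" for k
      unfolding inv fourier_tpow_mult
    proof (rule fourier_mult_eq_0[OF q(1) p q(3)])
      show "fourier (inverse gm) (k - int N - j) * fourier (g * \<phi>) j = 0" for j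
        using gm ker[of j] that by (cases "j < 0") (auto simp: Hp_bar_def)
    qed (use gm g\<phi> in \<open>auto simp: Hp_bar_def\<close>)
    have "f \<in> L0.span ((\<lambda>j. tpow 1 ^ j) ` {..<N})"
      by (rule Laurent_polynomial_span[OF f1]) (use low high in auto)
    moreover have "\<phi> = inverse gp * f"
      unfolding f_def by (metis gp(1) mult.assoc mult.commute mult_1)
    ultimately show "\<phi> \<in> (\<lambda>f. inverse gp * f) ` L0.span ((\<lambda>j. tpow 1 ^ j) ` {..<N})"
      by (intro image_eqI)
  qed
  have gen: "inverse gp * tpow 1 ^ j \<in> ker_Hp p (toeplitz g)" if j: "j < N" for j
    unfolding ker_toeplitz_iff[OF p g F]
  proof (intro conjI allI impI)
    show "inverse gp * tpow 1 ^ j \<in> Hp p"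
    proof -
      have "inverse gp * tpow 1 ^ j = tpow (int j) * inverse gp"
        by (simp add: tpow_power mult.commute)
      then show ?thesis
        using gp(3) p Linf_mult_Lp[OF tpow_Linf, of "inverse gp" p "int j"]
        by (simp add: Hp_def fourier_tpow_mult)
    qed
    fix k :: int assume k: "k \<ge> 0"
    \<comment> \<open>The product is \<open>gm\<close> with its frequencies shifted to at most j -
      N, which is negative.\<close>
    have "g * (inverse gp * tpow 1 ^ j) = (tpow (- int N) * tpow (int j)) * gm * (gp * inverse gp)"
      unfolding fact tpow_power by (simp add: mult_ac)
    also have "\<dots> = tpow (int j - int N) * gm"
      by (simp add: gp(1) flip: tpow_add)
    finally show "fourier (g * (inverse gp * tpow 1 ^ j)) k = 0"
      using gm(2) j k by (simp add: fourier_tpow_mult Hp_bar_def)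
  qed
  have "L0.span ((\<lambda>f. inverse gp * f) ` (\<lambda>j. tpow 1 ^ j) ` {..<N}) \<subseteq> ker_Hp p (toeplitz g)"
    by (rule L0.span_minimal[OF _ ker_subspace]) (use gen in auto)
  then show "(\<lambda>f. inverse gp * f) ` L0.span ((\<lambda>j. tpow 1 ^ j) ` {..<N}) \<subseteq> ker_Hp p (toeplitz g)"
    by (simp add: L0_pair.linear_span_image[OF mult_linear])
qed

text \<open>Powers of \<open>chi\<close> instead of t, because the shift inverts \<open>chi\<close>;
  so the operator permutes these generators up to a scalar.\<close>

definition ker_gen :: "nat \<Rightarrow> L0" where
  "ker_gen j = inverse gp * chi \<beta> ^ j"

lemma ker_span: "ker_Hp p (toeplitz g) = L0.span (ker_gen ` {..<N})"
  unfolding ker_eq span_chi_powers[OF \<beta>] L0_pair.linear_span_image[OF mult_linear, symmetric] image_image ker_gen_def ..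

lemma inj_mult_inverse_gp: "inj (\<lambda>f. inverse gp * f)"
  using gp(1) by (intro injI) (metis mult.assoc mult_1)

lemma dim_ker: "L0.dim (ker_Hp p (toeplitz g)) = N"
proof -
  have e: "(\<lambda>j. tpow 1 ^ j) ` {..<N} = tpow ` int ` {..<N}"
    by (auto simp: tpow_power image_image)
  have "L0.independent ((\<lambda>f. inverse gp * f) ` tpow ` int ` {..<N})"
    by (rule L0_pair.linear_independent_injective_image[OF mult_linear independent_tpow])
       (rule inj_on_subset[OF inj_mult_inverse_gp], simp)
  then have "L0.dim (ker_Hp p (toeplitz g)) = card ((\<lambda>f. inverse gp * f) ` tpow ` int ` {..<N})"
    unfolding ker_eq e L0_pair.linear_span_image[OF mult_linear, symmetric]
    by (rule L0.dim_span_eq_card_independent)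
  also have "\<dots> = N"
    by (simp add: card_image inj_on_subset[OF inj_mult_inverse_gp] inj_on_subset[OF inj_tpow])
  finally show ?thesis .
qed

text \<open>The form of \<open>P_alpha\<close> on the kernel, where
  \<open>riesz_P \<phi> = \<phi>\<close> and \<open>riesz_P (g * \<phi>) = 0\<close>. Free of
  projections, it is linear on all classes.\<close>

definition ker_involution :: "L0 \<Rightarrow> L0" where
  "ker_involution \<phi> = inverse (chi \<beta>) * comp_alpha \<beta> (g * \<phi>)"

lemma P_alpha_ker: "\<phi> \<in> ker_Hp p (toeplitz g) \<Longrightarrow> P_alpha \<beta> g \<phi> = ker_involution \<phi>"
  by (simp add: P_alpha_def J_alpha_def ker_involution_def riesz_Q_def ker_Hp_def toeplitz_def riesz_P_Hp[OF p])

lemma ker_involution_linear: "Vector_Spaces.linear cscale cscale ker_involution"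
  by unfold_locales
     (simp_all add: ker_involution_def ring_distribs comp_alpha_simps[OF \<beta>] mult_cscale)

section \<open>The action of the involution on the generators\<close>

context
  assumes inv: "g * comp_alpha \<beta> g = 1" and norm: "at_infty gm = 1" and Npos: "N > 0"
begin

lemma ker_involution_involutive: "ker_involution (ker_involution \<phi>) = \<phi>"
proof -
  have "ker_involution (ker_involution \<phi>) = (inverse (chi \<beta>) * comp_alpha \<beta> (inverse (chi \<beta>))) * (g * comp_alpha \<beta> g) * \<phi>"
    by (simp add: ker_involution_def comp_alpha_simps[OF \<beta>] comp_alpha_involutive[OF \<beta>] mult_ac)
  also have "inverse (chi \<beta>) * comp_alpha \<beta> (inverse (chi \<beta>)) = 1"
    using chi_inverse[OF \<beta>] comp_alpha_chi[OF \<beta>] comp_alpha_involutive[OF \<beta>, of "chi \<beta>"]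
    by (simp add: mult.commute)
  finally show ?thesis by (simp add: inv)
qed

text \<open>Both sides of \<open>gp * gm\<^sub>\<alpha> / (t - \<beta>)\<^sup>N = (t / (cnj \<beta> * t - 1))\<^sup>N / (gm * gp\<^sub>\<alpha>)\<close> are integrable, the left
  one is analytic in the disc and the right one outside it, so they are constant.\<close>

lemma factor_symmetry: "\<exists>c. gp * comp_alpha \<beta> gm = cscale c (lin_out \<beta> ^ N)"
proof -
  define b where "b = gp * comp_alpha \<beta> gm"
  define e where "e = inverse gm * comp_alpha \<beta> (inverse gp)"
  define a where "a = inverse (lin_out \<beta>) ^ N * b"
  have gmL: "gm \<in> Lp p" "\<And>k. k > 0 \<Longrightarrow> fourier gm k = 0" and gpL: "inverse gp \<in> Lp p" "\<And>k. k < 0 \<Longrightarrow> fourier (inverse gp) k = 0"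
    using gm gp by (auto simp: Hp_bar_def Hp_def)
  have b1: "b \<in> Lp 1"
    unfolding b_def
    by (rule Lp_mult_L1[OF q(1) p q(3)]) (use gp in \<open>auto simp: Hp_def intro: comp_alpha_Lp[OF \<beta> gmL(1)]\<close>)
  have bneg: "fourier b k = 0" if "k < 0" for k
    unfolding b_def
  proof (rule fourier_mult_eq_0[OF q(1) p q(3)])
    show "fourier gp (k - j) * fourier (comp_alpha \<beta> gm) j = 0" for j
      using gp that comp_alpha_coanalytic[OF \<beta> Lp_L1[OF p gmL(1)] gmL(2), of j]
      by (cases "j < 0") (auto simp: Hp_def)
  qed (use gp in \<open>auto simp: Hp_def intro: comp_alpha_Lp[OF \<beta> gmL(1)]\<close>)
  have e1: "e \<in> Lp 1"
    unfolding e_def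
    by (rule Lp_mult_L1[OF q(1) p q(3)]) (use gm in \<open>auto simp: Hp_bar_def intro: comp_alpha_Lp[OF \<beta> gpL(1)]\<close>)
  have epos: "fourier e k = 0" if "k > 0" for k
    unfolding e_def
  proof (rule fourier_mult_eq_0[OF q(1) p q(3)])
    show "fourier (inverse gm) (k - j) * fourier (comp_alpha \<beta> (inverse gp)) j = 0" for j
      using gm that comp_alpha_analytic[OF \<beta> Lp_L1[OF p gpL(1)] gpL(2), of j]
      by (cases "j > 0") (auto simp: Hp_bar_def)
  qed (use gm in \<open>auto simp: Hp_bar_def intro: comp_alpha_Lp[OF \<beta> gpL(1)]\<close>)
  have ainv: "comp_alpha \<beta> gp * comp_alpha \<beta> (inverse gp) = 1"
    unfolding comp_alpha_simps(2)[OF \<beta>, symmetric] gp(1) by (rule comp_alpha_simps(5)[OF \<beta>])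
  have t1: "tpow (int N) = tpow 1 ^ N" by (simp add: tpow_power)
  have at: "comp_alpha \<beta> (tpow (- int N)) * comp_alpha \<beta> (tpow 1 ^ N) = 1"
    unfolding t1[symmetric] comp_alpha_simps(2)[OF \<beta>, symmetric] by (simp add: comp_alpha_simps[OF \<beta>])
  \<comment> \<open>Solving \<open>g * comp_alpha \<beta> g = 1\<close> for b leaves the N-th powers
    of t and of \<alpha> next to e.\<close>
  have be: "b = e * (tpow 1 ^ N * comp_alpha \<beta> (tpow 1 ^ N))"
  proof -
    have "e * (tpow 1 ^ N * comp_alpha \<beta> (tpow 1 ^ N))
      = e * (tpow (int N) * comp_alpha \<beta> (tpow 1 ^ N)) * (g * comp_alpha \<beta> g)"
      by (simp add: inv t1)
    also have "\<dots> = b * (gm * inverse gm) * (comp_alpha \<beta> gp * comp_alpha \<beta> (inverse gp))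
        * (tpow (int N) * tpow (- int N)) * (comp_alpha \<beta> (tpow (- int N)) * comp_alpha \<beta> (tpow 1 ^ N))"
      unfolding fact e_def b_def comp_alpha_simps(2)[OF \<beta>] by (simp only: mult_ac)
    also have "\<dots> = b" by (simp add: gm ainv at)
    finally show ?thesis ..
  qed
  \<comment> \<open>This absorbs the division by \<open>lin_out\<close> in the definition of a into
    a division by \<open>lin_in\<close>, whose zero is inside the disc. So a also has a form with
    nonpositive spectrum.\<close>
  have ate: "comp_alpha \<beta> (tpow 1) * inverse (lin_out \<beta>) = inverse (lin_in \<beta>)"
  proof -
    have "comp_alpha \<beta> (tpow 1) * inverse (lin_out \<beta>)
      = inverse (lin_in \<beta>) * comp_alpha \<beta> (tpow 1 * tpow (- 1))"
      by (simp only: inverse_lin_out[OF \<beta>] comp_alpha_simps[OF \<beta>] mult_ac)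
    then show ?thesis by (simp add: comp_alpha_simps[OF \<beta>])
  qed
  have a': "a = (tpow 1 * inverse (lin_in \<beta>)) ^ N * e"
    unfolding a_def be ate[symmetric] comp_alpha_power[OF \<beta>] power_mult_distrib by (simp only: mult_ac)
  have a1: "a \<in> Lp 1"
    unfolding a_def by (intro Linf_mult_Lp Linf_power inverse_lin_out_Linf[OF \<beta>] b1) simp
  have "a = cscale (fourier a 0) 1"
  proof (rule fourier_unique[OF a1])
    show "cscale (fourier a 0) 1 \<in> Lp 1" by (intro Lp_cscale Lp_1)
    show "fourier a k = fourier (cscale (fourier a 0) 1) k" for k
      using inverse_lin_out_power_analytic[OF \<beta> b1 bneg, of k N]
        inverse_lin_in_power_coanalytic[OF \<beta> e1 epos, of k N]
      by (cases k "0 :: int" rule: linorder_cases) (auto simp: fourier_cscale fourier_1 a_def[symmetric] a'[symmetric])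
  qed
  then have "lin_out \<beta> ^ N * a = lin_out \<beta> ^ N * cscale (fourier a 0) 1"
    by (rule arg_cong)
  then have "lin_out \<beta> ^ N * a = cscale (fourier a 0) (lin_out \<beta> ^ N)"
    by (simp only: mult_cscale mult_1_right)
  moreover have "lin_out \<beta> ^ N * a = b"
    unfolding a_def mult.assoc[symmetric] power_mult_distrib[symmetric] lin_inverse[OF \<beta>] by simp
  ultimately show ?thesis unfolding b_def by auto
qed

lemma ker_gen_0_nonzero: "ker_gen 0 \<noteq> 0"
  using gp(1) by (auto simp: ker_gen_def)

lemma ker_involution_ker_gen:
  "(alpha_signature \<beta> (int N) gp)\<^sup>2 = 1"
  "j < N \<Longrightarrow> ker_involution (ker_gen j) = cscale (alpha_signature \<beta> (int N) gp) (ker_gen (N - 1 - j))"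
proof -
  obtain c where c: "gp * comp_alpha \<beta> gm = cscale c (lin_out \<beta> ^ N)"
    using factor_symmetry by blast
  have gma: "comp_alpha \<beta> gm = cscale c (lin_out \<beta> ^ N * inverse gp)"
  proof -
    have "comp_alpha \<beta> gm = (gp * inverse gp) * comp_alpha \<beta> gm" by (simp add: gp)
    also have "\<dots> = (gp * comp_alpha \<beta> gm) * inverse gp" by (simp only: mult_ac)
    finally show ?thesis by (simp add: c mult_cscale)
  qed
  \<comment> \<open>The shifted \<open>tpow (- int N)\<close> turns
    \<open>lin_out \<beta> ^ N\<close> into \<open>lin_in \<beta> ^ N\<close>, which is
    \<open>lam \<beta> ^ N\<close> times \<open>chi \<beta> ^ N\<close>; hence the second
    factor.\<close>
  define \<epsilon> where "\<epsilon> = c * lam \<beta> ^ N"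
  have involution_gen: "ker_involution (ker_gen j) = cscale \<epsilon> (ker_gen (N - 1 - j))" if j: "j < N" for j
  proof -
    \<comment> \<open>Of the N factors \<open>chi\<close>, j cancel against the shifted
      \<open>chi \<beta> ^ j\<close> and one against the weight in \<open>J_alpha\<close>, whence
      the index N - 1 - j.\<close>
    have chik: "chi \<beta> ^ N * inverse (chi \<beta>) ^ Suc j = chi \<beta> ^ (N - 1 - j)"
    proof -
      have "chi \<beta> ^ N = chi \<beta> ^ (N - 1 - j) * chi \<beta> ^ Suc j"
        using j by (simp only: power_add[symmetric]) simp
      then have "chi \<beta> ^ N * inverse (chi \<beta>) ^ Suc j = chi \<beta> ^ (N - 1 - j) * (chi \<beta> * inverse (chi \<beta>)) ^ Suc j"
        by (simp only: power_mult_distrib mult.assoc)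
      then show ?thesis by (simp add: chi_inverse[OF \<beta>])
    qed
    have lo: "lin_out \<beta> * comp_alpha \<beta> (tpow (- 1)) = lin_in \<beta>"
    proof -
      have "lin_out \<beta> * comp_alpha \<beta> (tpow (- 1)) = lin_in \<beta> * comp_alpha \<beta> (tpow 1 * tpow (- 1))"
        by (simp only: lin_in_alpha[OF \<beta>, symmetric] comp_alpha_simps[OF \<beta>] mult_ac)
      then show ?thesis by (simp add: comp_alpha_simps[OF \<beta>])
    qed
    have tN: "tpow (- int N) = tpow (- 1) ^ N" by (simp add: tpow_power)
    have "g * ker_gen j = gm * tpow (- int N) * (gp * inverse gp) * chi \<beta> ^ j"
      unfolding fact ker_gen_def by (simp only: mult_ac)
    then have "ker_involution (ker_gen j) = inverse (chi \<beta>) * (comp_alpha \<beta> gm * comp_alpha \<beta> (tpow (- int N))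
        * comp_alpha \<beta> (gp * inverse gp) * inverse (chi \<beta>) ^ j)"
      by (simp only: ker_involution_def comp_alpha_simps(2)[OF \<beta>] comp_alpha_power[OF \<beta>] comp_alpha_chi[OF \<beta>])
    also have "\<dots> = cscale c ((lin_out \<beta> * comp_alpha \<beta> (tpow (- 1))) ^ N * inverse gp * inverse (chi \<beta>) ^ Suc j)"
      unfolding gma tN comp_alpha_power[OF \<beta>] gp(1) comp_alpha_simps(5)[OF \<beta>] mult_cscale power_mult_distrib
      by (simp add: mult_ac)
    also have "\<dots> = cscale c (inverse gp * (lin_in \<beta> ^ N * inverse (chi \<beta>) ^ Suc j))"
      unfolding lo by (simp only: mult_ac)
    also have "lin_in \<beta> ^ N = cscale (lam \<beta> ^ N) (chi \<beta> ^ N)"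
    proof (induction N)
      case (Suc N)
      then show ?case by (simp add: lin_in_chi[OF \<beta>] mult_cscale)
    qed simp
    also have "cscale c (inverse gp * (cscale (lam \<beta> ^ N) (chi \<beta> ^ N) * inverse (chi \<beta>) ^ Suc j))
      = cscale \<epsilon> (ker_gen (N - 1 - j))"
      unfolding mult_cscale chik \<epsilon>_def ker_gen_def by simp
    finally show ?thesis .
  qed
  have \<epsilon>2: "\<epsilon> * \<epsilon> = 1"
  proof -
    interpret sh: Vector_Spaces.linear cscale cscale ker_involution by (rule ker_involution_linear)
    have "ker_gen 0 = ker_involution (ker_involution (ker_gen 0))" by (simp add: ker_involution_involutive)
    also have "\<dots> = cscale (\<epsilon> * \<epsilon>) (ker_gen 0)"
      using Npos by (simp add: involution_gen sh.scale)
    finally have "cscale (\<epsilon> * \<epsilon> - 1) (ker_gen 0) = 0"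
      by (simp add: L0.scale_left_diff_distrib)
    then show ?thesis using ker_gen_0_nonzero by simp
  qed
  have "\<epsilon> * alpha_signature \<beta> (int N) gp = 1"
  proof -
    have b0: "cnj \<beta> \<noteq> 0" using \<beta> by auto
    have gmL: "gm \<in> Lp 1" "\<And>k. k > 0 \<Longrightarrow> fourier gm k = 0" and
      gpL: "inverse gp \<in> Lp 1" "\<And>k. k < 0 \<Longrightarrow> fourier (inverse gp) k = 0"
      using gm gp Lp_L1[OF p] by (auto simp: Hp_bar_def Hp_def)
    have "1 = disc_ext (comp_alpha \<beta> gm) (1 / cnj \<beta>)"
      using disc_ext_comp_alpha[OF \<beta> gmL] norm by (simp add: at_infty_def)
    also have "\<dots> = c * disc_ext (lin_out \<beta> ^ N * inverse gp) (1 / cnj \<beta>)"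
      unfolding gma using gpL(1)
      by (intro disc_ext_cscale[OF \<beta>] Linf_mult_Lp Linf_power lin_Linf[OF \<beta>]) auto
    also have "\<dots> = c * ((1 / cnj \<beta> - \<beta>) ^ N * disc_ext (inverse gp) (1 / cnj \<beta>))"
      by (simp add: disc_ext_lin_out_power[OF \<beta> gpL])
    \<comment> \<open>The first factor \<open>lam \<beta>\<close> goes into \<epsilon>, the quotient
      into the signature.\<close>
    also have "1 / cnj \<beta> - \<beta> = lam \<beta> * (lam \<beta> / cnj \<beta>)"
      using lam_square[OF \<beta>] b0 by (simp add: field_simps)
    finally have "c * ((lam \<beta> * (lam \<beta> / cnj \<beta>)) ^ N * disc_ext (inverse gp) (1 / cnj \<beta>)) = 1" ..
    then show ?thesis
      by (simp only: \<epsilon>_def alpha_signature_def power_int_of_nat power_mult_distrib mult_ac)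
  qed
  then have eq: "\<epsilon> = alpha_signature \<beta> (int N) gp"
    using \<epsilon>2 by (metis mult.assoc mult.commute mult_1)
  show "(alpha_signature \<beta> (int N) gp)\<^sup>2 = 1"
    using \<epsilon>2 eq by (simp add: power2_eq_square)
  show "j < N \<Longrightarrow> ker_involution (ker_gen j) = cscale (alpha_signature \<beta> (int N) gp) (ker_gen (N - 1 - j))"
    using involution_gen eq by simp
qed

text \<open>Up to the factor 1/2 this is the image of \<open>ker_gen j\<close> under the projection
  with sign s, where \<tau> is s times the signature.\<close>

definition sym_gen :: "complex \<Rightarrow> nat \<Rightarrow> L0" where
  "sym_gen \<tau> j = ker_gen j + cscale \<tau> (ker_gen (N - 1 - j))"

lemma im_P_alpha_span:
  "im_P_alpha p \<beta> g s = L0.span (sym_gen (s * alpha_signature \<beta> (int N) gp) ` {..<N})"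
proof -
  define L where "L \<phi> = cscale (1/2) (\<phi> + cscale s (ker_involution \<phi>))" for \<phi>
  interpret sh: Vector_Spaces.linear cscale cscale ker_involution by (rule ker_involution_linear)
  have lin: "Vector_Spaces.linear cscale cscale L"
    by unfold_locales (simp_all add: L_def sh.add sh.scale L0.scale_right_distrib algebra_simps)
  have "im_P_alpha p \<beta> g s = L ` ker_Hp p (toeplitz g)"
    unfolding im_P_alpha_def by (intro image_cong) (auto simp: P_alpha_proj_def L_def P_alpha_ker)
  also have "\<dots> = L0.span (L ` ker_gen ` {..<N})"
    unfolding ker_span by (rule L0_pair.linear_span_image[OF lin, symmetric])
  also have "L ` ker_gen ` {..<N} = cscale (1/2) ` sym_gen (s * alpha_signature \<beta> (int N) gp) ` {..<N}"
    unfolding image_image by (intro image_cong) (auto simp: L_def sym_gen_def ker_involution_ker_gen)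
  also have "L0.span \<dots> = L0.span (sym_gen (s * alpha_signature \<beta> (int N) gp) ` {..<N})"
  proof -
    have "L0.span (cscale (1/2) ` S) = cscale (1/2) ` L0.span S" for S
      using L0_pair.linear_span_image[OF L0.linear_scale_self] by auto
    moreover have "cscale (1/2) ` L0.span S = L0.span S" for S
    proof
      show "L0.span S \<subseteq> cscale (1/2) ` L0.span S"
      proof
        fix x assume "x \<in> L0.span S"
        then have "cscale 2 x \<in> L0.span S" by (rule L0.span_scale)
        moreover have "x = cscale (1/2) (cscale 2 x)" by simp
        ultimately show "x \<in> cscale (1/2) ` L0.span S" by blast
      qed
    qed (auto intro: L0.span_scale)
    ultimately show ?thesis by simp
  qed
  finally show ?thesis .
qed

text \<open>Reflecting the index costs only the scalar \<tau>, so one index out of each pair j, N -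
  1 - j suffices for the span.\<close>

lemma sym_gen_reflect:
  assumes "\<tau> * \<tau> = 1" "j < N"
  shows "sym_gen \<tau> (N - 1 - j) = cscale \<tau> (sym_gen \<tau> j)"
  using assms by (simp add: sym_gen_def L0.scale_right_distrib add.commute)

text \<open>Both signs are treated together: half the sum of the two generators with index j is
  \<open>ker_gen j\<close>, so the union of the systems spans the kernel, and the count gives
  independence of each.\<close>

lemma bases_from_generators:
  assumes fin: "finite B" "finite C"
    and B: "L0.span B = L0.span (sym_gen 1 ` {..<N})" and C: "L0.span C = L0.span (sym_gen (-1) ` {..<N})"
    and card: "card B \<le> m" "card C \<le> k" "m + k \<le> N"
  shows "is_basis B (L0.span (sym_gen 1 ` {..<N})) \<and> L0.dim (L0.span (sym_gen 1 ` {..<N})) = m"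
    "is_basis C (L0.span (sym_gen (-1) ` {..<N})) \<and> L0.dim (L0.span (sym_gen (-1) ` {..<N})) = k"
proof -
  have bV: "sym_gen \<tau> j \<in> ker_Hp p (toeplitz g)" if "j < N" for \<tau> j
    unfolding sym_gen_def ker_span
    by (intro L0.span_add L0.span_scale L0.span_base) (use that in auto)
  have sub: "L0.span (sym_gen \<tau> ` {..<N}) \<subseteq> ker_Hp p (toeplitz g)" for \<tau>
    by (rule L0.span_minimal[OF _ ker_subspace]) (use bV in auto)
  have "ker_gen j \<in> L0.span (B \<union> C)" if "j < N" for j
  proof -
    have "sym_gen 1 j \<in> L0.span (B \<union> C)" "sym_gen (-1) j \<in> L0.span (B \<union> C)"
      using that B C L0.span_mono[of B "B \<union> C"] L0.span_mono[of C "B \<union> C"]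
        L0.span_base[of "sym_gen 1 j" "sym_gen 1 ` {..<N}"] L0.span_base[of "sym_gen (-1) j" "sym_gen (-1) ` {..<N}"]
      by auto
    then have "cscale (1/2) (sym_gen 1 j + sym_gen (-1) j) \<in> L0.span (B \<union> C)"
      by (intro L0.span_scale L0.span_add)
    moreover have "cscale (1/2) (sym_gen 1 j + sym_gen (-1) j) = ker_gen j"
    proof -
      have "sym_gen 1 j + sym_gen (-1) j = cscale 2 (ker_gen j)"
        by (simp add: sym_gen_def L0.scale_left_distrib[of 1 1, simplified])
      then show ?thesis by simp
    qed
    ultimately show ?thesis by simp
  qed
  then have "ker_Hp p (toeplitz g) \<subseteq> L0.span (B \<union> C)"
    unfolding ker_span by (intro L0.span_minimal) auto
  from two_bases[OF dim_ker ker_subspace fin _ _ this card] B C sub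
  show "is_basis B (L0.span (sym_gen 1 ` {..<N})) \<and> L0.dim (L0.span (sym_gen 1 ` {..<N})) = m"
    "is_basis C (L0.span (sym_gen (-1) ` {..<N})) \<and> L0.dim (L0.span (sym_gen (-1) ` {..<N})) = k"
    by (auto simp: is_basis_def)
qed

lemma half_span:
  assumes \<tau>: "\<tau> * \<tau> = 1" and B: "B \<subseteq> sym_gen \<tau> ` {..<N}"
    and half: "\<And>j. j < N \<Longrightarrow> sym_gen \<tau> j \<in> L0.span B \<or> sym_gen \<tau> (N - 1 - j) \<in> L0.span B"
  shows "L0.span B = L0.span (sym_gen \<tau> ` {..<N})"
proof
  show "L0.span B \<subseteq> L0.span (sym_gen \<tau> ` {..<N})" using B by (rule L0.span_mono)
  have "sym_gen \<tau> j \<in> L0.span B" if j: "j < N" for j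
    using half[OF j]
  proof
    assume "sym_gen \<tau> (N - 1 - j) \<in> L0.span B"
    then have "cscale \<tau> (sym_gen \<tau> (N - 1 - j)) \<in> L0.span B" by (rule L0.span_scale)
    then show ?thesis unfolding sym_gen_reflect[OF \<tau> j] using \<tau> by simp
  qed
  then show "L0.span (sym_gen \<tau> ` {..<N}) \<subseteq> L0.span B"
    by (intro L0.span_minimal) auto
qed

lemma even_bases:
  assumes N: "N = 2 * m" and s: "s \<in> {1, -1}"
  defines "\<tau> \<equiv> s * alpha_signature \<beta> (int N) gp"
  shows "is_basis {inverse gp * (chi \<beta> ^ (m - k - 1) + cscale \<tau> (chi \<beta> ^ (m + k))) | k. k < m}
      (im_P_alpha p \<beta> g s) \<and> L0.dim (im_P_alpha p \<beta> g s) = m"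
proof -
  \<comment> \<open>Kept as a function of \<tau>: the count needs the systems for 1 and -1 at once,
    whichever of them s times the signature is.\<close>
  define B where "B \<tau> = {inverse gp * (chi \<beta> ^ (m - k - 1) + cscale \<tau> (chi \<beta> ^ (m + k))) | k. k < m}" for \<tau>
  have Bb: "B \<tau> = sym_gen \<tau> ` {..<m}" for \<tau>
  proof -
    \<comment> \<open>With N = 2 m the mirror image of the index m - k - 1 is m + k.\<close>
    have "inverse gp * (chi \<beta> ^ (m - k - 1) + cscale \<tau> (chi \<beta> ^ (m + k))) = sym_gen \<tau> (m - k - 1)" if "k < m" for k
      unfolding sym_gen_def ker_gen_def using that N by (simp add: ring_distribs mult_cscale)
    then have "(\<lambda>k. inverse gp * (chi \<beta> ^ (m - k - 1) + cscale \<tau> (chi \<beta> ^ (m + k)))) ` {..<m}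
        = (\<lambda>k. sym_gen \<tau> (m - k - 1)) ` {..<m}"
      by (intro image_cong) auto
    then have "B \<tau> = (\<lambda>k. sym_gen \<tau> (m - k - 1)) ` {..<m}"
      unfolding B_def by blast
    also have "\<dots> = sym_gen \<tau> ` (\<lambda>k. m - k - 1) ` {..<m}" by (simp add: image_image)
    also have "(\<lambda>k. m - k - 1) ` {..<m} = {..<m}"
    proof
      show "{..<m} \<subseteq> (\<lambda>k. m - k - 1) ` {..<m}"
        by (rule subsetI, rule_tac x="m - x - 1" in image_eqI) auto
    qed auto
    finally show ?thesis .
  qed
  have span: "L0.span (B \<tau>) = L0.span (sym_gen \<tau> ` {..<N})" if "\<tau> * \<tau> = 1" for \<tau>
  proof (rule half_span[OF that])
    show "sym_gen \<tau> j \<in> L0.span (B \<tau>) \<or> sym_gen \<tau> (N - 1 - j) \<in> L0.span (B \<tau>)" if "j < N" for j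
    proof (cases "j < m")
      case False
      then have "N - 1 - j < m" using that N by auto
      then show ?thesis unfolding Bb by (auto intro: L0.span_base)
    qed (auto simp: Bb intro: L0.span_base)
  qed (use N in \<open>auto simp: Bb\<close>)
  have card: "finite (B \<tau>)" "card (B \<tau>) \<le> m" for \<tau>
    unfolding Bb using card_image_le[of "{..<m}" "sym_gen \<tau>"] by auto
  have "\<tau>\<^sup>2 = 1" using s ker_involution_ker_gen(1) by (auto simp: \<tau>_def power_mult_distrib)
  then have "\<tau> = 1 \<or> \<tau> = -1" by (simp add: power2_eq_1_iff)
  moreover note bases_from_generators[of "B 1" "B (-1)" m m] span[of 1] span[of "-1"] card N
  ultimately have "is_basis (B \<tau>) (L0.span (sym_gen \<tau> ` {..<N})) \<and> L0.dim (L0.span (sym_gen \<tau> ` {..<N})) = m"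
    by auto
  then show ?thesis unfolding im_P_alpha_span \<tau>_def[symmetric] B_def .
qed

text \<open>For odd N the middle index m is its own mirror image, and its generator is
  \<open>1 + \<tau>\<close> times \<open>ker_gen m\<close>. It vanishes for \<tau> = -1, which is
  why 0 is removed and where the summand \<open>(1 + \<tau>) / 2\<close> of the dimension comes
  from.\<close>

lemma odd_bases:
  assumes N: "N = 2 * m + 1" and s: "s \<in> {1, -1}"
  defines "\<tau> \<equiv> s * alpha_signature \<beta> (int N) gp"
  shows "is_basis ({inverse gp * (chi \<beta> ^ (m + k) + cscale \<tau> (chi \<beta> ^ (m - k))) | k. k \<le> m} - {0})
      (im_P_alpha p \<beta> g s) \<and> of_nat (L0.dim (im_P_alpha p \<beta> g s)) = of_nat m + (1 + \<tau>) / 2"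
proof -
  define B where "B \<tau> = {inverse gp * (chi \<beta> ^ (m + k) + cscale \<tau> (chi \<beta> ^ (m - k))) | k. k \<le> m} - {0}" for \<tau>
  have Bb: "B \<tau> = sym_gen \<tau> ` {m..<N} - {0}" for \<tau>
  proof -
    have "inverse gp * (chi \<beta> ^ (m + k) + cscale \<tau> (chi \<beta> ^ (m - k))) = sym_gen \<tau> (m + k)" if "k \<le> m" for k
      unfolding sym_gen_def ker_gen_def using that N by (simp add: ring_distribs mult_cscale)
    then have "(\<lambda>k. inverse gp * (chi \<beta> ^ (m + k) + cscale \<tau> (chi \<beta> ^ (m - k)))) ` {..m}
        = (\<lambda>k. sym_gen \<tau> (m + k)) ` {..m}"
      by (intro image_cong) auto
    then have "B \<tau> = (\<lambda>k. sym_gen \<tau> (m + k)) ` {..m} - {0}"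
      unfolding B_def by blast
    also have "\<dots> = sym_gen \<tau> ` (\<lambda>k. m + k) ` {..m} - {0}" by (simp add: image_image)
    also have "(\<lambda>k. m + k) ` {..m} = {m..<N}"
    proof
      show "{m..<N} \<subseteq> (\<lambda>k. m + k) ` {..m}"
        by (rule subsetI, rule_tac x="x - m" in image_eqI) (use N in auto)
    qed (use N in auto)
    finally show ?thesis .
  qed
  have span: "L0.span (B \<tau>) = L0.span (sym_gen \<tau> ` {..<N})" if "\<tau> * \<tau> = 1" for \<tau>
  proof (rule half_span[OF that])
    have mem: "sym_gen \<tau> j \<in> L0.span (B \<tau>)" if "m \<le> j" "j < N" for j
      using that by (cases "sym_gen \<tau> j = 0") (auto simp: Bb L0.span_zero intro: L0.span_base)
    show "sym_gen \<tau> j \<in> L0.span (B \<tau>) \<or> sym_gen \<tau> (N - 1 - j) \<in> L0.span (B \<tau>)" if "j < N" for j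
      using mem[of j] mem[of "N - 1 - j"] that N by linarith
  qed (auto simp: Bb)
  have fin: "finite (B \<tau>)" for \<tau> by (simp add: Bb)
  have "card (B 1) \<le> card (sym_gen 1 ` {m..<N})" unfolding Bb by (intro card_mono) auto
  also have "\<dots> \<le> m + 1" using card_image_le[of "{m..<N}" "sym_gen 1"] N by simp
  finally have c1: "card (B 1) \<le> m + 1" .
  have "N - 1 - m = m" using N by simp
  then have "sym_gen (-1) m = 0" by (simp add: sym_gen_def)
  then have "sym_gen (-1) ` {m..<N} - {0} \<subseteq> sym_gen (-1) ` {m + 1..<N}"
    by (auto simp: image_iff) (metis Suc_leI atLeastLessThan_iff le_neq_implies_less)
  then have "card (B (-1)) \<le> card (sym_gen (-1) ` {m + 1..<N})" unfolding Bb by (intro card_mono) auto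
  also have "\<dots> \<le> m" using card_image_le[of "{m + 1..<N}" "sym_gen (-1)"] N by simp
  finally have c2: "card (B (-1)) \<le> m" .
  have "\<tau>\<^sup>2 = 1" using s ker_involution_ker_gen(1) by (auto simp: \<tau>_def power_mult_distrib)
  then have \<tau>: "\<tau> = 1 \<or> \<tau> = -1" by (simp add: power2_eq_1_iff)
  note bases = bases_from_generators[OF fin[of 1] fin[of "-1"] _ _ c1 c2]
  have "is_basis (B \<tau>) (L0.span (sym_gen \<tau> ` {..<N})) \<and>
      of_nat (L0.dim (L0.span (sym_gen \<tau> ` {..<N}))) = of_nat m + (1 + \<tau>) / 2"
    using \<tau> bases span[of 1] span[of "-1"] N by auto
  then show ?thesis unfolding im_P_alpha_span \<tau>_def[symmetric] B_def .
qed

end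

end

theorem theorem4p3:
  fixes \<beta> :: complex and p :: real and n :: int and g gm gp :: L0
  assumes "1 < cmod \<beta>"
    and "1 < p"
    and "g \<in> Linf"
    and "g * comp_alpha \<beta> g = 1"
    and "fredholm p (toeplitz g)"
    and "n = fredholm_index p (toeplitz g)"
    and "n > 0"
    and "wiener_hopf p g n gm gp"
  shows "(\<forall>m::nat. n = 2 * int m \<longrightarrow>
            (\<forall>s\<in>{1, -1}.
              is_basis
                {inverse gp * (chi \<beta> ^ (m - k - 1) + cscale (s * alpha_signature \<beta> n gp) (chi \<beta> ^ (m + k))) | k. k < m}
                (im_P_alpha p \<beta> g s) \<and>
              L0.dim (im_P_alpha p \<beta> g s) = m))
       \<and> (\<forall>m::nat. n = 2 * int m + 1 \<longrightarrow>
            (\<forall>s\<in>{1, -1}.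
              is_basis
                ({inverse gp * (chi \<beta> ^ (m + k) + cscale (s * alpha_signature \<beta> n gp) (chi \<beta> ^ (m - k))) | k. k \<le> m} - {0})
                (im_P_alpha p \<beta> g s) \<and>
              of_nat (L0.dim (im_P_alpha p \<beta> g s)) = of_nat m + (1 + s * alpha_signature \<beta> n gp) / 2))"
proof -
  note \<beta> = assms(1) and p = assms(2) and g = assms(3) and inv = assms(4) and F = assms(5)
  define N where "N = nat n"
  have n: "n = int N" and Npos: "N > 0" using assms(7) by (simp_all add: N_def)
  have wh: "g = gm * tpow (- int N) * gp" "at_infty gm = 1"
    "gm * inverse gm = 1" "gp * inverse gp = 1" "gp \<in> Hp (p / (p - 1))" "inverse gp \<in> Hp p"
    "gm \<in> Hp_bar p" "inverse gm \<in> Hp_bar (p / (p - 1))"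
    using assms(8) by (auto simp: wiener_hopf_def Let_def n)
  \<comment> \<open>Here \<open>refl\<close> instantiates the exponent q of the context with
    \<open>p / (p - 1)\<close>.\<close>
  note ctxt = \<beta> p refl g F wh(1,3,7,8,4,5,6) inv wh(2) Npos
  show ?thesis
  proof (intro conjI allI impI ballI)
    fix m :: nat and s :: complex
    assume "n = 2 * int m" and s: "s \<in> {1, -1}"
    then have "N = 2 * m" using n by linarith
    from even_bases[OF ctxt this s]
    show "is_basis {inverse gp * (chi \<beta> ^ (m - k - 1) + cscale (s * alpha_signature \<beta> n gp) (chi \<beta> ^ (m + k))) | k. k < m}
        (im_P_alpha p \<beta> g s)" "L0.dim (im_P_alpha p \<beta> g s) = m"
      by (simp_all add: n)
  next
    fix m :: nat and s :: complex
    assume "n = 2 * int m + 1" and s: "s \<in> {1, -1}"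
    then have "N = 2 * m + 1" using n by linarith
    from odd_bases[OF ctxt this s]
    show "is_basis ({inverse gp * (chi \<beta> ^ (m + k) + cscale (s * alpha_signature \<beta> n gp) (chi \<beta> ^ (m - k))) | k. k \<le> m} - {0})
        (im_P_alpha p \<beta> g s)"
      "of_nat (L0.dim (im_P_alpha p \<beta> g s)) = of_nat m + (1 + s * alpha_signature \<beta> n gp) / 2"
      by (simp_all add: n)
  qed
qed

end
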